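(* Let $\Omega\subset\mathbb{R}^d$ be open, let $(M_p)_{p\in\mathbb{N}}$ be a weight sequence satisfying (M.1), (M.2), (M.3), let $g=[(g_\varepsilon)]\in\mathcal{G}^{\{M_p\}}(\Omega)$ with representative $(g_\varepsilon)\in\mathcal{E}_M^{\{M_p\}}(\Omega)$, and let $T\in\mathcal{D}'^{\{M_p\}}(\Omega)$ be a Roumieu ultradistribution. Assume that for every compact set $K\subset\subset\Omega$ there exist sequences $(k_i),(\ell_i),(b_i)\in\mathfrak{R}$ with $b_i\le k_i$ for all $i$ such that: (1) ($g$ is a regular generalized Roumieu ultradistribution) for every $(h_i)\in\mathfrak{R}$, $\|g_\varepsilon\|_{K,(h_i)}=O(e^{N_{(k_i)}(1/\varepsilon)})$; (2) ($g$ is strongly $R$-associated to $T$) there are $C>0$ and $\varepsilon_0\in(0,1)$ such that for every $\phi\in\mathcal{D}^{\{M_p\}}(K)$ and every $\varepsilon\in(0,\varepsilon_0)$, $|\langle g_\varepsilon-T,\phi\rangle|\le C e^{-N_{(b_i)}(1/\varepsilon)}\|\phi\|_{K,(\ell_i)}$. Then $T\in\mathcal{E}^{\{M_p\}}(\Omega)$, i.e. $T$ is (given by integration against) a Roumieu ultradifferentiable function.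
   Context: Conventions: $\mathbb{N}=\{0,1,2,\dots\}$, $\mathbb{Z}_+=\{1,2,\dots\}$. Functions are complex valued. For nets indexed by $\varepsilon\in(0,1)$, $a_\varepsilon=O(b_\varepsilon)$ means that there are $C>0$ and $\varepsilon_0\in(0,1)$ with $|a_\varepsilon|\le C b_\varepsilon$ for $\varepsilon\in(0,\varepsilon_0)$. All compact sets $K\subset\subset\Omega$ are assumed regular in the sense of Komatsu (Whitney-type regularity: finitely many connected components, and any two points $x,y$ of the same component can be joined by a rectifiable curve in $K$ of length at most $C_K|x-y|$). Weight sequence: $(M_p)_{p\in\mathbb{N}}$ is a sequence of positive numbers with $M_0=1$ such that, for some constants $c_0,H\ge1$: (M.1) $M_p^2\le M_{p-1}M_{p+1}$, $p\in\mathbb{Z}_+$; (M.2) $M_p\le c_0H^p\min_{0\le q\le p}M_{p-q}M_q$, $p\in\mathbb{N}$; (M.3) $\sum_{j=p+1}^\infty M_{j-1}/M_j\le c_0\,p\,M_p/M_{p+1}$, $p\in\mathbb{Z}_+$. For $\alpha\in\mathbb{N}^d$, $M_\alpha:=M_{|\alpha|}$. $\mathfrak{R}$ is the set of all positive monotonically increasing sequences $(r_i)_{i\in\mathbb{Z}_+}$ with $r_i\to\infty$. For $(r_i)\in\mathfrak{R}$, $N_{(r_i)}(\rho)=\sup_{p\in\mathbb{N}}\ln_+\big(\rho^p/(M_p\prod_{i=1}^pr_i)\big)$, $\rho>0$, where $\ln_+=\max(\ln,0)$. Function spaces: for $K\subset\subset\Omega$, $(r_i)\in\mathfrak{R}$,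 $\phi\in C^\infty(\Omega)$ put $\|\phi\|_{K,(r_i)}=\sup_{x\in K,\alpha\in\mathbb{N}^d}\frac{|\phi^{(\alpha)}(x)|}{M_\alpha\prod_{i\le|\alpha|}r_i}$. $\mathcal{E}^{\{M_p\}}(\Omega)$ is the space of $\phi\in C^\infty(\Omega)$ with $\|\phi\|_{K,(r_i)}<\infty$ for all $K\subset\subset\Omega$ and all $(r_i)\in\mathfrak{R}$. $\mathcal{D}^{\{M_p\}}(K)$ is the space of those $\phi\in\mathcal{E}^{\{M_p\}}(\Omega)$ with support in $K$, with the topology given by the norms $\|\cdot\|_{K,(r_i)}$, $(r_i)\in\mathfrak{R}$; $\mathcal{D}^{\{M_p\}}(\Omega)=\varinjlim_{K\subset\subset\Omega}\mathcal{D}^{\{M_p\}}(K)$, and $\mathcal{D}'^{\{M_p\}}(\Omega)$ (Roumieu ultradistributions) is its dual. $\langle g_\varepsilon,\phi\rangle=\int_\Omega g_\varepsilon\phi\,dx$. Generalized ultradistributions: $\mathcal{E}_M^{\{M_p\}}(\Omega)$ is the set of nets $(g_\varepsilon)\in(\mathcal{E}^{\{M_p\}}(\Omega))^{(0,1)}$ such that for all $K\subset\subset\Omega$ and $(h_i)\in\mathfrak{R}$ there is $(k_i)\in\mathfrak{R}$ with $\|g_\varepsilon\|_{K,(h_i)}=O(e^{N_{(k_i)}(1/\varepsilon)})$. $\mathcal{N}^{\{M_p\}}(\Omega)$ is the set of nets such that for all $K\subset\subset\Omega$ and all $(h_i),(k_i)\in\mathfrak{R}$: $\|g_\varepsilon\|_{K,(h_i)}=O(e^{-N_{(k_i)}(1/\varepsilon)})$.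 $\mathcal{G}^{\{M_p\}}(\Omega)=\mathcal{E}_M^{\{M_p\}}(\Omega)/\mathcal{N}^{\{M_p\}}(\Omega)$. *)

theory Defs
  imports "HOL-Analysis.Analysis"
begin

definition weight_seq :: "(nat \<Rightarrow> real) \<Rightarrow> bool" where
  "weight_seq M \<longleftrightarrow>
     (\<forall>p. M p > 0) \<and> M 0 = 1 \<and>
     (\<exists>c0\<ge>1. \<exists>H\<ge>1.
        (\<forall>p\<ge>1. (M p)\<^sup>2 \<le> M (p - 1) * M (p + 1)) \<and>
        (\<forall>p. M p \<le> c0 * H ^ p * Min ((\<lambda>q. M (p - q) * M q) ` {0..p})) \<and>
        (\<forall>p\<ge>1. summable (\<lambda>j. M (p + j) / M (p + j + 1)) \<and>
               (\<Sum>j. M (p + j) / M (p + j + 1)) \<le> c0 * real p * (M p / M (p + 1))))"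

text \<open>Sequences are indexed by the positive integers; the value at 0 is irrelevant.\<close>

definition roumieu_seqs :: "(nat \<Rightarrow> real) set" where
  "roumieu_seqs =
     {r. (\<forall>i\<ge>1. r i > 0) \<and> (\<forall>i\<ge>1. \<forall>j\<ge>i. r i \<le> r j) \<and> filterlim r at_top sequentially}"

text \<open>For a weight sequence \<open>M\<close> and \<open>r \<in> roumieu_seqs\<close> the supremum below is
  finite, because the \<open>p\<close>-th root of \<open>M p\<close> tends to infinity.\<close>

definition assoc_fun :: "(nat \<Rightarrow> real) \<Rightarrow> (nat \<Rightarrow> real) \<Rightarrow> real \<Rightarrow> real" where
  "assoc_fun M r \<rho> = (SUP p. max (ln (\<rho> ^ p / (M p * (\<Prod>i=1..p. r i)))) 0)"

definition path_length :: "(real \<Rightarrow> 'a::metric_space) \<Rightarrow> ennreal" where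
  "path_length \<gamma> =
     (SUP (n, t) \<in> {(n :: nat, t :: nat \<Rightarrow> real). mono t \<and> range t \<subseteq> {0..1}}.
        \<Sum>i<n. ennreal (dist (\<gamma> (t i)) (\<gamma> (t (Suc i)))))"

definition regular_compact :: "'a::metric_space set \<Rightarrow> 'a set \<Rightarrow> bool" where
  "regular_compact \<Omega> K \<longleftrightarrow>
     compact K \<and> K \<subseteq> \<Omega> \<and> finite (components K) \<and>
     (\<exists>C>0. \<forall>x y. connected_component K x y \<longrightarrow>
        (\<exists>\<gamma>. path \<gamma> \<and> path_image \<gamma> \<subseteq> K \<and> pathstart \<gamma> = x \<and> pathfinish \<gamma> = y \<and>
             path_length \<gamma> \<le> ennreal (C * dist x y)))"

definition partial :: "'n::finite \<Rightarrow> (real^'n \<Rightarrow> complex) \<Rightarrow> real^'n \<Rightarrow> complex" where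
  "partial i f x = vector_derivative (\<lambda>t. f (x + t *\<^sub>R axis i 1)) (at 0)"

text \<open>A function is infinitely differentiable on the open set \<open>\<Omega>\<close> if all its iterated partial
  derivatives, in any order, are differentiable there. Values off \<open>\<Omega>\<close> play no role.\<close>

definition smooth_on :: "(real^'n::finite) set \<Rightarrow> (real^'n \<Rightarrow> complex) \<Rightarrow> bool" where
  "smooth_on \<Omega> f \<longleftrightarrow> (\<forall>js. foldr partial js f differentiable_on \<Omega>)"

abbreviation order_of :: "('n::finite \<Rightarrow> nat) \<Rightarrow> nat" where
  "order_of \<alpha> \<equiv> (\<Sum>i\<in>UNIV. \<alpha> i)"

text \<open>The multi-index derivative applies, in some order, the partial derivative in direction \<open>i\<close>
  exactly \<open>\<alpha> i\<close> times; for smooth functions the order does not matter.\<close>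

definition multi_deriv :: "('n::finite \<Rightarrow> nat) \<Rightarrow> (real^'n \<Rightarrow> complex) \<Rightarrow> real^'n \<Rightarrow> complex" where
  "multi_deriv \<alpha> f = foldr partial (SOME js. \<forall>i. count_list js i = \<alpha> i) f"

lemma ex_list_of_multi_index:
  fixes \<alpha> :: "'n::finite \<Rightarrow> nat"
  shows "\<exists>js. \<forall>i. count_list js i = \<alpha> i"
proof -
  obtain js where "mset js = Abs_multiset \<alpha>"
    using ex_mset by blast
  then have "count_list js i = \<alpha> i" for i
    by (metis count_mset finite count_Abs_multiset)
  then show ?thesis by blast
qed

definition useminorm ::
  "(nat \<Rightarrow> real) \<Rightarrow> (nat \<Rightarrow> real) \<Rightarrow> (real^'n::finite) set \<Rightarrow> (real^'n \<Rightarrow> complex) \<Rightarrow> ennreal" where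
  "useminorm M r K \<phi> =
     (SUP (x, \<alpha>) \<in> K \<times> UNIV.
        ennreal (cmod (multi_deriv \<alpha> \<phi> x) / (M (order_of \<alpha>) * (\<Prod>i=1..order_of \<alpha>. r i))))"

definition ultradiff :: "(nat \<Rightarrow> real) \<Rightarrow> (real^'n::finite) set \<Rightarrow> (real^'n \<Rightarrow> complex) set" where
  "ultradiff M \<Omega> =
     {\<phi>. smooth_on \<Omega> \<phi> \<and>
         (\<forall>K. regular_compact \<Omega> K \<longrightarrow> (\<forall>r\<in>roumieu_seqs. useminorm M r K \<phi> < \<infinity>))}"

text \<open>Functions with compact support in \<open>\<Omega>\<close> are taken to be extended by zero to the whole space,
  so that equality of test functions is equality of total functions.\<close>

definition test_on ::
  "(nat \<Rightarrow> real) \<Rightarrow> (real^'n::finite) set \<Rightarrow> (real^'n) set \<Rightarrow> (real^'n \<Rightarrow> complex) set" where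
  "test_on M \<Omega> K = {\<phi> \<in> ultradiff M \<Omega>. closure {x. \<phi> x \<noteq> 0} \<subseteq> K}"

definition test_on_topology ::
  "(nat \<Rightarrow> real) \<Rightarrow> (real^'n::finite) set \<Rightarrow> (real^'n) set \<Rightarrow> (real^'n \<Rightarrow> complex) topology" where
  "test_on_topology M \<Omega> K =
     topology_generated_by
       {{\<psi> \<in> test_on M \<Omega> K. useminorm M r K (\<lambda>x. \<psi> x - \<phi> x) < ennreal e} | \<phi> r e.
          \<phi> \<in> test_on M \<Omega> K \<and> r \<in> roumieu_seqs \<and> e > 0}"

definition test_functions ::
  "(nat \<Rightarrow> real) \<Rightarrow> (real^'n::finite) set \<Rightarrow> (real^'n \<Rightarrow> complex) set" where
  "test_functions M \<Omega> = (\<Union>K\<in>{K. regular_compact \<Omega> K}. test_on M \<Omega> K)"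

text \<open>The locally convex inductive limit topology, i.e. the finest locally convex topology for
  which all inclusions of the spaces \<open>test_on M \<Omega> K\<close> are continuous: it is generated by the convex
  sets whose trace on each of these spaces is open.\<close>

definition test_topology ::
  "(nat \<Rightarrow> real) \<Rightarrow> (real^'n::finite) set \<Rightarrow> (real^'n \<Rightarrow> complex) topology" where
  "test_topology M \<Omega> =
     topology_generated_by
       {U. U \<subseteq> test_functions M \<Omega> \<and>
           (\<forall>\<phi>\<in>U. \<forall>\<psi>\<in>U. \<forall>t\<in>{0..1}. (\<lambda>x. (1 - t) *\<^sub>R \<phi> x + t *\<^sub>R \<psi> x) \<in> U) \<and>
           (\<forall>K. regular_compact \<Omega> K \<longrightarrow>
                openin (test_on_topology M \<Omega> K) (U \<inter> test_on M \<Omega> K))}"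

definition ultradistributions ::
  "(nat \<Rightarrow> real) \<Rightarrow> (real^'n::finite) set \<Rightarrow> ((real^'n \<Rightarrow> complex) \<Rightarrow> complex) set" where
  "ultradistributions M \<Omega> =
     {T. (\<forall>\<phi>\<in>test_functions M \<Omega>. \<forall>\<psi>\<in>test_functions M \<Omega>. \<forall>a b.
            T (\<lambda>x. a * \<phi> x + b * \<psi> x) = a * T \<phi> + b * T \<psi>) \<and>
         continuous_map (test_topology M \<Omega>) euclidean T}"

definition pairing ::
  "(real^'n::finite) set \<Rightarrow> (real^'n \<Rightarrow> complex) \<Rightarrow> (real^'n \<Rightarrow> complex) \<Rightarrow> complex" where
  "pairing \<Omega> f \<phi> = (LINT x:\<Omega>|lborel. f x * \<phi> x)"

text \<open>\<open>net_bigo a b\<close> expresses \<open>a \<epsilon> = O(b \<epsilon>)\<close> for nets indexed by the open unit interval;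
  values of nets at other indices play no role.\<close>

definition net_bigo :: "(real \<Rightarrow> ennreal) \<Rightarrow> (real \<Rightarrow> real) \<Rightarrow> bool" where
  "net_bigo a b \<longleftrightarrow>
     (\<exists>C>0. \<exists>\<epsilon>0\<in>{0<..<1}. \<forall>\<epsilon>\<in>{0<..<\<epsilon>0}. a \<epsilon> \<le> ennreal (C * b \<epsilon>))"

definition moderate_nets ::
  "(nat \<Rightarrow> real) \<Rightarrow> (real^'n::finite) set \<Rightarrow> (real \<Rightarrow> real^'n \<Rightarrow> complex) set" where
  "moderate_nets M \<Omega> =
     {g. (\<forall>\<epsilon>\<in>{0<..<1}. g \<epsilon> \<in> ultradiff M \<Omega>) \<and>
         (\<forall>K. regular_compact \<Omega> K \<longrightarrow>
            (\<forall>h\<in>roumieu_seqs. \<exists>k\<in>roumieu_seqs.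
               net_bigo (\<lambda>\<epsilon>. useminorm M h K (g \<epsilon>)) (\<lambda>\<epsilon>. exp (assoc_fun M k (1 / \<epsilon>)))))}"

definition negligible_nets ::
  "(nat \<Rightarrow> real) \<Rightarrow> (real^'n::finite) set \<Rightarrow> (real \<Rightarrow> real^'n \<Rightarrow> complex) set" where
  "negligible_nets M \<Omega> =
     {g. (\<forall>\<epsilon>\<in>{0<..<1}. g \<epsilon> \<in> ultradiff M \<Omega>) \<and>
         (\<forall>K. regular_compact \<Omega> K \<longrightarrow>
            (\<forall>h\<in>roumieu_seqs. \<forall>k\<in>roumieu_seqs.
               net_bigo (\<lambda>\<epsilon>. useminorm M h K (g \<epsilon>)) (\<lambda>\<epsilon>. exp (- assoc_fun M k (1 / \<epsilon>)))))}"

definition generalized_ultradistributions ::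
  "(nat \<Rightarrow> real) \<Rightarrow> (real^'n::finite) set \<Rightarrow> (real \<Rightarrow> real^'n \<Rightarrow> complex) set set" where
  "generalized_ultradistributions M \<Omega> =
     moderate_nets M \<Omega> //
       {(u, v). u \<in> moderate_nets M \<Omega> \<and> v \<in> moderate_nets M \<Omega> \<and>
                (\<lambda>\<epsilon> x. u \<epsilon> x - v \<epsilon> x) \<in> negligible_nets M \<Omega>}"

end

theory Submission
  imports Defs
begin

text \<open>
  The question is local. A tensor product of bump functions of class \<open>{M\<^sub>p}\<close>, supported in a small cube, is
  used as a cutoff \<open>\<chi>\<close>, and \<open>\<chi> g\<^sub>\<epsilon>\<close> is expanded in a Fourier series with coefficients \<open>c\<^sub>\<epsilon>(\<xi>)\<close>. Regularity
  of the net gives \<open>c\<^sub>\<epsilon>(\<xi>) = O(exp (N\<^sub>k(1/\<epsilon>) - N\<^sub>h(\<bar>\<xi>\<bar>)))\<close> for every \<open>h\<close>, and strong association gives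
  \<open>c\<^sub>\<epsilon>(\<xi>) - c(\<xi>) = O(exp (m N\<^sub>s(\<bar>\<xi>\<bar>) - N\<^sub>b(1/\<epsilon>)))\<close>, where \<open>c(\<xi>)\<close> are the coefficients of \<open>\<chi> T\<close>. Now \<open>N\<^sub>k \<le> N\<^sub>b\<close>
  because \<open>b \<le> k\<close>, and by (M.2) every multiple of \<open>N\<^sub>s\<close> is dominated by some \<open>N\<^sub>h\<close>. Balancing \<open>\<epsilon>\<close> against
  \<open>\<xi>\<close> therefore yields \<open>c(\<xi>) = O(exp (- N\<^sub>t(\<bar>\<xi>\<bar>)))\<close> for every \<open>t\<close>, and even
  \<open>c\<^sub>\<epsilon>(\<xi>) - c(\<xi>) = O(exp (- N\<^sub>b(1/\<epsilon>) / 2 - N\<^sub>t(\<bar>\<xi>\<bar>)))\<close>. So \<open>g\<^sub>\<epsilon>\<close> converges locally uniformly to an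
  ultradifferentiable function, and \<open>T\<close> is integration against this function.

  The coefficients are estimated with derivatives in a single coordinate direction, and the limit series is
  differentiated termwise; hence the symmetry of mixed derivatives is never needed.
\<close>

section \<open>Weights and associated functions\<close>

text \<open>Neither hypothesis suffices alone: regularity gives decay in the frequency with a
  constant that may blow up as \<epsilon> tends to 0, association gives smallness in \<epsilon> with
  a constant that may grow with the frequency. Because of \<open>b \<le> k\<close> both are measured
  by the single quantity Y = \<open>assoc_fun M b (1 / \<epsilon>)\<close>, so one trade-off serves
  both. With X a common majorant of \<open>assoc_fun M s\<close> and \<open>assoc_fun M t\<close> at
  the size of \<xi>, the two errors are, up to constants, exp(m X - Y) and exp(Y - (3 m + 4) X). On
  either side of the threshold Y = 2 (m + 1) X one of them is at most exp(- Y / 2 - X); this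
  dictates the number 3 m + 4. In the application m is the dimension: a cutoff times a character is
  a tensor product, and each factor costs one associated function.

  \<open>T\<close> is identified through pairings: for an arbitrary test function, both
  \<open>T\<close> and integration against the limit function are limits of the pairings with the
  net, and a finite cover by the local neighbourhoods suffices for the second limit.\<close>

definition wt :: "(nat \<Rightarrow> real) \<Rightarrow> (nat \<Rightarrow> real) \<Rightarrow> nat \<Rightarrow> real" where
  "wt M r p = M p * (\<Prod>i=1..p. r i)"

lemma weight_seq_pos: "weight_seq M \<Longrightarrow> M p > 0"
  and weight_seq_0: "weight_seq M \<Longrightarrow> M 0 = 1"
  by (auto simp: weight_seq_def)

lemma weight_seq_log_convex:
  assumes "weight_seq M" shows "(M (Suc p))\<^sup>2 \<le> M p * M (Suc (Suc p))"
proof -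
  have "\<forall>p\<ge>1. (M p)\<^sup>2 \<le> M (p - 1) * M (p + 1)" using assms unfolding weight_seq_def by blast
  from this[rule_format, of "Suc p"] show ?thesis by simp
qed

lemma weight_seq_ratio_mono:
  assumes "weight_seq M" "p \<le> q" shows "M (Suc p) / M p \<le> M (Suc q) / M q"
  using assms(2)
proof (induction q rule: dec_induct)
  case (step q)
  have "M (Suc q) / M q \<le> M (Suc (Suc q)) / M (Suc q)"
    using weight_seq_log_convex[OF assms(1), of q] weight_seq_pos[OF assms(1)]
    by (simp add: divide_simps power2_eq_square mult.commute)
  with step show ?case by linarith
qed simp

text \<open>Raising q by one multiplies the left side by M_{q+1} / M_q and the right side by
  M_{p+q+1} / M_{p+q}, which log-convexity makes at least as large; M_0 = 1 starts the
  induction.\<close>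

lemma weight_seq_mult_le:
  assumes "weight_seq M" shows "M p * M q \<le> M (p + q)"
proof (induction q)
  case 0 then show ?case using weight_seq_0[OF assms] by simp
next
  case (Suc q)
  note pos = weight_seq_pos[OF assms]
  have "M p * M (Suc q) = (M p * M q) * (M (Suc q) / M q)" using pos[of q] by simp
  also have "\<dots> \<le> M (p + q) * (M (Suc (p + q)) / M (p + q))"
    by (intro mult_mono Suc weight_seq_ratio_mono[OF assms]) (use pos in \<open>auto simp: less_imp_le\<close>)
  also have "\<dots> = M (p + Suc q)" using pos[of "p+q"] by simp
  finally show ?case .
qed

lemma weight_seq_ge_power:
  assumes "weight_seq M" shows "M 1 ^ p \<le> M p"
proof (induction p)
  case (Suc p)
  have "M 1 ^ Suc p \<le> M p * M 1" using Suc weight_seq_pos[OF assms, of 1] by (simp add: mult.commute)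
  also have "\<dots> \<le> M (p + 1)" by (rule weight_seq_mult_le[OF assms])
  finally show ?case by simp
qed (simp add: weight_seq_0[OF assms])

lemma weight_seq_stable:
  assumes "weight_seq M"
  obtains c H where "c \<ge> 1" "H \<ge> 1" "\<And>p q. M (p + q) \<le> c * H ^ (p + q) * (M p * M q)"
proof -
  obtain c H where cH: "c \<ge> 1" "H \<ge> 1"
    and le: "\<And>p. M p \<le> c * H ^ p * Min ((\<lambda>q. M (p - q) * M q) ` {0..p})"
    using assms unfolding weight_seq_def by blast
  have "M (p + q) \<le> c * H ^ (p + q) * (M p * M q)" for p q
  proof -
    have "Min ((\<lambda>q'. M (p + q - q') * M q') ` {0..p + q}) \<le> M p * M q"
      by (intro Min_le image_eqI[where x = q]) auto
    then show ?thesis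
      by (intro order_trans[OF le[of "p + q"]] mult_left_mono) (use cH in auto)
  qed
  then show ?thesis using that cH by blast
qed

text \<open>The case p = 1 of (M.3), extended by the term j = 0, is the Denjoy--Carleman condition:
  the sum is the budget for the widths of the boxes that make up a cutoff.\<close>

lemma weight_seq_summable:
  assumes "weight_seq M" shows "summable (\<lambda>j. M j / M (Suc j))"
proof -
  have "\<forall>p\<ge>1. summable (\<lambda>j. M (p + j) / M (p + j + 1))"
    using assms unfolding weight_seq_def by blast
  then have "summable (\<lambda>j. M (1 + j) / M (1 + j + 1))" by blast
  then have "summable (\<lambda>j. M (j + 1) / M (Suc (j + 1)))" by (simp add: add.commute)
  then show ?thesis by (subst (asm) summable_iff_shift)
qed

lemma roumieu_pos: "r \<in> roumieu_seqs \<Longrightarrow> i \<ge> 1 \<Longrightarrow> r i > 0"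
  and roumieu_mono: "r \<in> roumieu_seqs \<Longrightarrow> 1 \<le> i \<Longrightarrow> i \<le> j \<Longrightarrow> r i \<le> r j"
  and roumieu_lim: "r \<in> roumieu_seqs \<Longrightarrow> filterlim r at_top sequentially"
  by (auto simp: roumieu_seqs_def)

lemma roumieu_prod_pos: "r \<in> roumieu_seqs \<Longrightarrow> (\<Prod>i=1..p. r i) > 0"
  by (intro prod_pos) (auto simp: roumieu_pos)

lemma wt_pos: "weight_seq M \<Longrightarrow> r \<in> roumieu_seqs \<Longrightarrow> wt M r p > 0"
  unfolding wt_def by (intro mult_pos_pos weight_seq_pos roumieu_prod_pos)

lemma wt_0: "weight_seq M \<Longrightarrow> wt M r 0 = 1"
  by (simp add: wt_def weight_seq_0)

lemma roumieu_prod_mult_le: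
  assumes "r \<in> roumieu_seqs"
  shows "(\<Prod>i=1..p. r i) * (\<Prod>i=1..q. r i) \<le> (\<Prod>i=1..p+q. r i)"
proof (induction q)
  case (Suc q)
  have "(\<Prod>i=1..p. r i) * (\<Prod>i=1..Suc q. r i) = ((\<Prod>i=1..p. r i) * (\<Prod>i=1..q. r i)) * r (Suc q)"
    by simp
  also have "\<dots> \<le> (\<Prod>i=1..p+q. r i) * r (Suc (p + q))"
    by (intro mult_mono Suc roumieu_mono[OF assms])
      (use roumieu_prod_pos[OF assms] roumieu_pos[OF assms] in \<open>auto simp: less_imp_le\<close>)
  finally show ?case by simp
qed simp

lemma wt_mult_le:
  assumes "weight_seq M" "r \<in> roumieu_seqs" shows "wt M r p * wt M r q \<le> wt M r (p + q)"
proof -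
  have "wt M r p * wt M r q = (M p * M q) * ((\<Prod>i=1..p. r i) * (\<Prod>i=1..q. r i))"
    by (simp add: wt_def)
  also have "\<dots> \<le> M (p + q) * (\<Prod>i=1..p+q. r i)"
    by (intro mult_mono weight_seq_mult_le roumieu_prod_mult_le assms mult_nonneg_nonneg)
      (use weight_seq_pos[OF assms(1)] roumieu_prod_pos[OF assms(2)] in \<open>auto simp: less_imp_le\<close>)
  finally show ?thesis by (simp add: wt_def)
qed

text \<open>Since r is unbounded, all but finitely many factors are at least L; the initial
  quotients are absorbed into c. This yields the finiteness of associated functions and absorbs the
  geometric factors in the derivatives of a cutoff.\<close>

lemma roumieu_prod_superexp:
  assumes "r \<in> roumieu_seqs" "L > 0"
  obtains c where "c > 0" "\<And>p. c * L ^ p \<le> (\<Prod>i=1..p. r i)"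
proof -
  obtain i0 where i0: "\<And>i. i \<ge> i0 \<Longrightarrow> r i \<ge> L"
    using roumieu_lim[OF assms(1)] unfolding filterlim_at_top eventually_sequentially by blast
  let ?R = "\<lambda>p. \<Prod>i=1..p. r i"
  define c where "c = Min ((\<lambda>p. ?R p / L ^ p) ` {..i0})"
  have c: "c \<le> ?R p / L ^ p" if "p \<le> i0" for p
    unfolding c_def by (rule Min_le) (use that in auto)
  have "c > 0"
    unfolding c_def by (subst Min_gr_iff) (use roumieu_prod_pos[OF assms(1)] assms(2) in auto)
  moreover have "c * L ^ p \<le> ?R p" for p
  proof (cases "p \<le> i0")
    case True then show ?thesis using c[of p] assms(2) by (simp add: field_simps)
  next
    case False
    then have "i0 \<le> p" by simp
    then show ?thesis
    proof (induction p rule: dec_induct)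
      case base then show ?case using c[of i0] assms(2) by (simp add: field_simps)
    next
      case (step p)
      have "c * L ^ Suc p = (c * L ^ p) * L" by simp
      also have "\<dots> \<le> ?R p * r (Suc p)"
        by (intro mult_mono step i0) (use step assms(2) roumieu_prod_pos[OF assms(1)] in \<open>auto simp: less_imp_le\<close>)
      finally show ?case by simp
    qed
  qed
  ultimately show ?thesis using that by blast
qed

lemma roumieu_scale:
  assumes "r \<in> roumieu_seqs" "c > 0" shows "(\<lambda>i. c * r i) \<in> roumieu_seqs"
  using assms filterlim_tendsto_pos_mult_at_top[OF tendsto_const, of c r sequentially]
  by (auto simp: roumieu_seqs_def)

lemma roumieu_min:
  assumes "r \<in> roumieu_seqs" "s \<in> roumieu_seqs" shows "(\<lambda>i. min (r i) (s i)) \<in> roumieu_seqs"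
proof -
  have "filterlim (\<lambda>i. min (r i) (s i)) at_top sequentially"
    using roumieu_lim[OF assms(1)] roumieu_lim[OF assms(2)]
    unfolding filterlim_at_top by (simp add: eventually_conj_iff)
  then show ?thesis using assms by (fastforce simp: roumieu_seqs_def)
qed

section \<open>Associated functions: finiteness, extremal property, multiples\<close>

lemma assoc_fun_bdd:
  assumes M: "weight_seq M" and r: "r \<in> roumieu_seqs" and "\<rho> \<ge> 0"
  shows "bdd_above (range (\<lambda>p. max (ln (\<rho> ^ p / wt M r p)) 0))"
proof (cases "\<rho> = 0")
  case True
  \<comment> \<open>For p > 0 this rests on the default value \<open>ln 0 = 0\<close>.\<close>
  have "max (ln (\<rho> ^ p / wt M r p)) 0 \<le> 0" for p
    using True by (cases p) (auto simp: wt_0[OF M])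
  then show ?thesis by (intro bdd_aboveI2[where M = 0])
next
  case False
  with assms have \<rho>: "\<rho> > 0" by simp
  have M1: "M 1 > 0" using weight_seq_pos[OF M] .
  obtain c where c: "c > 0" "\<And>p. c * (\<rho> / M 1) ^ p \<le> (\<Prod>i=1..p. r i)"
    using roumieu_prod_superexp[OF r, of "\<rho> / M 1"] \<rho> M1 by auto
  have "max (ln (\<rho> ^ p / wt M r p)) 0 \<le> max (ln (1 / c)) 0" for p
  proof -
    \<comment> \<open>\<open>M 1 ^ p \<le> M p\<close> reduces the claim to the products of r, which
      outgrow every geometric sequence.\<close>
    have "c * \<rho> ^ p = M 1 ^ p * (c * (\<rho> / M 1) ^ p)" using M1 by (simp add: power_divide)
    also have "\<dots> \<le> wt M r p"
      unfolding wt_def by (intro mult_mono weight_seq_ge_power[OF M] c)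
        (use weight_seq_pos[OF M] c M1 \<rho> in \<open>auto simp: less_imp_le\<close>)
    finally have "\<rho> ^ p / wt M r p \<le> 1 / c"
      using c(1) wt_pos[OF M r, of p] by (simp add: field_simps)
    then have "ln (\<rho> ^ p / wt M r p) \<le> ln (1 / c)"
      using \<rho> c(1) wt_pos[OF M r, of p] by (subst ln_le_cancel_iff) auto
    then show ?thesis by simp
  qed
  then show ?thesis by (intro bdd_aboveI2)
qed

lemma assoc_fun_wt: "assoc_fun M r \<rho> = (SUP p. max (ln (\<rho> ^ p / wt M r p)) 0)"
  by (simp add: assoc_fun_def wt_def)

lemma assoc_fun_upper:
  assumes "weight_seq M" "r \<in> roumieu_seqs" "\<rho> \<ge> 0"
  shows "max (ln (\<rho> ^ p / wt M r p)) 0 \<le> assoc_fun M r \<rho>"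
  unfolding assoc_fun_wt by (rule cSUP_upper[OF UNIV_I assoc_fun_bdd[OF assms]])

lemma assoc_fun_nonneg:
  assumes "weight_seq M" "r \<in> roumieu_seqs" "\<rho> \<ge> 0" shows "assoc_fun M r \<rho> \<ge> 0"
  using assoc_fun_upper[OF assms, of 0] by linarith

lemma power_le_assoc_fun:
  assumes "weight_seq M" "r \<in> roumieu_seqs" "\<rho> \<ge> 0"
  shows "\<rho> ^ p \<le> wt M r p * exp (assoc_fun M r \<rho>)"
proof (cases "\<rho> ^ p = 0")
  case True
  show ?thesis unfolding True using wt_pos[OF assms(1,2), of p] by (simp add: less_imp_le)
next
  case False
  then have "\<rho> ^ p > 0" using assms(3) by (metis less_eq_real_def zero_le_power)
  then have "\<rho> ^ p / wt M r p = exp (ln (\<rho> ^ p / wt M r p))"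
    using wt_pos[OF assms(1,2), of p] by simp
  also have "\<dots> \<le> exp (assoc_fun M r \<rho>)"
    using assoc_fun_upper[OF assms, of p] by simp
  finally show ?thesis using wt_pos[OF assms(1,2), of p] by (simp add: field_simps)
qed

text \<open>Together with \<open>power_le_assoc_fun\<close>: exp N(\<rho>) is the least B with
  \<rho>^p \<le> w_p B for all p. This pair of rules replaces most later handling of suprema and
  logarithms.\<close>

lemma exp_assoc_fun_le:
  assumes M: "weight_seq M" and r: "r \<in> roumieu_seqs" and "\<rho> \<ge> 0"
    and le: "\<And>p. \<rho> ^ p \<le> wt M r p * B"
  shows "exp (assoc_fun M r \<rho>) \<le> B"
proof -
  have B: "B \<ge> 1" using le[of 0] by (simp add: wt_0[OF M])
  have "assoc_fun M r \<rho> \<le> ln B"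
    unfolding assoc_fun_wt
  proof (rule cSUP_least)
    fix p
    have "ln (\<rho> ^ p / wt M r p) \<le> ln B" if "\<rho> ^ p > 0"
      using that le[of p] wt_pos[OF M r, of p] B
      by (subst ln_le_cancel_iff) (auto simp: field_simps)
    moreover have "ln (\<rho> ^ p / wt M r p) = 0" if "\<not> \<rho> ^ p > 0"
    proof -
      have "\<rho> ^ p = 0" using that \<open>\<rho> \<ge> 0\<close> by (meson linorder_not_le antisym zero_le_power)
      then show ?thesis by (simp del: power_eq_0_iff)
    qed
    moreover have "ln B \<ge> 0" using B by simp
    ultimately show "max (ln (\<rho> ^ p / wt M r p)) 0 \<le> ln B" by fastforce
  qed simp
  then have "exp (assoc_fun M r \<rho>) \<le> exp (ln B)" by simp
  then show ?thesis using B by simp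
qed

lemma assoc_fun_antimono:
  assumes M: "weight_seq M" and r: "r \<in> roumieu_seqs" and s: "s \<in> roumieu_seqs" and "\<rho> \<ge> 0"
    and le: "\<And>i. i \<ge> 1 \<Longrightarrow> r i \<le> s i"
  shows "assoc_fun M s \<rho> \<le> assoc_fun M r \<rho>"
proof -
  have "exp (assoc_fun M s \<rho>) \<le> exp (assoc_fun M r \<rho>)"
  proof (rule exp_assoc_fun_le[OF M s \<open>\<rho> \<ge> 0\<close>])
    fix p
    have "(\<Prod>i=1..p. r i) \<le> (\<Prod>i=1..p. s i)"
      by (intro prod_mono) (auto simp: le roumieu_pos[OF r] less_imp_le)
    then have "wt M r p \<le> wt M s p"
      unfolding wt_def by (intro mult_left_mono) (auto simp: weight_seq_pos[OF M] less_imp_le)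
    then have "wt M r p * exp (assoc_fun M r \<rho>) \<le> wt M s p * exp (assoc_fun M r \<rho>)" by simp
    with power_le_assoc_fun[OF M r \<open>\<rho> \<ge> 0\<close>, of p]
    show "\<rho> ^ p \<le> wt M s p * exp (assoc_fun M r \<rho>)" by linarith
  qed
  then show ?thesis by simp
qed

lemma assoc_fun_mono:
  assumes M: "weight_seq M" and r: "r \<in> roumieu_seqs" and "0 \<le> \<rho>" "\<rho> \<le> \<sigma>"
  shows "assoc_fun M r \<rho> \<le> assoc_fun M r \<sigma>"
proof -
  have "exp (assoc_fun M r \<rho>) \<le> exp (assoc_fun M r \<sigma>)"
    by (rule exp_assoc_fun_le[OF M r \<open>\<rho> \<ge> 0\<close>])
      (use assms in \<open>auto intro: order_trans[OF power_mono power_le_assoc_fun]\<close>)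
  then show ?thesis by simp
qed

text \<open>The left side multiplies the p + q smallest members of the list r_1, r_1, r_2, r_2, ...,
  the right side some p + q of its members. The induction removes the last factor of the longer
  block.\<close>

lemma prod_halved_index_le:
  fixes r :: "nat \<Rightarrow> real"
  assumes r: "r \<in> roumieu_seqs"
  shows "(\<Prod>i=1..p+q. r ((i + 1) div 2)) \<le> (\<Prod>i=1..p. r i) * (\<Prod>i=1..q. r i)"
proof -
  let ?R = "\<lambda>p. \<Prod>i=1..p. r i"
  have "\<forall>p q. p + q = m \<longrightarrow> (\<Prod>i=1..m. r ((i + 1) div 2)) \<le> ?R p * ?R q" for m
  proof (induction m)
    case (Suc m)
    \<comment> \<open>In the longer block q is at least half of Suc m, rounded up, so its last
      factor \<open>r q\<close> dominates the factor split off on the left.\<close>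
    have *: "(\<Prod>i=1..Suc m. r ((i + 1) div 2)) \<le> ?R p * ?R q" if "p + q = Suc m" "p \<le> q" for p q
    proof -
      obtain q' where q': "q = Suc q'" using \<open>p \<le> q\<close> \<open>p + q = Suc m\<close> by (cases q) auto
      have "(\<Prod>i=1..Suc m. r ((i + 1) div 2)) = (\<Prod>i=1..m. r ((i + 1) div 2)) * r ((Suc m + 1) div 2)"
        by simp
      also have "\<dots> \<le> (?R p * ?R q') * r q"
      proof (rule mult_mono)
        show "(\<Prod>i=1..m. r ((i + 1) div 2)) \<le> ?R p * ?R q'" using Suc.IH q' that by simp
        show "r ((Suc m + 1) div 2) \<le> r q" by (rule roumieu_mono[OF r]) (use that in auto)
        show "0 \<le> ?R p * ?R q'" by (intro mult_nonneg_nonneg less_imp_le[OF roumieu_prod_pos[OF r]])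
        show "0 \<le> r ((Suc m + 1) div 2)" by (rule less_imp_le[OF roumieu_pos[OF r]]) simp
      qed
      also have "\<dots> = ?R p * ?R q" by (simp add: q')
      finally show ?thesis .
    qed
    show ?case
    proof (intro allI impI)
      fix p q :: nat assume "p + q = Suc m"
      then show "(\<Prod>i=1..Suc m. r ((i + 1) div 2)) \<le> ?R p * ?R q"
        using *[of p q] *[of q p] nat_le_linear[of p q] add.commute[of p q] mult.commute[of "?R p" "?R q"]
        by metis
    qed
  qed auto
  then show ?thesis by blast
qed

text \<open>With h_i = r_{(i+1) div 2} / H, (M.2) and \<open>prod_halved_index_le\<close> give
  w_h(p+q) \<le> c w_r(p) w_r(q); the factor 1 / H cancels H^{p+q}. Hence \<rho>^p \<rho>^q is
  bounded by w_r(p) w_r(q) c exp N_h(\<rho>), and p and q can be optimized independently, which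
  produces the square of exp N_r(\<rho>).\<close>

lemma assoc_fun_double:
  assumes M: "weight_seq M" and r: "r \<in> roumieu_seqs"
  shows "\<exists>h\<in>roumieu_seqs. \<exists>c. \<forall>\<rho>\<ge>0. 2 * assoc_fun M r \<rho> \<le> assoc_fun M h \<rho> + c"
proof -
  obtain c H where cH: "c \<ge> 1" "H \<ge> 1" and st: "\<And>p q. M (p + q) \<le> c * H ^ (p + q) * (M p * M q)"
    using weight_seq_stable[OF M] by blast
  define h where "h i = (1 / H) * r ((i + 1) div 2)" for i
  have "filterlim (\<lambda>i. (i + 1) div 2 :: nat) at_top sequentially"
    unfolding filterlim_at_top eventually_sequentially
  proof (intro allI)
    fix Z :: nat
    show "\<exists>N. \<forall>n\<ge>N. Z \<le> (n + 1) div 2" by (intro exI[of _ "2 * Z"]) auto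
  qed
  then have "filterlim (\<lambda>i. r ((i + 1) div 2)) at_top sequentially"
    by (rule filterlim_compose[OF roumieu_lim[OF r]])
  then have "(\<lambda>i. r ((i + 1) div 2)) \<in> roumieu_seqs"
    unfolding roumieu_seqs_def by (auto intro!: roumieu_pos[OF r] roumieu_mono[OF r])
  from roumieu_scale[OF this, of "1 / H"] have h: "h \<in> roumieu_seqs"
    using cH unfolding h_def by simp
  have whr: "wt M h (p + q) \<le> c * (wt M r p * wt M r q)" for p q
  proof -
    have "wt M h (p + q) = M (p + q) * ((\<Prod>i=1..p+q. r ((i + 1) div 2)) / H ^ (p + q))"
      by (simp add: wt_def h_def prod_dividef)
    also have "\<dots> \<le> (c * H ^ (p + q) * (M p * M q)) * (((\<Prod>i=1..p. r i) * (\<Prod>i=1..q. r i)) / H ^ (p + q))"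
      by (intro mult_mono divide_right_mono st prod_halved_index_le r mult_nonneg_nonneg divide_nonneg_nonneg prod_nonneg)
        (use cH weight_seq_pos[OF M] roumieu_pos[OF r] in \<open>auto simp: less_imp_le\<close>)
    also have "\<dots> = c * (wt M r p * wt M r q)" using cH by (simp add: wt_def)
    finally show ?thesis .
  qed
  have "2 * assoc_fun M r \<rho> \<le> assoc_fun M h \<rho> + ln c" if \<rho>: "\<rho> \<ge> 0" for \<rho>
  proof (cases "\<rho> = 0")
    case True
    have "exp (assoc_fun M r 0) \<le> 1"
      by (rule exp_assoc_fun_le[OF M r]) (auto simp: power_0_left wt_0[OF M] wt_pos[OF M r] less_imp_le)
    moreover have "ln c \<ge> 0" using cH by simp
    ultimately show ?thesis using True assoc_fun_nonneg[OF M h, of 0] by simp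
  next
    case False
    let ?E = "exp (assoc_fun M r \<rho>)" and ?B = "c * exp (assoc_fun M h \<rho>)"
    have 1: "\<rho> ^ p * \<rho> ^ q \<le> wt M r p * wt M r q * ?B" for p q
    proof -
      have "\<rho> ^ p * \<rho> ^ q \<le> wt M h (p + q) * exp (assoc_fun M h \<rho>)"
        using power_le_assoc_fun[OF M h \<rho>, of "p + q"] by (simp add: power_add)
      also have "\<dots> \<le> c * (wt M r p * wt M r q) * exp (assoc_fun M h \<rho>)"
        by (intro mult_right_mono whr) simp
      finally show ?thesis by (simp add: mult_ac)
    qed
    have pos: "\<rho> ^ p > 0" for p using False \<rho> by simp
    \<comment> \<open>First optimization, with the exponent p kept fixed; the next step optimizes
      over p.\<close>
    have 2: "?E \<le> wt M r p * ?B / \<rho> ^ p" for p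
      by (rule exp_assoc_fun_le[OF M r \<rho>]) (use 1[of p] pos[of p] in \<open>simp add: field_simps\<close>)
    have "?E \<le> ?B / ?E"
      by (rule exp_assoc_fun_le[OF M r \<rho>]) (use 2 pos in \<open>simp add: field_simps\<close>)
    then have "?E * ?E \<le> ?B" by (simp add: field_simps)
    then have "exp (assoc_fun M r \<rho> + assoc_fun M r \<rho>) \<le> exp (ln c + assoc_fun M h \<rho>)"
      unfolding exp_add using cH by simp
    then show ?thesis by simp
  qed
  with h show ?thesis by (intro bexI[of _ h] exI[of _ "ln c"]) auto
qed

text \<open>Repeated doubling, combined with m \<le> 2^m.\<close>

lemma assoc_fun_multiple:
  assumes M: "weight_seq M" and r: "r \<in> roumieu_seqs"
  shows "\<exists>h\<in>roumieu_seqs. \<exists>c. \<forall>\<rho>\<ge>0. real m * assoc_fun M r \<rho> \<le> assoc_fun M h \<rho> + c"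
proof -
  have "\<exists>h\<in>roumieu_seqs. \<exists>c. \<forall>\<rho>\<ge>0. 2 ^ n * assoc_fun M r \<rho> \<le> assoc_fun M h \<rho> + c" for n
  proof (induction n)
    case 0
    show ?case by (intro bexI[OF _ r] exI[of _ 0]) simp
  next
    case (Suc n)
    then obtain h c where h: "h \<in> roumieu_seqs" "\<forall>\<rho>\<ge>0. 2 ^ n * assoc_fun M r \<rho> \<le> assoc_fun M h \<rho> + c"
      by blast
    obtain h' c' where h': "h' \<in> roumieu_seqs" "\<forall>\<rho>\<ge>0. 2 * assoc_fun M h \<rho> \<le> assoc_fun M h' \<rho> + c'"
      using assoc_fun_double[OF M h(1)] by blast
    have "2 ^ Suc n * assoc_fun M r \<rho> \<le> assoc_fun M h' \<rho> + (c' + 2 * c)" if "\<rho> \<ge> 0" for \<rho>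
      using h(2)[rule_format, OF that] h'(2)[rule_format, OF that] by simp
    then show ?case using h'(1) by (intro bexI[of _ h'] exI[of _ "c' + 2 * c"]) auto
  qed
  from this[of m] obtain h c where h: "h \<in> roumieu_seqs"
    "\<forall>\<rho>\<ge>0. 2 ^ m * assoc_fun M r \<rho> \<le> assoc_fun M h \<rho> + c"
    by blast
  have "real m * assoc_fun M r \<rho> \<le> assoc_fun M h \<rho> + c" if "\<rho> \<ge> 0" for \<rho>
  proof -
    have "real m \<le> 2 ^ m" by (metis less_exp of_nat_less_iff of_nat_numeral of_nat_power less_imp_le)
    then have "real m * assoc_fun M r \<rho> \<le> 2 ^ m * assoc_fun M r \<rho>"
      by (intro mult_right_mono assoc_fun_nonneg[OF M r that])
    then show ?thesis using h(2)[rule_format, OF that] by linarith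
  qed
  with h(1) show ?thesis by (intro bexI[of _ h] exI[of _ c]) auto
qed

text \<open>The term p = 1 of the supremum; this logarithmic lower bound already shows that
  associated functions tend to infinity.\<close>

lemma assoc_fun_ge_ln:
  assumes M: "weight_seq M" and r: "r \<in> roumieu_seqs" and "\<rho> \<ge> 0"
  shows "assoc_fun M r \<rho> \<ge> ln (\<rho> / wt M r 1)"
  using assoc_fun_upper[OF assms, of 1] by simp

text \<open>In the variable \<open>ln \<rho>\<close> the associated function is a supremum of convex functions.\<close>

lemma continuous_on_assoc_fun:
  assumes M: "weight_seq M" and r: "r \<in> roumieu_seqs"
  shows "continuous_on {0<..} (assoc_fun M r)"
proof -
  define F where "F s = assoc_fun M r (exp s)" for s
  have ln_eq: "ln (exp s ^ p / wt M r p) = real p * s - ln (wt M r p)" for s p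
    using wt_pos[OF M r, of p] by (simp add: ln_div ln_realpow)
  have F_ge: "max (real p * s - ln (wt M r p)) 0 \<le> F s" for s p
    using assoc_fun_upper[OF M r, of "exp s" p] by (simp add: F_def ln_eq)
  have "convex_on UNIV F"
  proof (rule convex_onI)
    fix t x y :: real assume t: "0 < t" "t < 1"
    have "max (real p * ((1 - t) *\<^sub>R x + t *\<^sub>R y) - ln (wt M r p)) 0 \<le> (1 - t) * F x + t * F y" for p
    proof -
      have "(1 - t) * max (real p * x - ln (wt M r p)) 0 + t * max (real p * y - ln (wt M r p)) 0
          \<le> (1 - t) * F x + t * F y"
        by (intro add_mono mult_left_mono F_ge) (use t in auto)
      moreover have "(1 - t) * (real p * x - ln (wt M r p)) \<le> (1 - t) * max (real p * x - ln (wt M r p)) 0"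
        "t * (real p * y - ln (wt M r p)) \<le> t * max (real p * y - ln (wt M r p)) 0"
        "0 \<le> (1 - t) * max (real p * x - ln (wt M r p)) 0" "0 \<le> t * max (real p * y - ln (wt M r p)) 0"
        by (intro mult_left_mono mult_nonneg_nonneg; use t in simp)+
      moreover have "real p * ((1 - t) *\<^sub>R x + t *\<^sub>R y) - ln (wt M r p)
          = (1 - t) * (real p * x - ln (wt M r p)) + t * (real p * y - ln (wt M r p))"
        by (simp add: algebra_simps)
      ultimately show ?thesis by (intro max.boundedI) linarith+
    qed
    then show "F ((1 - t) *\<^sub>R x + t *\<^sub>R y) \<le> (1 - t) * F x + t * F y"
      unfolding F_def assoc_fun_wt[of M r "exp ((1 - t) *\<^sub>R x + t *\<^sub>R y)"] ln_eq by (intro cSUP_least) auto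
  qed auto
  then have "continuous_on UNIV F" using convex_on_continuous[of UNIV F] by simp
  then have "continuous_on {0<..} (\<lambda>\<rho>. F (ln \<rho>))"
    by (rule continuous_on_compose2) (auto intro!: continuous_on_ln)
  then show ?thesis by (rule continuous_on_eq) (simp add: F_def)
qed

section \<open>Cutoff functions of one variable\<close>

definition average :: "real \<Rightarrow> (real \<Rightarrow> real) \<Rightarrow> real \<Rightarrow> real" where
  "average a f x = integral {x - a..x + a} f / (2 * a)"

lemma average_has_derivative:
  assumes f: "continuous_on UNIV f" and "a > 0"
  shows "(average a f has_real_derivative (f (x + a) - f (x - a)) / (2 * a)) (at x)"
proof -
  define c where "c = x - a - 1"
  define G where "G y = integral {c..y} f" for y
  have int: "f integrable_on {u..v}" for u v
    using integrable_continuous_interval continuous_on_subset[OF f] by blast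
  have G: "(G has_real_derivative f y) (at y)" if "y > c" for y
    using integral_has_real_derivative[of c "y + 1" f y] that continuous_on_subset[OF f]
    unfolding G_def by (simp add: at_within_Icc_at)
  have "((\<lambda>y. (G (y + a) - G (y - a)) / (2 * a)) has_real_derivative (f (x + a) - f (x - a)) / (2 * a)) (at x)"
    by (rule DERIV_cdivide) (use \<open>a > 0\<close> in \<open>auto intro!: derivative_eq_intros DERIV_chain2[OF G] simp: c_def\<close>)
  moreover have "eventually (\<lambda>y. (G (y + a) - G (y - a)) / (2 * a) = average a f y) (nhds x)"
  proof -
    have "eventually (\<lambda>y. y \<in> {x - 1<..<x + 1}) (nhds x)"
      by (intro eventually_nhds_in_open) auto
    then show ?thesis
    proof eventually_elim
      case (elim y)
      have "G (y - a) + integral {y - a..y + a} f = G (y + a)"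
        unfolding G_def by (rule Henstock_Kurzweil_Integration.integral_combine)
          (use elim int \<open>a > 0\<close> in \<open>auto simp: c_def\<close>)
      then show ?case by (simp add: average_def)
    qed
  qed
  ultimately show ?thesis by (subst (asm) DERIV_cong_ev) auto
qed

lemma average_continuous:
  assumes "continuous_on UNIV f" "a > 0" shows "continuous_on UNIV (average a f)"
  using DERIV_isCont[OF average_has_derivative[OF assms]] by (simp add: continuous_at_imp_continuous_on)

text \<open>Averaging does not increase the uniform distance. With a constant in place of g, the
  same estimate yields the range, the local constancy and the approximation error of
  averages.\<close>

lemma average_diff_le:
  assumes f: "continuous_on UNIV f" and g: "continuous_on UNIV g" and a: "a > 0"
    and le: "\<And>y. \<bar>y - x\<bar> \<le> a \<Longrightarrow> \<bar>f y - g y\<bar> \<le> B"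
  shows "\<bar>average a f x - average a g x\<bar> \<le> B"
proof -
  have int: "h integrable_on {x - a..x + a}" if "continuous_on UNIV h" for h :: "real \<Rightarrow> real"
    using integrable_continuous_interval continuous_on_subset[OF that] by blast
  have "norm (integral {x - a..x + a} (\<lambda>y. f y - g y)) \<le> integral {x - a..x + a} (\<lambda>y. B)"
    by (rule integral_norm_bound_integral) (auto intro!: int continuous_intros f g le)
  also have "\<dots> = B * (2 * a)" using a by simp
  finally have "\<bar>integral {x - a..x + a} f - integral {x - a..x + a} g\<bar> \<le> B * (2 * a)"
    using int[OF f] int[OF g] by (simp add: integral_diff)
  then show ?thesis using a by (simp add: average_def field_simps flip: diff_divide_distrib)
qed

lemma average_const: "a > 0 \<Longrightarrow> average a (\<lambda>_. c) x = c"
  by (simp add: average_def)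

text \<open>For \<open>n \<rightarrow> \<infinity>\<close> one obtains the convolution of \<open>f\<close> with infinitely many normalized box functions of
  widths \<open>2 * a p, 2 * a (p + 1), \<dots>\<close>, as in the proof of the Denjoy--Carleman theorem.\<close>

primrec bump_approx :: "(nat \<Rightarrow> real) \<Rightarrow> (real \<Rightarrow> real) \<Rightarrow> nat \<Rightarrow> nat \<Rightarrow> real \<Rightarrow> real" where
  "bump_approx a f 0 p = f"
| "bump_approx a f (Suc n) p = average (a p) (bump_approx a f n (Suc p))"

definition bump :: "(nat \<Rightarrow> real) \<Rightarrow> (real \<Rightarrow> real) \<Rightarrow> nat \<Rightarrow> real \<Rightarrow> real" where
  "bump a f p x = lim (\<lambda>n. bump_approx a f n p x)"

text \<open>Level p is the average of level p + 1 over half-width a_p, so its derivative is a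
  difference quotient of level p + 1. Each derivative uses up one box and costs a factor 1 /
  a_p.\<close>

primrec bump_deriv :: "(nat \<Rightarrow> real) \<Rightarrow> (real \<Rightarrow> real) \<Rightarrow> nat \<Rightarrow> nat \<Rightarrow> real \<Rightarrow> real" where
  "bump_deriv a f 0 p x = bump a f p x"
| "bump_deriv a f (Suc q) p x = (bump_deriv a f q (Suc p) (x + a p) - bump_deriv a f q (Suc p) (x - a p)) / (2 * a p)"

context
  fixes a :: "nat \<Rightarrow> real" and f :: "real \<Rightarrow> real" and L :: real
  assumes a_pos: "\<And>j. a j > 0" and a_sum: "summable a"
    and f_lip: "\<And>x y. \<bar>f x - f y\<bar> \<le> L * \<bar>x - y\<bar>"
    and f_range: "\<And>x. 0 \<le> f x" "\<And>x. f x \<le> 1"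
begin

lemma lipschitz_constant_nonneg: "L \<ge> 0" using f_lip[of 1 0] by simp

lemma lipschitz_continuous_real: "continuous_on UNIV f"
  by (rule lipschitz_on_continuous_on[of L]) (auto intro!: lipschitz_onI f_lip lipschitz_constant_nonneg simp: dist_real_def)

lemma bump_approx_continuous: "continuous_on UNIV (bump_approx a f n p)"
  by (induction n arbitrary: p) (auto intro: lipschitz_continuous_real average_continuous a_pos)

text \<open>Passing from n to n + 1 inserts one innermost average, of half-width a_{p+n}. On the
  Lipschitz function f it costs at most L a_{p+n}, and the outer averages do not enlarge the
  error.\<close>

lemma bump_approx_step: "\<bar>bump_approx a f (Suc n) p x - bump_approx a f n p x\<bar> \<le> L * a (p + n)"
proof (induction n arbitrary: p x)
  case 0
  have "\<bar>average (a p) f x - average (a p) (\<lambda>_. f x) x\<bar> \<le> L * a p"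
    by (rule average_diff_le)
      (auto intro!: lipschitz_continuous_real a_pos order_trans[OF f_lip] mult_left_mono lipschitz_constant_nonneg)
  then show ?case by (simp add: average_const a_pos)
next
  case (Suc n)
  have "\<bar>average (a p) (bump_approx a f (Suc n) (Suc p)) x - average (a p) (bump_approx a f n (Suc p)) x\<bar>
      \<le> L * a (Suc p + n)"
    using Suc[of "Suc p"] by (intro average_diff_le bump_approx_continuous a_pos) simp
  then show ?case by simp
qed

lemma bump_approx_uniform: "uniform_limit UNIV (\<lambda>n x. bump_approx a f n p x) (bump a f p) sequentially"
proof -
  let ?d = "\<lambda>n x. bump_approx a f (Suc n) p x - bump_approx a f n p x"
  have "summable (\<lambda>n. L * a (p + n))"
    using summable_mult[OF summable_ignore_initial_segment[OF a_sum, of p]] by (simp add: add.commute)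
  then have "uniform_limit UNIV (\<lambda>n x. \<Sum>i<n. ?d i x) (\<lambda>x. \<Sum>i. ?d i x) sequentially"
    by (rule Weierstrass_m_test[rotated]) (use bump_approx_step in auto)
  then have "uniform_limit UNIV (\<lambda>n x. f x + (\<Sum>i<n. ?d i x)) (\<lambda>x. f x + (\<Sum>i. ?d i x)) sequentially"
    by (intro uniform_limit_intros)
  then have ul: "uniform_limit UNIV (\<lambda>n x. bump_approx a f n p x) (\<lambda>x. f x + (\<Sum>i. ?d i x)) sequentially"
    by (subst (asm) sum_lessThan_telescope) simp
  have "(\<lambda>n. bump_approx a f n p x) \<longlonglongrightarrow> f x + (\<Sum>i. ?d i x)" for x
    using tendsto_uniform_limitI[OF ul] by simp
  then have "bump a f p = (\<lambda>x. f x + (\<Sum>i. ?d i x))"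
    unfolding bump_def by (auto intro: limI)
  with ul show ?thesis by simp
qed

lemma bump_approx_tendsto: "(\<lambda>n. bump_approx a f n p x) \<longlonglongrightarrow> bump a f p x"
  using tendsto_uniform_limitI[OF bump_approx_uniform] by simp

lemma bump_continuous: "continuous_on UNIV (bump a f p)"
  by (rule uniform_limit_theorem[OF _ bump_approx_uniform]) (simp_all add: bump_approx_continuous)

text \<open>Uniform convergence lets the limit pass through the outermost average.\<close>

lemma bump_rec: "bump a f p x = average (a p) (bump a f (Suc p)) x"
proof (rule LIMSEQ_unique)
  show "(\<lambda>n. bump_approx a f (Suc n) p x) \<longlonglongrightarrow> bump a f p x"
    using bump_approx_tendsto by (rule LIMSEQ_Suc)
  show "(\<lambda>n. bump_approx a f (Suc n) p x) \<longlonglongrightarrow> average (a p) (bump a f (Suc p)) x"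
  proof (rule LIMSEQ_I)
    fix e :: real assume "e > 0"
    then have "eventually (\<lambda>n. \<forall>y\<in>UNIV. dist (bump_approx a f n (Suc p) y) (bump a f (Suc p) y) < e / 2) sequentially"
      by (intro uniform_limitD[OF bump_approx_uniform]) simp
    then obtain N where N: "\<And>n y. n \<ge> N \<Longrightarrow> \<bar>bump_approx a f n (Suc p) y - bump a f (Suc p) y\<bar> < e / 2"
      unfolding eventually_sequentially by (auto simp: dist_real_def)
    have "\<bar>average (a p) (bump_approx a f n (Suc p)) x - average (a p) (bump a f (Suc p)) x\<bar> \<le> e / 2"
      if "n \<ge> N" for n
      by (intro average_diff_le bump_approx_continuous bump_continuous a_pos less_imp_le[OF N[OF that]])
    then show "\<exists>N. \<forall>n\<ge>N. norm (bump_approx a f (Suc n) p x - average (a p) (bump a f (Suc p)) x) < e"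
      using \<open>e > 0\<close> by (intro exI[of _ N]) fastforce
  qed
qed

lemma bump_approx_range: "0 \<le> bump_approx a f n p x \<and> bump_approx a f n p x \<le> 1"
proof (induction n arbitrary: p x)
  case (Suc n)
  \<comment> \<open>The range [0, 1] is encoded as distance at most 1/2 from the constant
    1/2.\<close>
  have "\<bar>average (a p) (bump_approx a f n (Suc p)) x - average (a p) (\<lambda>_. 1 / 2) x\<bar> \<le> 1 / 2"
  proof (intro average_diff_le bump_approx_continuous a_pos continuous_intros)
    fix y show "\<bar>bump_approx a f n (Suc p) y - 1 / 2\<bar> \<le> 1 / 2" using Suc[of "Suc p" y] by arith
  qed
  then have "\<bar>average (a p) (bump_approx a f n (Suc p)) x - 1 / 2\<bar> \<le> 1 / 2"
    by (simp add: average_const a_pos)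
  then show ?case unfolding bump_approx.simps by arith
qed (use f_range in auto)

lemma bump_range: "0 \<le> bump a f p x" "bump a f p x \<le> 1"
  using bump_approx_range
  by (auto intro: tendsto_lowerbound[OF bump_approx_tendsto] tendsto_upperbound[OF bump_approx_tendsto])

lemma bump_approx_local:
  assumes "\<And>y. \<bar>y - x\<bar> \<le> (\<Sum>j<n. a (p + j)) \<Longrightarrow> f y = c"
  shows "bump_approx a f n p x = c"
  using assms
proof (induction n arbitrary: p x)
  case (Suc n)
  have "\<bar>average (a p) (bump_approx a f n (Suc p)) x - average (a p) (\<lambda>_. c) x\<bar> \<le> 0"
  proof (rule average_diff_le)
    fix y assume y: "\<bar>y - x\<bar> \<le> a p"
    have "bump_approx a f n (Suc p) y = c"
    proof (rule Suc.IH)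
      fix z assume "\<bar>z - y\<bar> \<le> (\<Sum>j<n. a (Suc p + j))"
      then have "\<bar>z - x\<bar> \<le> (\<Sum>j<Suc n. a (p + j))"
        unfolding sum.lessThan_Suc_shift using y by simp
      then show "f z = c" by (rule Suc.prems)
    qed
    then show "\<bar>bump_approx a f n (Suc p) y - c\<bar> \<le> 0" by simp
  qed (auto intro: bump_approx_continuous a_pos)
  then show ?case by (simp add: average_const a_pos)
qed simp

lemma sum_shift_le: "(\<Sum>j<n. a (p + j)) \<le> suminf a"
proof -
  have "(\<Sum>j<n. a (p + j)) = sum a {p..<p + n}"
    by (simp add: sum.shift_bounds_nat_ivl atLeast0LessThan[symmetric] add.commute[of p]
        sum.shift_bounds_nat_ivl[of a 0 p n, simplified])
  also have "\<dots> \<le> suminf a"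
    by (rule sum_le_suminf[OF a_sum]) (auto intro: less_imp_le[OF a_pos])
  finally show ?thesis .
qed

lemma bump_local:
  assumes "\<And>y. \<bar>y - x\<bar> \<le> suminf a \<Longrightarrow> f y = c" shows "bump a f p x = c"
proof -
  have "bump_approx a f n p x = c" for n
    by (rule bump_approx_local) (use assms sum_shift_le[of p n] in auto)
  then show ?thesis using bump_approx_tendsto[of p x] by (simp add: LIMSEQ_const_iff)
qed

lemma bump_deriv_has_derivative:
  "(bump_deriv a f q p has_real_derivative bump_deriv a f (Suc q) p x) (at x)"
proof (induction q arbitrary: p x)
  case 0
  have "bump_deriv a f 0 p = average (a p) (bump a f (Suc p))"
    by (rule ext) (simp add: bump_rec)
  then show ?case using average_has_derivative[OF bump_continuous[of "Suc p"] a_pos[of p], of x] by simp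
next
  case (Suc q)
  note [derivative_intros] = DERIV_chain2[OF Suc]
  have "((\<lambda>x. (bump_deriv a f q (Suc p) (x + a p) - bump_deriv a f q (Suc p) (x - a p)) / (2 * a p))
      has_real_derivative bump_deriv a f (Suc (Suc q)) p x) (at x)"
    unfolding bump_deriv.simps(2)[of a f "Suc q" p x]
    by (rule DERIV_cdivide) (auto intro!: derivative_eq_intros simp del: bump_deriv.simps)
  then show ?case by simp
qed

lemma bump_deriv_bound: "\<bar>bump_deriv a f q p x\<bar> \<le> (\<Prod>j<q. 1 / a (p + j))"
proof (induction q arbitrary: p x)
  case 0
  then show ?case using bump_range by simp
next
  case (Suc q)
  have "\<bar>bump_deriv a f (Suc q) p x\<bar>
      \<le> (\<bar>bump_deriv a f q (Suc p) (x + a p)\<bar> + \<bar>bump_deriv a f q (Suc p) (x - a p)\<bar>) / (2 * a p)"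
    using a_pos[of p] by (auto simp: divide_le_cancel)
  also have "\<dots> \<le> ((\<Prod>j<q. 1 / a (Suc p + j)) + (\<Prod>j<q. 1 / a (Suc p + j))) / (2 * a p)"
    by (intro divide_right_mono add_mono Suc) (use a_pos[of p] in auto)
  also have "\<dots> = (\<Prod>j<Suc q. 1 / a (p + j))"
    unfolding prod.lessThan_Suc_shift by simp
  finally show ?case .
qed

text \<open>Two spreads add up: the averages enlarge the support of f by at most
  \<open>suminf a\<close>, and the q difference quotients shift it by at most a_p + ... +
  a_{p+q-1}.\<close>

lemma bump_deriv_support:
  assumes f0: "\<And>y. \<bar>y\<bar> \<ge> A \<Longrightarrow> f y = 0" and x: "\<bar>x\<bar> \<ge> A + suminf a + (\<Sum>j<q. a (p + j))"
  shows "bump_deriv a f q p x = 0"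
  using x
proof (induction q arbitrary: p x)
  case 0
  then show ?case using f0 by (auto intro!: bump_local)
next
  case (Suc q)
  have "bump_deriv a f q (Suc p) y = 0" if "\<bar>y - x\<bar> \<le> a p" for y
  proof (rule Suc.IH)
    show "A + suminf a + (\<Sum>j<q. a (Suc p + j)) \<le> \<bar>y\<bar>"
      using Suc.prems that unfolding sum.lessThan_Suc_shift by simp
  qed
  then show ?case using a_pos[of p] by simp
qed

end

text \<open>Half-widths proportional to M_j / M_{j+1} make the derivative bound telescope: the
  product of the 1 / a_j for j < q is A^{-q} M_q. The family \<kappa> lists the function together
  with all its derivatives.\<close>

lemma ultradiff_bump:
  assumes M: "weight_seq M" and \<delta>: "\<delta> > 0"
  shows "\<exists>\<kappa>::nat \<Rightarrow> real \<Rightarrow> real. \<exists>L>0.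
     (\<forall>q t. (\<kappa> q has_real_derivative \<kappa> (Suc q) t) (at t)) \<and>
     (\<forall>t. \<bar>t\<bar> \<le> \<delta> \<longrightarrow> \<kappa> 0 t = 1) \<and> (\<forall>q t. \<bar>t\<bar> \<ge> 4 * \<delta> \<longrightarrow> \<kappa> q t = 0) \<and>
     (\<forall>q t. \<bar>\<kappa> q t\<bar> \<le> L ^ q * M q)"
proof -
  note pos = weight_seq_pos[OF M]
  define S where "S = (\<Sum>j. M j / M (Suc j))"
  have "S > 0" unfolding S_def by (rule suminf_pos[OF weight_seq_summable[OF M]]) (simp add: pos)
  \<comment> \<open>Total half-width \<delta>/2. The trapezoid f below is 1 up to 2 \<delta> and 0
    from 3 \<delta> on. Averaging spoils at most \<delta>/2 on the inside; averaging and difference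
    quotients together spoil at most \<delta>/2 + \<delta>/2 on the outside. This leaves the radii
    \<delta> and 4 \<delta>.\<close>
  define A where "A = \<delta> / 2 / S"
  have A: "A > 0" using \<open>S > 0\<close> \<delta> by (simp add: A_def)
  define a where "a j = A * (M j / M (Suc j))" for j
  have a_pos: "a j > 0" for j using A pos by (simp add: a_def)
  have a_sum: "summable a" unfolding a_def by (intro summable_mult weight_seq_summable[OF M])
  have sum_a: "suminf a = \<delta> / 2"
    unfolding a_def using \<open>S > 0\<close> by (subst suminf_mult[OF weight_seq_summable[OF M]]) (simp add: A_def S_def)
  define f where "f t = max 0 (min 1 (3 - \<bar>t\<bar> / \<delta>))" for t
  have f_lip: "\<bar>f x - f y\<bar> \<le> (1 / \<delta>) * \<bar>x - y\<bar>" for x y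
  proof -
    have "\<bar>f x - f y\<bar> \<le> \<bar>\<bar>x\<bar> / \<delta> - \<bar>y\<bar> / \<delta>\<bar>" unfolding f_def by linarith
    also have "\<dots> = \<bar>\<bar>x\<bar> - \<bar>y\<bar>\<bar> / \<delta>" using \<delta> by (simp flip: diff_divide_distrib)
    also have "\<dots> \<le> \<bar>x - y\<bar> / \<delta>" using \<delta> by (intro divide_right_mono) auto
    finally show ?thesis by simp
  qed
  have f_range: "0 \<le> f x" "f x \<le> 1" for x by (auto simp: f_def)
  have f0: "f y = 0" if "\<bar>y\<bar> \<ge> 3 * \<delta>" for y using that \<delta> by (simp add: f_def field_simps)
  have f1: "f y = 1" if "\<bar>y\<bar> \<le> 2 * \<delta>" for y using that \<delta> by (simp add: f_def field_simps)
  note ax = a_pos a_sum f_lip f_range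
  define \<kappa> where "\<kappa> q = bump_deriv a f q 0" for q
  have "(\<kappa> q has_real_derivative \<kappa> (Suc q) t) (at t)" for q t
    unfolding \<kappa>_def by (rule bump_deriv_has_derivative[OF ax])
  moreover have "\<kappa> 0 t = 1" if "\<bar>t\<bar> \<le> \<delta>" for t
    unfolding \<kappa>_def bump_deriv.simps
    by (rule bump_local[OF ax]) (rule f1, use that \<delta> sum_a in \<open>arith\<close>)
  moreover have "\<kappa> q t = 0" if "\<bar>t\<bar> \<ge> 4 * \<delta>" for q t
    unfolding \<kappa>_def
  proof (rule bump_deriv_support[OF ax])
    show "3 * \<delta> + suminf a + (\<Sum>j<q. a (0 + j)) \<le> \<bar>t\<bar>"
      using sum_shift_le[OF ax, of 0 q] that \<delta> by (simp add: sum_a)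
  qed (use f0 in auto)
  moreover have "\<bar>\<kappa> q t\<bar> \<le> (1 / A) ^ q * M q" for q t
  proof -
    have "(\<Prod>j<q. 1 / a (0 + j)) = (1 / A) ^ q * M q"
    proof (induction q)
      case (Suc q)
      then show ?case using pos[of q] by (simp add: a_def)
    qed (simp add: weight_seq_0[OF M])
    then show ?thesis unfolding \<kappa>_def using bump_deriv_bound[OF ax, of q 0 t] by simp
  qed
  ultimately show ?thesis using A by (intro exI[of _ \<kappa>] exI[of _ "1 / A"]) auto
qed

section \<open>Leibniz rule and tensor products\<close>

text \<open>\<open>leib u v p a b\<close> is the \<open>p\<close>-th derivative of the product of the \<open>a\<close>-th derivative of \<open>u\<close> and
  the \<open>b\<close>-th derivative of \<open>v\<close>, where \<open>u\<close> and \<open>v\<close> list the derivatives at one point.\<close>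

primrec leib :: "(nat \<Rightarrow> complex) \<Rightarrow> (nat \<Rightarrow> complex) \<Rightarrow> nat \<Rightarrow> nat \<Rightarrow> nat \<Rightarrow> complex" where
  "leib u v 0 a b = u a * v b"
| "leib u v (Suc p) a b = leib u v p (Suc a) b + leib u v p a (Suc b)"

text \<open>The recursion has 2^p leaves, each a product whose two orders add up to a + b +
  p.\<close>

lemma norm_leib_le:
  assumes "\<And>q q'. q + q' = a + b + p \<Longrightarrow> cmod (u q) * cmod (v q') \<le> X"
  shows "cmod (leib u v p a b) \<le> 2 ^ p * X"
  using assms
proof (induction p arbitrary: a b)
  case (Suc p)
  have "cmod (leib u v (Suc p) a b) \<le> cmod (leib u v p (Suc a) b) + cmod (leib u v p a (Suc b))"
    by (simp add: norm_triangle_ineq)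
  also have "\<dots> \<le> 2 ^ p * X + 2 ^ p * X"
    by (intro add_mono Suc.IH Suc.prems) auto
  finally show ?case by (simp add: mult_ac)
qed (simp add: norm_mult)

lemma leib_eq_0:
  assumes "\<And>a. u a = 0" shows "leib u v p a b = 0"
  by (induction p arbitrary: a b) (simp_all add: assms)

lemma leib_has_vector_derivative:
  assumes "\<And>q. ((\<lambda>t. u t q) has_vector_derivative u s (Suc q)) (at s)"
    and "\<And>q. ((\<lambda>t. v t q) has_vector_derivative v s (Suc q)) (at s)"
  shows "((\<lambda>t. leib (u t) (v t) p a b) has_vector_derivative leib (u s) (v s) (Suc p) a b) (at s)"
proof (induction p arbitrary: a b)
  case 0
  show ?case
    using has_vector_derivative_mult[OF assms(1)[of a] assms(2)[of b]] by (simp add: add.commute)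
next
  case (Suc p)
  show ?case
    using has_vector_derivative_add[OF Suc[of "Suc a" b] Suc[of a "Suc b"]] by simp
qed

text \<open>Halving r divides the weight of order q by 2^q, which pays for the 2^p terms of the
  Leibniz rule.\<close>

abbreviation halved :: "(nat \<Rightarrow> real) \<Rightarrow> nat \<Rightarrow> real" where
  "halved r \<equiv> \<lambda>i. 1 / 2 * r i"

lemma halved_roumieu: "r \<in> roumieu_seqs \<Longrightarrow> halved r \<in> roumieu_seqs"
  using roumieu_scale[of r "1 / 2"] by simp

text \<open>The constant is fixed before u, v, A and B, because these will depend on \<epsilon> and
  on the frequency.\<close>

abbreviation leib_const :: "(nat \<Rightarrow> real) \<Rightarrow> (nat \<Rightarrow> real) \<Rightarrow> real \<Rightarrow> real \<Rightarrow> bool" where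
  "leib_const M l L C \<equiv> \<forall>u v A B p. A \<ge> 0 \<longrightarrow> B \<ge> 0 \<longrightarrow> (\<forall>q. cmod (u q) \<le> A * (L ^ q * M q)) \<longrightarrow>
    (\<forall>q. cmod (v q) \<le> B * wt M (halved l) q) \<longrightarrow> cmod (leib u v p 0 0) \<le> C * A * B * wt M l p"

text \<open>For orders q + q' = p the factor 2^p splits as 2^q 2^{q'}. The halved sequence
  compensates 2^{q'}; the remaining (2 L)^q is absorbed by l_1 ... l_q.\<close>

lemma leib_weight_bound:
  assumes M: "weight_seq M" and l: "l \<in> roumieu_seqs" and L: "L > 0"
  shows "\<exists>C>0. leib_const M l L C"
proof -
  note pos = weight_seq_pos[OF M] and Rpos = roumieu_prod_pos[OF l]
  obtain c where c: "c > 0" "\<And>q. c * (2 * L) ^ q \<le> (\<Prod>i=1..q. l i)"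
    using roumieu_prod_superexp[OF l, of "2 * L"] L by auto
  have "cmod (leib u v p 0 0) \<le> (1 / c) * A * B * wt M l p"
    if AB: "A \<ge> 0" "B \<ge> 0" and u: "\<forall>q. cmod (u q) \<le> A * (L ^ q * M q)"
      and v: "\<forall>q. cmod (v q) \<le> B * wt M (halved l) q" for u v A B p
  proof -
    have "cmod (leib u v p 0 0) \<le> 2 ^ p * ((1 / c) * A * B * wt M l p / 2 ^ p)"
    proof (rule norm_leib_le)
      fix q q' assume "q + q' = 0 + 0 + p"
      then have p: "p = q + q'" by simp
      have w: "wt M (halved l) q' = M q' * (\<Prod>i=1..q'. l i) / 2 ^ q'"
        by (simp add: wt_def prod_dividef)
      have "cmod (u q) * cmod (v q') \<le> A * (L ^ q * M q) * (B * (M q' * (\<Prod>i=1..q'. l i) / 2 ^ q'))"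
        using u v AB L pos[of q] unfolding w[symmetric] by (intro mult_mono) auto
      also have "\<dots> = (A * B / 2 ^ p) * ((M q * M q') * ((2 * L) ^ q * (\<Prod>i=1..q'. l i)))"
        by (simp add: p power_add power_mult_distrib)
      also have "\<dots> \<le> (A * B / 2 ^ p) * (M p * ((1 / c * (\<Prod>i=1..q. l i)) * (\<Prod>i=1..q'. l i)))"
        unfolding p
        by (intro mult_left_mono mult_mono mult_right_mono weight_seq_mult_le[OF M])
          (use AB L c c(2)[of q] pos Rpos in \<open>auto simp: less_imp_le field_simps simp del: power_mult_distrib\<close>)
      also have "\<dots> \<le> (A * B / 2 ^ p) * (M p * (1 / c * (\<Prod>i=1..p. l i)))"
        using roumieu_prod_mult_le[OF l, of q q'] AB c pos[of p]
        by (intro mult_left_mono) (auto simp: p divide_right_mono)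
      finally show "cmod (u q) * cmod (v q') \<le> (1 / c) * A * B * wt M l p / 2 ^ p"
        by (simp add: wt_def mult_ac)
    qed
    then show ?thesis by simp
  qed
  with c(1) show ?thesis by (intro exI[of _ "1 / c"]) auto
qed

text \<open>If each \<open>W j\<close> lists the derivatives of a function of one variable,
  \<open>tensor W \<alpha>\<close> is the \<alpha>-th derivative of the product of these functions
  in separate variables, and \<open>tensor W (\<lambda>_. 0)\<close> is the product itself.\<close>

definition tensor :: "('n::finite \<Rightarrow> nat \<Rightarrow> real \<Rightarrow> complex) \<Rightarrow> ('n \<Rightarrow> nat) \<Rightarrow> real^'n \<Rightarrow> complex" where
  "tensor W \<alpha> x = (\<Prod>j\<in>UNIV. W j (\<alpha> j) (x $ j))"

lemma prod_wt_le:
  assumes "weight_seq M" "r \<in> roumieu_seqs" "finite S"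
  shows "(\<Prod>j\<in>S. wt M r (\<alpha> j)) \<le> wt M r (\<Sum>j\<in>S. \<alpha> j)"
  using assms(3)
proof induction
  case (insert j S)
  have "(\<Prod>j\<in>insert j S. wt M r (\<alpha> j)) \<le> wt M r (\<alpha> j) * wt M r (\<Sum>j\<in>S. \<alpha> j)"
    using insert wt_pos[OF assms(1,2)] by (simp add: mult_left_mono less_imp_le)
  also have "\<dots> \<le> wt M r (\<Sum>j\<in>insert j S. \<alpha> j)"
    using insert wt_mult_le[OF assms(1,2)] by simp
  finally show ?case .
qed (simp add: wt_0[OF assms(1)])

lemma count_list_some: "count_list (SOME js. \<forall>i. count_list js i = \<alpha> i) j = (\<alpha> :: 'n::finite \<Rightarrow> nat) j"
  using someI_ex[OF ex_list_of_multi_index[of \<alpha>]] by blast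

lemma partialI:
  "((\<lambda>t. f (x + t *\<^sub>R axis i 1)) has_vector_derivative D) (at 0) \<Longrightarrow> partial i f x = D"
  unfolding partial_def by (rule vector_derivative_at)

context
  fixes W :: "'n::finite \<Rightarrow> nat \<Rightarrow> real \<Rightarrow> complex"
  assumes W: "\<And>j q t. (W j q has_vector_derivative W j (Suc q) t) (at t)"
begin

lemma tensor_line_derivative:
  "((\<lambda>t. tensor W \<alpha> (x + t *\<^sub>R axis i 1)) has_vector_derivative tensor W (\<alpha>(i := Suc (\<alpha> i))) x) (at 0)"
proof -
  have eq: "tensor W \<alpha> (x + t *\<^sub>R axis i 1) =
      W i (\<alpha> i) (x $ i + t) * (\<Prod>j\<in>UNIV - {i}. W j (\<alpha> j) (x $ j))" for t
    unfolding tensor_def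
    by (subst prod.remove[of _ i]) (auto simp: axis_def intro!: arg_cong2[where f = "(*)"] prod.cong)
  have eq': "tensor W (\<alpha>(i := Suc (\<alpha> i))) x =
      W i (Suc (\<alpha> i)) (x $ i) * (\<Prod>j\<in>UNIV - {i}. W j (\<alpha> j) (x $ j))"
    unfolding tensor_def
    by (subst prod.remove[of _ i]) (auto intro!: arg_cong2[where f = "(*)"] prod.cong)
  have "((\<lambda>t. W i (\<alpha> i) (x $ i + t)) has_vector_derivative 1 *\<^sub>R W i (Suc (\<alpha> i)) (x $ i + 0)) (at 0)"
    by (rule vector_diff_chain_at[of "\<lambda>t. x $ i + t" 1 0 "W i (\<alpha> i)", unfolded o_def])
      (auto intro!: derivative_eq_intros W)
  then show ?thesis
    unfolding eq eq' by (intro has_vector_derivative_mult_left) simp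
qed

lemma tensor_differentiable: "tensor W \<alpha> differentiable (at x)"
proof -
  have "((\<lambda>x. W j (\<alpha> j) (x $ j)) has_derivative (\<lambda>h. (h $ j) *\<^sub>R W j (Suc (\<alpha> j)) (x $ j))) (at x)" for j
    using has_derivative_compose[of "\<lambda>x. x $ j" "\<lambda>h. h $ j" x UNIV "W j (\<alpha> j)"]
      W[of j "\<alpha> j" "x $ j"] bounded_linear_imp_has_derivative[OF bounded_linear_vec_nth, of j]
    by (auto simp: has_vector_derivative_def)
  then show ?thesis
    unfolding differentiable_def tensor_def[abs_def] by (intro exI, rule has_derivative_prod)
qed

text \<open>Only the number of occurrences of each direction survives, so for these functions the
  list chosen in \<open>multi_deriv\<close> is immaterial.\<close>

lemma foldr_partial_tensor: "foldr partial js (tensor W (\<lambda>_. 0)) = tensor W (count_list js)"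
proof (induction js)
  case (Cons i js)
  have eq: "count_list (i # js) = (count_list js)(i := Suc (count_list js i))" by auto
  have "partial i (tensor W (count_list js)) = tensor W (count_list (i # js))"
    unfolding eq by (rule ext) (rule partialI[OF tensor_line_derivative])
  then show ?case by (simp only: foldr.simps o_apply Cons)
qed (simp add: fun_eq_iff tensor_def)

lemma smooth_on_tensor: "smooth_on \<Omega> (tensor W (\<lambda>_. 0))"
  unfolding smooth_on_def foldr_partial_tensor
  by (auto intro!: differentiable_at_imp_differentiable_on tensor_differentiable)

lemma multi_deriv_tensor: "multi_deriv \<alpha> (tensor W (\<lambda>_. 0)) = tensor W \<alpha>"
  unfolding multi_deriv_def foldr_partial_tensor by (rule ext) (simp add: tensor_def count_list_some)

text \<open>Supermultiplicativity of the weights (\<open>prod_wt_le\<close>) turns a product of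
  bounds in one variable into the weight of the total order.\<close>

lemma useminorm_tensor:
  assumes M: "weight_seq M" and r: "r \<in> roumieu_seqs"
    and b: "\<And>j q t. cmod (W j q t) \<le> A j * wt M r q"
  shows "useminorm M r K (tensor W (\<lambda>_. 0)) \<le> ennreal (\<Prod>j\<in>UNIV. A j)"
  unfolding useminorm_def
proof (rule SUP_least)
  fix z :: "(real^'n) \<times> ('n \<Rightarrow> nat)"
  obtain x \<alpha> where z: "z = (x, \<alpha>)" by (cases z)
  have A: "A j \<ge> 0" for j
    using order_trans[OF norm_ge_zero b[of j 0 0]] by (simp add: wt_0[OF M])
  have "cmod (tensor W \<alpha> x) \<le> (\<Prod>j\<in>UNIV. A j * wt M r (\<alpha> j))"
    unfolding tensor_def prod_norm[symmetric] by (intro prod_mono) (auto intro: b)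
  also have "\<dots> \<le> (\<Prod>j\<in>UNIV. A j) * wt M r (order_of \<alpha>)"
    unfolding prod.distrib by (intro mult_left_mono prod_wt_le[OF M r] prod_nonneg) (auto simp: A)
  finally have "ennreal (cmod (tensor W \<alpha> x) / wt M r (order_of \<alpha>)) \<le> ennreal (\<Prod>j\<in>UNIV. A j)"
    using wt_pos[OF M r, of "order_of \<alpha>"] by (intro ennreal_leI) (simp add: field_simps)
  then show "(case z of (x, \<alpha>) \<Rightarrow> ennreal (cmod (multi_deriv \<alpha> (tensor W (\<lambda>_. 0)) x) /
      (M (order_of \<alpha>) * (\<Prod>i=1..order_of \<alpha>. r i)))) \<le> ennreal (\<Prod>j\<in>UNIV. A j)"
    by (simp add: z multi_deriv_tensor wt_def)
qed

lemma tensor_in_test_on: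
  assumes M: "weight_seq M"
    and b: "\<And>r. r \<in> roumieu_seqs \<Longrightarrow> \<exists>A. \<forall>j q t. cmod (W j q t) \<le> A j * wt M r q"
    and K: "closed K" and supp: "\<And>x. x \<notin> K \<Longrightarrow> tensor W (\<lambda>_. 0) x = 0"
  shows "tensor W (\<lambda>_. 0) \<in> test_on M \<Omega> K"
proof -
  have "useminorm M r K' (tensor W (\<lambda>_. 0)) < \<infinity>" if r: "r \<in> roumieu_seqs" for r K'
  proof -
    obtain A where "\<forall>j q t. cmod (W j q t) \<le> A j * wt M r q" using b[OF r] ..
    then have "useminorm M r K' (tensor W (\<lambda>_. 0)) \<le> ennreal (\<Prod>j\<in>UNIV. A j)"
      by (intro useminorm_tensor M r) auto
    also have "\<dots> < \<infinity>" by simp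
    finally show ?thesis .
  qed
  moreover have "closure {x. tensor W (\<lambda>_. 0) x \<noteq> 0} \<subseteq> K"
    by (rule closure_minimal[OF _ K]) (use supp in auto)
  ultimately show ?thesis
    by (auto simp: test_on_def ultradiff_def smooth_on_tensor)
qed

end

section \<open>Trigonometric series with rapidly decreasing coefficients\<close>

definition freq :: "nat \<Rightarrow> ('n::finite \<Rightarrow> int)" where
  "freq = from_nat_into UNIV"

lemma bij_freq: "bij (freq :: nat \<Rightarrow> 'n::finite \<Rightarrow> int)"
proof -
  have "inj (\<lambda>z (_ :: 'n). int z)" by (auto simp: inj_def fun_eq_iff)
  then have "infinite (range (\<lambda>z (_ :: 'n). int z))" by (rule range_inj_infinite)
  then have "infinite (UNIV :: ('n \<Rightarrow> int) set)"
    by (rule infinite_super[OF subset_UNIV])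
  then show ?thesis unfolding freq_def by (intro bij_betw_from_nat_into) auto
qed

lemma abs_summable_int_inverse_square:
  "Infinite_Set_Sum.abs_summable_on (\<lambda>k::int. 1 / (1 + (of_int k)\<^sup>2) :: real) UNIV"
proof -
  have "summable (\<lambda>n. inverse (real (Suc n) ^ 2))"
    using inverse_power_summable[of 2, where 'a = real] summable_Suc_iff[of "\<lambda>n. inverse (real n ^ 2)"] by simp
  then have "summable (\<lambda>n. 2 * inverse (real (Suc n) ^ 2))" by (rule summable_mult)
  moreover have "norm (1 / (1 + (real n)\<^sup>2)) \<le> 2 * inverse (real (Suc n) ^ 2)" for n
  proof -
    have "(real (Suc n))\<^sup>2 \<le> 2 * (1 + (real n)\<^sup>2)"
      using zero_le_power2[of "real n - 1"] by (simp add: power2_eq_square algebra_simps)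
    then show ?thesis by (simp add: field_simps add_pos_nonneg)
  qed
  ultimately have s: "summable (\<lambda>n. norm (1 / (1 + (real n)\<^sup>2)))"
    using summable_comparison_test'[of "\<lambda>n. 2 * inverse (real (Suc n) ^ 2)" 0 "\<lambda>n. norm (1 / (1 + (real n)\<^sup>2))"]
    by simp
  have "Infinite_Set_Sum.abs_summable_on (\<lambda>k::int. 1 / (1 + (of_int k)\<^sup>2) :: real) (range g)"
    if g: "inj g" "\<And>n. (of_int (g n))\<^sup>2 = (real n)\<^sup>2" for g :: "nat \<Rightarrow> int"
  proof -
    have "bij_betw g UNIV (range g)" using g(1) by (simp add: bij_betw_def)
    from abs_summable_on_reindex_bij_betw[OF this, of "\<lambda>k. 1 / (1 + (of_int k)\<^sup>2) :: real"] s
    show ?thesis by (simp add: g(2) abs_summable_on_nat_iff')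
  qed
  from this[of int] this[of "\<lambda>n. - int n"]
  have "Infinite_Set_Sum.abs_summable_on (\<lambda>k::int. 1 / (1 + (of_int k)\<^sup>2) :: real) (range int \<union> range (\<lambda>n. - int n))"
    by (intro abs_summable_on_union) (auto simp: inj_def)
  also have "range int \<union> range (\<lambda>n. - int n) = UNIV"
  proof -
    have "z \<in> range int \<union> range (\<lambda>n. - int n)" for z by (cases z rule: int_cases2) auto
    then show ?thesis by blast
  qed
  finally show ?thesis .
qed

definition lattice_weight :: "('n::finite \<Rightarrow> int) \<Rightarrow> real" where
  "lattice_weight k = (\<Prod>j\<in>UNIV. 1 / (1 + (of_int (k j))\<^sup>2))"

lemma summable_lattice_weight: "summable (\<lambda>m. lattice_weight (freq m :: 'n::finite \<Rightarrow> int))"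
proof -
  have "Infinite_Set_Sum.abs_summable_on (lattice_weight :: ('n \<Rightarrow> int) \<Rightarrow> real) (PiE UNIV (\<lambda>_. UNIV))"
    unfolding lattice_weight_def[abs_def]
    by (rule abs_summable_on_prod_PiE) (auto intro: abs_summable_int_inverse_square)
  then have "Infinite_Set_Sum.abs_summable_on (\<lambda>m. lattice_weight (freq m :: 'n \<Rightarrow> int)) UNIV"
    using abs_summable_on_reindex_bij_betw[OF bij_freq, of "lattice_weight :: ('n \<Rightarrow> int) \<Rightarrow> real"] by simp
  then have "summable (\<lambda>m. norm (lattice_weight (freq m :: 'n \<Rightarrow> int)))"
    by (simp add: abs_summable_on_nat_iff')
  then show ?thesis by (rule summable_norm_cancel)
qed

text \<open>The maximum norm is attained in one coordinate, so derivatives in that direction alone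
  produce its powers.\<close>

definition sup_norm :: "('n::finite \<Rightarrow> int) \<Rightarrow> real" where
  "sup_norm k = Max (range (\<lambda>j. \<bar>of_int (k j)\<bar>))"

abbreviation decay :: "(nat \<Rightarrow> real) \<Rightarrow> (nat \<Rightarrow> real) \<Rightarrow> ('n::finite \<Rightarrow> int) \<Rightarrow> real" where
  "decay M t k \<equiv> exp (- assoc_fun M t (sup_norm k))"

lemma sup_norm_upper: "\<bar>of_int (k j)\<bar> \<le> sup_norm k"
  unfolding sup_norm_def by (rule Max_ge) auto

lemma sup_norm_attained: "\<exists>j. sup_norm k = \<bar>of_int (k j)\<bar>"
proof -
  have "sup_norm k \<in> range (\<lambda>j. \<bar>of_int (k j)\<bar>)"
    unfolding sup_norm_def by (rule Max_in) auto
  then show ?thesis by auto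
qed

lemma sup_norm_nonneg: "0 \<le> sup_norm k"
  using sup_norm_attained[of k] by auto

text \<open>With \<rho> the norm of k and n the dimension, the product of the 1 + k_j^2 is at most
  (1 + \<rho>^2)^n, and this is at most 2^n (1 + \<rho>^{2n}) both for \<rho> \<le> 1 and for \<rho>
  > 1.\<close>

lemma lattice_weight_ge:
  "1 \<le> lattice_weight (k :: 'n::finite \<Rightarrow> int) * (2 ^ CARD('n) * (1 + sup_norm k ^ (2 * CARD('n))))"
proof -
  let ?\<rho> = "sup_norm k"
  have pos: "(\<Prod>j\<in>UNIV. 1 + (of_int (k j))\<^sup>2 :: real) > 0"
    by (intro prod_pos) (auto simp: add_pos_nonneg)
  have "(\<Prod>j\<in>UNIV. 1 + (of_int (k j))\<^sup>2 :: real) \<le> (\<Prod>j\<in>(UNIV :: 'n set). 1 + ?\<rho>\<^sup>2)"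
  proof (intro prod_mono conjI add_left_mono)
    fix j
    show "(of_int (k j))\<^sup>2 \<le> ?\<rho>\<^sup>2" using power_mono[OF sup_norm_upper[of k j], of 2] by simp
  qed (auto simp: add_nonneg_nonneg)
  also have "\<dots> = (1 + ?\<rho>\<^sup>2) ^ CARD('n)" by simp
  also have "\<dots> \<le> 2 ^ CARD('n) * (1 + ?\<rho> ^ (2 * CARD('n)))"
  proof (cases "?\<rho> \<le> 1")
    case True
    then have "?\<rho>\<^sup>2 \<le> 1" using sup_norm_nonneg[of k] by (simp add: power_le_one)
    then have "(1 + ?\<rho>\<^sup>2) ^ CARD('n) \<le> 2 ^ CARD('n)" by (intro power_mono) auto
    also have "\<dots> \<le> 2 ^ CARD('n) * (1 + ?\<rho> ^ (2 * CARD('n)))"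
      using sup_norm_nonneg[of k] by simp
    finally show ?thesis .
  next
    case False
    then have "1 \<le> ?\<rho>\<^sup>2" by (intro one_le_power) auto
    then have "(1 + ?\<rho>\<^sup>2) ^ CARD('n) \<le> (2 * ?\<rho>\<^sup>2) ^ CARD('n)" by (intro power_mono) auto
    also have "\<dots> = 2 ^ CARD('n) * ?\<rho> ^ (2 * CARD('n))" by (simp add: power_mult_distrib power_mult)
    also have "\<dots> \<le> 2 ^ CARD('n) * (1 + ?\<rho> ^ (2 * CARD('n)))" by simp
    finally show ?thesis .
  qed
  finally show ?thesis using pos by (simp add: lattice_weight_def prod_dividef field_simps)
qed

lemma lattice_weight_nonneg: "0 \<le> lattice_weight k"
  unfolding lattice_weight_def by (intro prod_nonneg) (auto simp: add_nonneg_nonneg)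

text \<open>exp N_t dominates the power \<rho>^{2n}, so \<open>decay\<close> is bounded by a
  multiple of the summable \<open>lattice_weight\<close>. Z is chosen before the family a, and the
  bound is uniform in it.\<close>

lemma lattice_sum_bound:
  assumes M: "weight_seq M" and t: "t \<in> roumieu_seqs"
  shows "\<exists>Z>0. \<forall>a B. (\<forall>k::'n::finite \<Rightarrow> int. 0 \<le> a k \<and> a k \<le> B * decay M t k) \<longrightarrow>
    summable (\<lambda>m. a (freq m)) \<and> (\<Sum>m. a (freq m)) \<le> Z * B"
proof -
  let ?c = "2 ^ CARD('n) * (1 + wt M t (2 * CARD('n)))"
  let ?w = "\<lambda>m. lattice_weight (freq m :: 'n \<Rightarrow> int)"
  have c: "?c > 0" using wt_pos[OF M t, of "2 * CARD('n)"] by simp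
  have ge: "decay M t k \<le> ?c * lattice_weight k" for k :: "'n \<Rightarrow> int"
  proof -
    let ?E = "exp (assoc_fun M t (sup_norm k))"
    have E: "?E \<ge> 1" using assoc_fun_nonneg[OF M t sup_norm_nonneg[of k]] by simp
    have "1 \<le> lattice_weight k * (2 ^ CARD('n) * (1 + sup_norm k ^ (2 * CARD('n))))"
      by (rule lattice_weight_ge)
    also have "\<dots> \<le> lattice_weight k * (2 ^ CARD('n) * (?E + wt M t (2 * CARD('n)) * ?E))"
      using E power_le_assoc_fun[OF M t sup_norm_nonneg[of k], of "2 * CARD('n)"]
      by (intro mult_left_mono add_mono lattice_weight_nonneg) auto
    also have "\<dots> = (?c * lattice_weight k) * ?E" by (simp add: algebra_simps)
    finally show ?thesis by (simp add: exp_minus field_simps)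
  qed
  have "summable (\<lambda>m. a (freq m)) \<and> (\<Sum>m. a (freq m)) \<le> (?c * (suminf ?w + 1)) * B"
    if a: "\<forall>k::'n \<Rightarrow> int. 0 \<le> a k \<and> a k \<le> B * decay M t k" for a B
  proof -
    have "0 \<le> B * exp (- assoc_fun M t (sup_norm (\<lambda>_::'n. 0)))" using order_trans[OF conjunct1[OF a[rule_format]] conjunct2[OF a[rule_format]]] .
    then have B: "B \<ge> 0" by (simp add: zero_le_mult_iff)
    have le: "a (freq m) \<le> (B * ?c) * ?w m" for m
      using a[rule_format, of "freq m"] mult_left_mono[OF ge[of "freq m"] B] by (simp add: mult_ac)
    have sw: "summable (\<lambda>m. (B * ?c) * ?w m)"
      by (intro summable_mult summable_lattice_weight)
    have s: "summable (\<lambda>m. a (freq m))"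
      by (rule summable_comparison_test[OF _ sw]) (use a le in auto)
    have "(\<Sum>m. a (freq m)) \<le> (\<Sum>m. (B * ?c) * ?w m)"
      by (intro suminf_le le s sw)
    also have "\<dots> = (B * ?c) * suminf ?w" by (intro suminf_mult summable_lattice_weight)
    also have "\<dots> \<le> (B * ?c) * (suminf ?w + 1)" using B c by (intro mult_left_mono) auto
    finally show ?thesis using s by (simp add: mult_ac)
  qed
  note main = this
  have "suminf ?w \<ge> 0" by (intro suminf_nonneg summable_lattice_weight lattice_weight_nonneg)
  then have "?c * (suminf ?w + 1) > 0" by (intro mult_pos_pos[OF c]) simp
  moreover have "\<forall>a B. (\<forall>k::'n \<Rightarrow> int. 0 \<le> a k \<and> a k \<le> B * decay M t k) \<longrightarrow>
      summable (\<lambda>m. a (freq m)) \<and> (\<Sum>m. a (freq m)) \<le> (?c * (suminf ?w + 1)) * B"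
    by (intro allI impI) (rule main)
  ultimately show ?thesis by (intro exI[of _ "?c * (suminf ?w + 1)"] conjI)
qed

section \<open>Characters and termwise differentiation\<close>

definition phase :: "('n::finite \<Rightarrow> int) \<Rightarrow> real^'n \<Rightarrow> real" where
  "phase k x = (\<Sum>j\<in>UNIV. of_int (k j) * x $ j)"

definition fchar :: "('n::finite \<Rightarrow> int) \<Rightarrow> real^'n \<Rightarrow> complex" where
  "fchar k x = cis (phase k x)"

definition trig_series :: "(('n::finite \<Rightarrow> int) \<Rightarrow> complex) \<Rightarrow> real^'n \<Rightarrow> complex" where
  "trig_series c x = (\<Sum>m. c (freq m) * fchar (freq m) x)"

text \<open>Decay with respect to every t is the Fourier-side form of the Roumieu condition, which
  bounds the seminorms for every r.\<close>

definition decaying :: "(nat \<Rightarrow> real) \<Rightarrow> (('n::finite \<Rightarrow> int) \<Rightarrow> complex) \<Rightarrow> bool" where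
  "decaying M c \<longleftrightarrow> (\<forall>t\<in>roumieu_seqs. \<exists>B. \<forall>k. cmod (c k) \<le> B * decay M t k)"

lemma norm_fchar [simp]: "cmod (fchar k x) = 1"
  by (simp add: fchar_def)

lemma fchar_add: "fchar (\<lambda>j. k j + l j) x = fchar k x * fchar l x"
  by (simp add: fchar_def phase_def cis_mult sum.distrib algebra_simps)

lemma fchar_has_derivative:
  "(fchar k has_derivative (\<lambda>h. (\<i> * of_real (phase k h)) * fchar k x)) (at x)"
proof -
  have "(phase k has_derivative phase k) (at x)"
    unfolding phase_def[abs_def]
    by (intro bounded_linear_imp_has_derivative bounded_linear_sum bounded_linear_const_mult bounded_linear_vec_nth)
  from has_derivative_cis[OF this] show ?thesis
    unfolding fchar_def[abs_def] by (simp add: scaleR_conv_of_real mult_ac)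
qed

lemma roumieu_seqs_real: "real \<in> roumieu_seqs"
  by (simp add: roumieu_seqs_def filterlim_real_sequentially)

text \<open>Of the decay exp(- 2 N_t) supplied by \<open>assoc_fun_double\<close>, one half pays for
  \<rho>^p \<le> w_p exp N_t and the other half remains for summation.\<close>

lemma decaying_power_bound:
  assumes M: "weight_seq M" and c: "decaying M c" and t: "t \<in> roumieu_seqs"
  shows "\<exists>B. \<forall>p k. cmod (c k) * sup_norm k ^ p \<le> (B * wt M t p) * decay M t k"
proof -
  obtain h d where h: "h \<in> roumieu_seqs" and hd: "\<forall>\<rho>\<ge>0. 2 * assoc_fun M t \<rho> \<le> assoc_fun M h \<rho> + d"
    using assoc_fun_double[OF M t] by blast
  obtain B where B: "\<And>k. cmod (c k) \<le> B * decay M h k"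
    using c h unfolding decaying_def by blast
  have "cmod (c k) * sup_norm k ^ p \<le> ((B * exp d) * wt M t p) * decay M t k" for p k
  proof -
    let ?N = "assoc_fun M t (sup_norm k)"
    have "0 \<le> B * decay M h k" using order_trans[OF norm_ge_zero B[of k]] .
    then have B0: "B \<ge> 0" by (simp add: zero_le_mult_iff)
    have "cmod (c k) \<le> B * exp (d + (- 2 * ?N))"
      using hd[rule_format, OF sup_norm_nonneg[of k]]
      by (intro order_trans[OF B[of k]] mult_left_mono B0) simp
    then have "cmod (c k) * sup_norm k ^ p \<le> (B * exp (d + (- 2 * ?N))) * (wt M t p * exp ?N)"
      by (intro mult_mono power_le_assoc_fun[OF M t] sup_norm_nonneg mult_nonneg_nonneg B0 zero_le_power) auto
    also have "\<dots> = ((B * exp d) * wt M t p) * (exp (- 2 * ?N) * exp ?N)" unfolding exp_add by simp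
    also have "exp (- 2 * ?N) * exp ?N = exp (- ?N)" by (simp flip: exp_add)
    finally show ?thesis .
  qed
  then show ?thesis by (intro exI[of _ "B * exp d"] allI)
qed

lemma decaying_mult:
  assumes M: "weight_seq M" and c: "decaying M c"
    and le: "\<And>k. cmod (d k) \<le> cmod (c k) * sup_norm k ^ p"
  shows "decaying M d"
  unfolding decaying_def
proof
  fix t assume t: "t \<in> roumieu_seqs"
  obtain B where "\<And>p k. cmod (c k) * sup_norm k ^ p \<le> (B * wt M t p) * decay M t k"
    using decaying_power_bound[OF M c t] by blast
  then show "\<exists>B. \<forall>k. cmod (d k) \<le> B * decay M t k"
    using order_trans[OF le] by (intro exI[of _ "B * wt M t p"]) auto
qed

text \<open>B is independent of p; this is what the seminorm estimate of the series demands of its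
  derivatives of order p.\<close>

lemma decaying_sum_bound:
  fixes c :: "('n::finite \<Rightarrow> int) \<Rightarrow> complex"
  assumes M: "weight_seq M" and c: "decaying M c" and t: "t \<in> roumieu_seqs"
  shows "\<exists>B. \<forall>p. summable (\<lambda>m. cmod (c (freq m)) * sup_norm (freq m :: 'n \<Rightarrow> int) ^ p) \<and>
    (\<Sum>m. cmod (c (freq m)) * sup_norm (freq m :: 'n \<Rightarrow> int) ^ p) \<le> B * wt M t p"
proof -
  obtain B where B: "\<And>p k. cmod (c k) * sup_norm k ^ p \<le> (B * wt M t p) * decay M t k"
    using decaying_power_bound[OF M c t] by blast
  obtain Z where Z: "\<forall>a B. (\<forall>k::'n \<Rightarrow> int. 0 \<le> a k \<and> a k \<le> B * decay M t k) \<longrightarrow>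
    summable (\<lambda>m. a (freq m)) \<and> (\<Sum>m. a (freq m)) \<le> Z * B"
    using lattice_sum_bound[OF M t, where 'n = 'n] by blast
  have "summable (\<lambda>m. cmod (c (freq m)) * sup_norm (freq m :: 'n \<Rightarrow> int) ^ p) \<and>
    (\<Sum>m. cmod (c (freq m)) * sup_norm (freq m :: 'n \<Rightarrow> int) ^ p) \<le> Z * (B * wt M t p)" for p
    by (rule Z[rule_format, of "\<lambda>k. cmod (c k) * sup_norm k ^ p"]) (use B[of _ p] in \<open>simp add: sup_norm_nonneg\<close>)
  then show ?thesis by (intro exI[of _ "Z * B"]) (simp add: mult.assoc)
qed

context
  fixes M :: "nat \<Rightarrow> real" and c :: "('n::finite \<Rightarrow> int) \<Rightarrow> complex"
  assumes M: "weight_seq M" and c: "decaying M c"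
begin

lemma decaying_summable: "summable (\<lambda>m. cmod (c (freq m)) * sup_norm (freq m :: 'n \<Rightarrow> int) ^ p)"
  using decaying_sum_bound[OF M c roumieu_seqs_real] by blast

lemma trig_series_sums: "(\<lambda>m. c (freq m) * fchar (freq m) x) sums trig_series c x"
proof -
  have "summable (\<lambda>m. norm (c (freq m) * fchar (freq m) x))"
    using decaying_summable[of 0] by (simp add: norm_mult)
  then show ?thesis unfolding trig_series_def by (rule summable_sums[OF summable_norm_cancel])
qed

lemma norm_frequency_le:
  "\<bar>phase k h\<bar> \<le> real CARD('n) * sup_norm (k :: 'n \<Rightarrow> int) * norm h"
proof -
  have "\<bar>phase k h\<bar> \<le> (\<Sum>j\<in>(UNIV::'n set). sup_norm k * norm h)"
    unfolding phase_def by (intro order_trans[OF sum_abs] sum_mono)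
      (auto simp: abs_mult intro!: mult_mono sup_norm_upper component_le_norm_cart sup_norm_nonneg)
  then show ?thesis by simp
qed

lemma trig_series_has_derivative:
  "(trig_series c has_derivative
     (\<lambda>h. \<Sum>m. c (freq m) * ((\<i> * of_real (phase (freq m) h)) * fchar (freq m) x))) (at x)"
proof -
  define f' where "f' m x h = c (freq m) * ((\<i> * of_real (phase (freq m) h)) * fchar (freq m) x)"
    for m and x h :: "real^'n"
  \<comment> \<open>Majorant of the differentiated series, uniform in x and linear in h, as termwise
    differentiation requires.\<close>
  define s where "s m = real CARD('n) * (cmod (c (freq m)) * sup_norm (freq m :: 'n \<Rightarrow> int))" for m
  have s: "summable s" unfolding s_def using decaying_summable[of 1] by (intro summable_mult) simp
  have le: "norm (f' m x h) \<le> s m * norm h" for m x h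
    using mult_left_mono[OF norm_frequency_le[of "freq m" h], of "cmod (c (freq m))"]
    by (simp add: f'_def s_def norm_mult mult_ac)
  have sh: "summable (\<lambda>m. s m * norm h)" for h :: "real^'n" using s by (rule summable_mult2)
  have sf: "summable (\<lambda>m. norm (f' m x h))" for x h
    using summable_comparison_test'[OF sh[of h], of 0 "\<lambda>m. norm (f' m x h)"] le by simp
  have "\<exists>g. \<forall>x\<in>UNIV. (\<lambda>m. c (freq m) * fchar (freq m) x) sums g x \<and> (g has_derivative (\<lambda>h. \<Sum>m. f' m x h)) (at x within UNIV)"
  proof (rule has_derivative_series)
    show "((\<lambda>x. c (freq m) * fchar (freq m) x) has_derivative f' m x) (at x within UNIV)" for m x
      unfolding f'_def by (intro has_derivative_mult_right fchar_has_derivative)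
    show "(\<lambda>m. c (freq m) * fchar (freq m) (0 :: real^'n)) sums trig_series c 0" by (rule trig_series_sums)
    fix e :: real assume "e > 0"
    then obtain N where N: "\<And>n. n \<ge> N \<Longrightarrow> norm (\<Sum>i. s (i + n)) < e"
      using suminf_exist_split[OF _ s] by blast
    have "norm (sum (\<lambda>i. f' i x h) {..<n} - (\<Sum>m. f' m x h)) \<le> e * norm h" if "n \<ge> N" for n x h
    proof -
      have sfn: "summable (\<lambda>m. norm (f' (m + n) x h))"
        using summable_ignore_initial_segment[OF sf] .
      have "(\<Sum>m. f' m x h) = (\<Sum>m. f' (m + n) x h) + sum (\<lambda>i. f' i x h) {..<n}"
        by (rule suminf_split_initial_segment) (rule summable_norm_cancel[OF sf])
      then have "norm (sum (\<lambda>i. f' i x h) {..<n} - (\<Sum>m. f' m x h)) = norm (\<Sum>m. f' (m + n) x h)"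
        by (simp add: norm_minus_commute)
      also have "\<dots> \<le> (\<Sum>m. norm (f' (m + n) x h))"
        by (rule summable_norm[OF sfn])
      also have "\<dots> \<le> (\<Sum>m. s (m + n) * norm h)"
        by (rule suminf_le[OF le sfn]) (rule summable_mult2[OF summable_ignore_initial_segment[OF s]])
      also have "\<dots> = (\<Sum>m. s (m + n)) * norm h"
        by (rule suminf_mult2[symmetric]) (rule summable_ignore_initial_segment[OF s])
      also have "\<dots> \<le> e * norm h" using N[OF that] by (intro mult_right_mono) auto
      finally show ?thesis .
    qed
    then show "\<forall>\<^sub>F n in sequentially. \<forall>x\<in>UNIV. \<forall>h. norm (sum (\<lambda>i. f' i x h) {..<n} - (\<Sum>m. f' m x h)) \<le> e * norm h"
      unfolding eventually_sequentially by blast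
  qed auto
  then obtain g where g: "\<And>x. (\<lambda>m. c (freq m) * fchar (freq m) x) sums g x"
      "(g has_derivative (\<lambda>h. \<Sum>m. f' m x h)) (at x)"
    by auto
  have "g = trig_series c" using sums_unique2[OF g(1) trig_series_sums] by auto
  with g(2) show ?thesis by (simp add: f'_def)
qed

lemma partial_trig_series: "partial j (trig_series c) = trig_series (\<lambda>k. (\<i> * of_int (k j)) * c k)"
proof
  fix x :: "real^'n"
  have "((\<lambda>t. x + t *\<^sub>R axis j 1) has_vector_derivative axis j 1) (at 0)"
    by (auto intro!: derivative_eq_intros)
  from vector_derivative_diff_chain_within[OF this, of "trig_series c", OF has_derivative_at_withinI]
  have "((\<lambda>t. trig_series c (x + t *\<^sub>R axis j 1)) has_vector_derivative
     (\<Sum>m. c (freq m) * ((\<i> * of_real (phase (freq m) (axis j 1))) * fchar (freq m) x))) (at 0)"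
    using trig_series_has_derivative[of x] by (simp add: o_def)
  moreover have "phase k (axis j 1) = of_int (k j)" for k :: "'n \<Rightarrow> int"
    by (simp add: phase_def axis_def if_distrib[of "\<lambda>x. _ * x"] cong: if_cong)
  ultimately show "partial j (trig_series c) x = trig_series (\<lambda>k. (\<i> * of_int (k j)) * c k) x"
    unfolding trig_series_def by (intro partialI) (simp add: mult_ac)
qed

lemma trig_series_continuous: "continuous_on UNIV (trig_series c)"
  using has_derivative_continuous[OF trig_series_has_derivative] by (simp add: continuous_at_imp_continuous_on)

end

lemma norm_prod_list_frequency_le:
  "cmod (prod_list (map (\<lambda>j. \<i> * of_int (k j)) js)) \<le> sup_norm k ^ length js"
proof (induction js)
  case (Cons j js)
  have "\<bar>of_int (k j)\<bar> * cmod (prod_list (map (\<lambda>j. \<i> * of_int (k j)) js)) \<le> sup_norm k * sup_norm k ^ length js"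
    by (intro mult_mono Cons sup_norm_upper sup_norm_nonneg) simp
  then show ?case by (simp add: norm_mult)
qed simp

text \<open>Differentiation multiplies the coefficients by monomials in the frequency.
  \<open>decaying\<close> is stable under this, so the induction stays within trigonometric
  series.\<close>

lemma foldr_partial_trig_series:
  assumes M: "weight_seq M" and c: "decaying M c"
  shows "foldr partial js (trig_series c) = trig_series (\<lambda>k. prod_list (map (\<lambda>j. \<i> * of_int (k j)) js) * c k)"
    and "decaying M (\<lambda>k. prod_list (map (\<lambda>j. \<i> * of_int (k j)) js) * c k)"
proof -
  show dec: "decaying M (\<lambda>k. prod_list (map (\<lambda>j. \<i> * of_int (k j)) js) * c k)" for js
    by (rule decaying_mult[OF M c, of _ "length js"])
      (simp add: norm_mult mult.commute mult_left_mono norm_prod_list_frequency_le)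
  show "foldr partial js (trig_series c) = trig_series (\<lambda>k. prod_list (map (\<lambda>j. \<i> * of_int (k j)) js) * c k)"
  proof (induction js)
    case (Cons j js)
    then show ?case using partial_trig_series[OF M dec, of j js] by (simp add: mult.assoc)
  qed simp
qed

lemma foldr_partial_trig_series_differentiable:
  assumes M: "weight_seq M" and c: "decaying M c"
  shows "foldr partial js (trig_series c) differentiable (at x)"
  unfolding foldr_partial_trig_series(1)[OF M c] differentiable_def
  using trig_series_has_derivative[OF M foldr_partial_trig_series(2)[OF M c]] by blast

lemma foldr_partial_trig_series_bound:
  fixes c :: "('n::finite \<Rightarrow> int) \<Rightarrow> complex"
  assumes M: "weight_seq M" and c: "decaying M c" and t: "t \<in> roumieu_seqs"
  shows "\<exists>B. \<forall>js x. cmod (foldr partial js (trig_series c) x) \<le> B * wt M t (length js)"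
proof -
  obtain B where B: "\<forall>p. summable (\<lambda>m. cmod (c (freq m)) * sup_norm (freq m :: 'n \<Rightarrow> int) ^ p) \<and>
    (\<Sum>m. cmod (c (freq m)) * sup_norm (freq m :: 'n \<Rightarrow> int) ^ p) \<le> B * wt M t p"
    using decaying_sum_bound[OF M c t] by blast
  have "cmod (foldr partial js (trig_series c) x) \<le> B * wt M t (length js)" for js x
  proof -
    let ?P = "\<lambda>k. prod_list (map (\<lambda>j. \<i> * of_int (k j)) js)"
    let ?s = "\<lambda>m. cmod (c (freq m)) * sup_norm (freq m :: 'n \<Rightarrow> int) ^ length js"
    have le': "norm (?P (freq m) * c (freq m) * fchar (freq m) x) \<le> ?s m" for m
      using mult_right_mono[OF norm_prod_list_frequency_le[of "freq m" js] norm_ge_zero[of "c (freq m)"]]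
      by (simp add: norm_mult mult.commute)
    have s: "summable ?s" using B by blast
    have sn: "summable (\<lambda>m. norm (?P (freq m) * c (freq m) * fchar (freq m) x))"
      using summable_comparison_test'[OF s, of 0 "\<lambda>m. norm (?P (freq m) * c (freq m) * fchar (freq m) x)"] le'
      by simp
    have "cmod (foldr partial js (trig_series c) x) \<le> (\<Sum>m. norm (?P (freq m) * c (freq m) * fchar (freq m) x))"
      unfolding foldr_partial_trig_series(1)[OF M c] trig_series_def by (rule summable_norm[OF sn])
    also have "\<dots> \<le> suminf ?s" by (rule suminf_le[OF le' sn s])
    also have "\<dots> \<le> B * wt M t (length js)" using B by blast
    finally show ?thesis .
  qed
  then show ?thesis by blast
qed

section \<open>Fourier inversion on a cube\<close>

definition cube :: "real^'n \<Rightarrow> real \<Rightarrow> (real^'n::finite) set" where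
  "cube a d = cbox (a - (\<chi> j. d)) (a + (\<chi> j. d))"

lemma mem_cube: "x \<in> cube a d \<longleftrightarrow> (\<forall>j. \<bar>x $ j - a $ j\<bar> \<le> d)"
  unfolding cube_def mem_box_cart by (simp add: abs_le_iff) (metis add.commute diff_le_eq le_diff_eq minus_diff_eq neg_le_iff_le)

lemma integral_cis_period:
  assumes "n \<noteq> 0" shows "integral {c - pi..c + pi} (\<lambda>t. cis (of_int n * t)) = 0"
proof -
  have "((\<lambda>t. cis (of_int n * t)) has_integral
      (cis (of_int n * (c + pi)) / (\<i> * of_int n) - cis (of_int n * (c - pi)) / (\<i> * of_int n))) {c - pi..c + pi}"
    using assms
    by (intro fundamental_theorem_of_calculus)
      (auto simp: has_vector_derivative_def scaleR_conv_of_real fun_eq_iff complex_eq_iff intro!: derivative_eq_intros)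
  moreover have "cis (of_int n * (c + pi)) = cis (of_int n * (c - pi)) * cis (2 * pi * of_int n)"
    by (simp add: cis_mult algebra_simps)
  then have "cis (of_int n * (c + pi)) = cis (of_int n * (c - pi))"
    using cis_multiple_2pi[of "of_int n"] by simp
  ultimately show ?thesis by (simp add: integral_unique)
qed

lemma fchar_continuous: "continuous_on S (fchar k)"
  by (rule continuous_at_imp_continuous_on) (auto intro: has_derivative_continuous[OF fchar_has_derivative])

lemma fchar_0 [simp]: "fchar (\<lambda>_. 0) x = 1"
  by (simp add: fchar_def phase_def)

text \<open>Cube and character are both products over the coordinates, so by Fubini the integral
  factors, and the factor in direction j integrates a nontrivial oscillation over full
  periods.\<close>

lemma integral_fchar_nonzero:
  fixes k :: "'n::finite \<Rightarrow> int"
  assumes "k j \<noteq> 0" shows "integral (cube a pi) (fchar k) = 0"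
proof -
  interpret product_sigma_finite "\<lambda>_. lborel :: real measure" ..
  define K :: "real^'n" where "K = (\<chi> j. of_int (k j))"
  \<comment> \<open>The indicator of the cube is distributed over the factors, so that all integrals
    extend over whole lines.\<close>
  define f where "f b t = indicator {a \<bullet> b - pi..a \<bullet> b + pi} t *\<^sub>R cis ((K \<bullet> b) * t)" for b :: "real^'n" and t
  have f_int: "integrable lborel (f b)" for b
    unfolding f_def by (intro borel_integrable_compact continuous_intros) auto
  have phase: "phase k x = (\<Sum>b\<in>Basis. (K \<bullet> b) * (x \<bullet> b))" for x
    unfolding euclidean_inner[symmetric] by (simp add: phase_def K_def inner_vec_def)
  have one: "(\<chi> j. pi) \<bullet> b = pi" if "b \<in> Basis" for b :: "real^'n"
    using that by (auto simp: Basis_vec_def inner_axis)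
  have eq: "indicator (cube a pi) x *\<^sub>R fchar k x = (\<Prod>b\<in>Basis. f b (x \<bullet> b))" for x
  proof -
    have "indicator (cube a pi) x = (\<Prod>b\<in>Basis. indicator {a \<bullet> b - pi..a \<bullet> b + pi} (x \<bullet> b) :: real)"
      by (auto simp: indicator_def cube_def mem_box inner_diff_left inner_add_left one prod_zero_iff)
    moreover have "cis (\<Sum>b\<in>Basis. (K \<bullet> b) * (x \<bullet> b)) = (\<Prod>b\<in>Basis. cis ((K \<bullet> b) * (x \<bullet> b)))"
      by (simp add: cis_conv_exp exp_sum sum_distrib_left)
    ultimately show ?thesis
      by (simp add: fchar_def phase f_def scaleR_conv_of_real prod.distrib)
  qed
  have "integral (cube a pi) (fchar k) = (LINT x:cube a pi|lborel. fchar k x)"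
    by (rule set_borel_integral_eq_integral(2)[symmetric])
      (auto simp: set_integrable_def cube_def intro!: borel_integrable_compact fchar_continuous)
  also have "\<dots> = (LINT x|lborel. (\<Prod>b\<in>Basis. f b (x \<bullet> b)))"
    unfolding set_lebesgue_integral_def eq ..
  also have "\<dots> = (LINT g|(\<Pi>\<^sub>M b\<in>Basis. lborel). (\<Prod>b\<in>Basis. f b ((\<Sum>b\<in>Basis. g b *\<^sub>R b) \<bullet> b)))"
    by (subst lborel_eq, subst integral_distr)
      (auto intro!: borel_measurable_prod measurable_compose[OF _ borel_measurable_integrable[OF f_int]])
  also have "\<dots> = (LINT g|(\<Pi>\<^sub>M b\<in>Basis. lborel). (\<Prod>b\<in>Basis. f b (g b)))"
    by (intro Bochner_Integration.integral_cong refl prod.cong) simp_all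
  also have "\<dots> = (\<Prod>b\<in>Basis. integral\<^sup>L lborel (f b))"
    by (rule product_integral_prod) (auto intro: f_int)
  also have "\<dots> = 0"
  proof (rule prod_zero)
    have "K \<bullet> axis j 1 = of_int (k j)" by (simp add: K_def inner_axis)
    then have "integral\<^sup>L lborel (f (axis j 1)) = (LINT t:{a $ j - pi..a $ j + pi}|lborel. cis (of_int (k j) * t))"
      by (simp add: f_def[abs_def] set_lebesgue_integral_def inner_axis)
    also have "\<dots> = integral {a $ j - pi..a $ j + pi} (\<lambda>t. cis (of_int (k j) * t))"
      by (rule set_borel_integral_eq_integral(2))
        (auto simp: set_integrable_def intro!: borel_integrable_compact continuous_intros)
    also have "\<dots> = 0" by (rule integral_cis_period[OF assms])
    finally show "\<exists>b\<in>Basis. integral\<^sup>L lborel (f b) = 0"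
      by (intro bexI[of _ "axis j 1"]) (auto simp: axis_in_Basis_iff)
  qed simp
  finally show ?thesis .
qed

lemma integral_fchar:
  "integral (cube a pi) (fchar k) = (if k = (\<lambda>_. 0) then of_real ((2 * pi) ^ CARD('n)) else 0)"
  for k :: "'n::finite \<Rightarrow> int"
proof (cases "k = (\<lambda>_. 0)")
  case True
  have "measure lborel (cube a pi) = (2 * pi) ^ CARD('n)"
    unfolding cube_def by (subst content_cbox_cart) (auto simp: interval_ne_empty_cart)
  moreover have "fchar (\<lambda>_::'n. 0) = (\<lambda>_. 1)" by (rule ext) simp
  ultimately show ?thesis using True by (simp add: cube_def scaleR_conv_of_real)
next
  case False
  then obtain j where "k j \<noteq> 0" by auto
  then show ?thesis using integral_fchar_nonzero False by simp
qed

lemma tendsto_integral_uniform_limit: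
  fixes f :: "nat \<Rightarrow> 'b::euclidean_space \<Rightarrow> 'c::banach"
  assumes "uniform_limit (cbox a b) f g sequentially" "\<And>n. continuous_on (cbox a b) (f n)"
  shows "(\<lambda>n. integral (cbox a b) (f n)) \<longlonglongrightarrow> integral (cbox a b) g"
proof (rule uniform_limit_integral_cbox[OF assms sequentially_bot])
  fix I J
  assume I: "\<And>n. (f n has_integral I n) (cbox a b)" and J: "(g has_integral J) (cbox a b)" and lim: "I \<longlonglongrightarrow> J"
  have "integral (cbox a b) (f n) = I n" for n using I by (rule integral_unique)
  with lim integral_unique[OF J] show ?thesis by simp
qed

text \<open>Uniform convergence permits termwise integration, and by orthogonality only the
  frequency l survives.\<close>

lemma integral_trig_series:
  fixes c :: "('n::finite \<Rightarrow> int) \<Rightarrow> complex"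
  assumes M: "weight_seq M" and c: "decaying M c"
  shows "((\<lambda>x. trig_series c x * fchar (\<lambda>j. - l j) x) has_integral c l * of_real ((2 * pi) ^ CARD('n))) (cube a pi)"
proof -
  let ?f = "\<lambda>n x. \<Sum>i<n. (c (freq i) * fchar (freq i) x) * fchar (\<lambda>j. - l j) x"
  have cont: "continuous_on S (?f n)" for S n
    by (intro continuous_intros fchar_continuous)
  have "uniform_limit (cube a pi) ?f (\<lambda>x. \<Sum>i. (c (freq i) * fchar (freq i) x) * fchar (\<lambda>j. - l j) x) sequentially"
    using decaying_summable[OF M c, of 0] by (intro Weierstrass_m_test) (auto simp: norm_mult)
  moreover have "(\<Sum>i. (c (freq i) * fchar (freq i) x) * fchar (\<lambda>j. - l j) x) = trig_series c x * fchar (\<lambda>j. - l j) x" for x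
    by (rule sums_unique[symmetric]) (intro sums_mult2 trig_series_sums[OF M c])
  ultimately have ul: "uniform_limit (cube a pi) ?f (\<lambda>x. trig_series c x * fchar (\<lambda>j. - l j) x) sequentially"
    by simp
  then have lim: "(\<lambda>n. integral (cube a pi) (?f n)) \<longlonglongrightarrow> integral (cube a pi) (\<lambda>x. trig_series c x * fchar (\<lambda>j. - l j) x)"
    unfolding cube_def by (rule tendsto_integral_uniform_limit) (rule cont)
  obtain i0 where i0: "freq i0 = l" using bij_is_surj[OF bij_freq[where 'n = 'n]] by (metis surjD)
  have inj: "freq i = l \<longleftrightarrow> i = i0" for i
    using i0 bij_is_inj[OF bij_freq[where 'n = 'n]] by (auto dest: injD)
  have summand: "((\<lambda>x. (c (freq i) * fchar (freq i) x) * fchar (\<lambda>j. - l j) x) has_integral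
      (if i = i0 then c l * of_real ((2 * pi) ^ CARD('n)) else 0)) (cube a pi)" for i
  proof -
    let ?k = "\<lambda>j. freq i j + - l j"
    have "(fchar ?k has_integral integral (cube a pi) (fchar ?k)) (cube a pi)"
      unfolding cube_def by (intro integrable_integral integrable_continuous fchar_continuous)
    from has_integral_mult_right[OF this, of "c (freq i)"]
    have "((\<lambda>x. c (freq i) * fchar ?k x) has_integral c (freq i) * integral (cube a pi) (fchar ?k)) (cube a pi)" .
    moreover have "?k = (\<lambda>_. 0) \<longleftrightarrow> i = i0"
      unfolding inj[symmetric] by (auto simp: fun_eq_iff)
    ultimately show ?thesis
      unfolding integral_fchar fchar_add by (auto simp: i0 mult.assoc split: if_splits)
  qed
  have "(?f n has_integral (\<Sum>i<n. if i = i0 then c l * of_real ((2 * pi) ^ CARD('n)) else 0)) (cube a pi)" for n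
    by (intro has_integral_sum summand) simp
  then have "integral (cube a pi) (?f n) = (\<Sum>i<n. if i = i0 then c l * of_real ((2 * pi) ^ CARD('n)) else 0)" for n
    by (rule integral_unique)
  then have "integral (cube a pi) (?f n) = c l * of_real ((2 * pi) ^ CARD('n))" if "n \<ge> Suc i0" for n
    using that by (simp add: sum.delta)
  then have "(\<lambda>n. integral (cube a pi) (?f n)) \<longlonglongrightarrow> c l * of_real ((2 * pi) ^ CARD('n))"
    by (rule tendsto_eventually[OF eventually_sequentiallyI])
  then have "integral (cube a pi) (\<lambda>x. trig_series c x * fchar (\<lambda>j. - l j) x) = c l * of_real ((2 * pi) ^ CARD('n))"
    by (rule LIMSEQ_unique[OF lim])
  moreover have "(\<lambda>x. trig_series c x * fchar (\<lambda>j. - l j) x) integrable_on cube a pi"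
    unfolding cube_def
    by (intro integrable_continuous continuous_intros fchar_continuous continuous_on_subset[OF trig_series_continuous[OF M c]]) simp
  ultimately show ?thesis by (simp add: has_integral_iff)
qed

section \<open>Trigonometric polynomials and uniqueness of Fourier coefficients\<close>

inductive trig_poly :: "(real^'n::finite \<Rightarrow> complex) \<Rightarrow> bool" where
  monomial: "trig_poly (\<lambda>x. c * fchar k x)"
| add: "trig_poly f \<Longrightarrow> trig_poly g \<Longrightarrow> trig_poly (\<lambda>x. f x + g x)"

lemma trig_poly_monomial_mult: "trig_poly f \<Longrightarrow> trig_poly (\<lambda>x. (c * fchar k x) * f x)"
proof (induction rule: trig_poly.induct)
  case (monomial d l)
  have "(\<lambda>x. (c * fchar k x) * (d * fchar l x)) = (\<lambda>x. (c * d) * fchar (\<lambda>j. k j + l j) x)"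
    by (simp add: fchar_add mult_ac)
  then show ?case by (simp only: trig_poly.monomial)
next
  case (add f g)
  then show ?case using trig_poly.add[OF add.IH] by (simp add: distrib_left)
qed

lemma trig_poly_mult: "trig_poly f \<Longrightarrow> trig_poly g \<Longrightarrow> trig_poly (\<lambda>x. f x * g x)"
proof (induction rule: trig_poly.induct)
  case (monomial c k)
  then show ?case by (rule trig_poly_monomial_mult)
next
  case (add f h)
  then show ?case using trig_poly.add[OF add.IH] by (simp add: distrib_right)
qed

lemma trig_poly_const: "trig_poly (\<lambda>_. c)"
  using trig_poly.monomial[of c "\<lambda>_. 0"] by simp

lemma trig_poly_cmult: "trig_poly f \<Longrightarrow> trig_poly (\<lambda>x. c * f x)"
  by (rule trig_poly_mult[OF trig_poly_const])

lemma trig_poly_sum: "finite A \<Longrightarrow> (\<And>a. a \<in> A \<Longrightarrow> trig_poly (f a)) \<Longrightarrow> trig_poly (\<lambda>x. \<Sum>a\<in>A. f a x)"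
  by (induction A rule: finite_induct) (simp_all add: trig_poly_const trig_poly.add)

definition torus_map :: "real^'n \<Rightarrow> complex^'n" where
  "torus_map x = (\<chi> j. cis (x $ j))"

lemma trig_poly_cis: "trig_poly (\<lambda>x. cis (s * x $ j))" if "s = 1 \<or> s = - 1"
proof -
  define k where "k i = (if i = j then if s = 1 then 1 else - 1 else 0 :: int)" for i
  have "phase k x = s * x $ j" for x
    using that by (auto simp: phase_def k_def if_distrib[of "\<lambda>a. a * _"] if_distrib[of real_of_int] cong: if_cong)
  then have "(\<lambda>x. cis (s * x $ j)) = (\<lambda>x. 1 * fchar k x)" by (simp add: fchar_def)
  then show ?thesis by (simp only: trig_poly.monomial)
qed

text \<open>The real coordinates on the torus are cosines and sines of the x_j, which Euler's
  formulas express through cis (x_j) and cis (- x_j).\<close>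

lemma trig_poly_torus_coordinate:
  assumes "b \<in> Basis" shows "trig_poly (\<lambda>x::real^'n::finite. of_real (torus_map x \<bullet> b))"
proof -
  obtain j u where b: "b = axis j u" and u: "u \<in> {1, \<i>}"
    using assms by (auto simp: Basis_vec_def Basis_complex_def)
  have inner: "torus_map x \<bullet> b = cis (x $ j) \<bullet> u" for x by (simp add: b torus_map_def inner_axis)
  have "(\<lambda>x::real^'n. complex_of_real (cis (x $ j) \<bullet> u)) =
      (\<lambda>x. (if u = 1 then 1 / 2 else - \<i> / 2) * cis (1 * x $ j) + (if u = 1 then 1 / 2 else \<i> / 2) * cis (- 1 * x $ j))"
    using u by (auto simp: fun_eq_iff complex_eq_iff inner_complex_def)
  then show ?thesis
    unfolding inner by (simp only:) (intro trig_poly.add trig_poly_cmult trig_poly_cis; simp)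
qed

lemma trig_poly_real_polynomial:
  "real_polynomial_function p \<Longrightarrow> trig_poly (\<lambda>x::real^'n::finite. of_real (p (torus_map x)))"
proof (induction rule: real_polynomial_function.induct)
  case (linear f)
  interpret bounded_linear f by fact
  have rep: "f z = (\<Sum>b\<in>Basis. (z \<bullet> b) * f b)" for z
  proof -
    have "f z = f (\<Sum>b\<in>Basis. (z \<bullet> b) *\<^sub>R b)" by (simp only: euclidean_representation)
    also have "\<dots> = (\<Sum>b\<in>Basis. (z \<bullet> b) * f b)" by (simp only: sum scaleR real_scaleR_def)
    finally show ?thesis .
  qed
  have "(\<lambda>x::real^'n. of_real (f (torus_map x)) :: complex) = (\<lambda>x. \<Sum>b\<in>Basis. of_real (torus_map x \<bullet> b) * of_real (f b))"
    by (rule ext, subst rep) (simp only: of_real_sum of_real_mult)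
  then show ?case
    by (simp only:) (intro trig_poly_sum trig_poly_mult[OF _ trig_poly_const] trig_poly_torus_coordinate finite_Basis)
qed (simp_all add: trig_poly_const trig_poly.add trig_poly_mult)

lemma trig_poly_polynomial_function:
  assumes "polynomial_function (p :: complex^'n::finite \<Rightarrow> complex)"
  shows "trig_poly (\<lambda>x. p (torus_map x))"
proof -
  have "real_polynomial_function (Re \<circ> p)" "real_polynomial_function (Im \<circ> p)"
    using assms bounded_linear_Re bounded_linear_Im unfolding polynomial_function_def by blast+
  from this[THEN trig_poly_real_polynomial]
  have "trig_poly (\<lambda>x. of_real (Re (p (torus_map x))) + \<i> * of_real (Im (p (torus_map x))))"
    by (intro trig_poly.add trig_poly_cmult) (simp_all add: o_def)
  then show ?thesis by (simp flip: complex_eq)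
qed

lemma trig_poly_continuous: "trig_poly f \<Longrightarrow> continuous_on S f"
  by (induction rule: trig_poly.induct) (intro continuous_intros fchar_continuous; assumption)+

lemma integral_trig_poly_eq_0:
  assumes D: "continuous_on (cube a pi) D"
    and orth: "\<And>k. integral (cube a pi) (\<lambda>x. D x * fchar k x) = 0"
    and "trig_poly f"
  shows "integral (cube a pi) (\<lambda>x. D x * f x) = 0"
  using \<open>trig_poly f\<close>
proof (induction rule: trig_poly.induct)
  case (monomial c k)
  have "(\<lambda>x. D x * (c * fchar k x)) = (\<lambda>x. c * (D x * fchar k x))" by (simp add: mult_ac)
  then show ?case using orth[of k] by simp
next
  case (add f g)
  have "(\<lambda>x. D x * f x) integrable_on cube a pi" "(\<lambda>x. D x * g x) integrable_on cube a pi"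
    unfolding cube_def
    by (intro integrable_continuous continuous_on_mult D[unfolded cube_def] trig_poly_continuous add.hyps)+
  then show ?case using add.IH by (simp add: distrib_left integral_add)
qed

text \<open>A function on the cube that is constant on the fibres of \<open>torus_map\<close> is a continuous function on
  the torus, where the Stone--Weierstrass theorem applies.\<close>

lemma fourier_uniqueness:
  fixes D :: "real^'n::finite \<Rightarrow> complex"
  assumes D: "continuous_on (cube a pi) D"
    and fib: "\<And>x y. x \<in> cube a pi \<Longrightarrow> y \<in> cube a pi \<Longrightarrow> torus_map x = torus_map y \<Longrightarrow> D x = D y"
    and orth: "\<And>k. integral (cube a pi) (\<lambda>x. D x * fchar k x) = 0"
    and x: "x \<in> cube a pi"
  shows "D x = 0"
proof -
  let ?C = "cube a pi"
  have compC: "compact ?C" by (simp add: cube_def)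
  have contE: "continuous_on ?C torus_map"
    unfolding torus_map_def[abs_def] by (intro continuous_on_vec_lambda continuous_intros)
  define D' where "D' z = D (inv_into ?C torus_map z)" for z
  have D': "D' (torus_map x) = D x" if "x \<in> ?C" for x
    unfolding D'_def
    by (rule fib) (use that in \<open>auto intro: inv_into_into f_inv_into_f\<close>)
  \<comment> \<open>The preimage of a closed set under \<open>D'\<close> is the image of a compact
    subset of the cube, hence closed.\<close>
  have contD': "continuous_on (torus_map ` ?C) D'"
    unfolding continuous_closedin_preimage_eq
  proof (intro allI impI)
    fix T :: "complex set" assume "closed T"
    have "torus_map ` ?C \<inter> D' -` T = torus_map ` (?C \<inter> D -` T)" using D' by auto
    moreover have "closed (?C \<inter> D -` T)"
      using D compact_imp_closed[OF compC] \<open>closed T\<close> by (rule continuous_closed_preimage)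
    then have "compact (?C \<inter> (?C \<inter> D -` T))" by (rule compact_Int_closed[OF compC])
    then have "compact (?C \<inter> D -` T)" by (simp only: inf_left_idem)
    then have "compact (torus_map ` (?C \<inter> D -` T))"
      by (intro compact_continuous_image continuous_on_subset[OF contE]) auto
    ultimately show "closedin (top_of_set (torus_map ` ?C)) (torus_map ` ?C \<inter> D' -` T)"
      by (auto intro: closed_subset compact_imp_closed)
  qed
  have "continuous_on (torus_map ` ?C) (\<lambda>z. cnj (D' z))" by (intro continuous_intros contD')
  then have approx: "\<exists>p. polynomial_function p \<and> (\<forall>z\<in>torus_map ` ?C. norm (cnj (D' z) - p z) < e)" if "e > 0" for e
    using Stone_Weierstrass_polynomial_function[OF compact_continuous_image[OF contE compC]] that by blast
  have int: "(\<lambda>x. D x * cnj (D x)) integrable_on ?C"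
    using D unfolding cube_def by (intro integrable_continuous continuous_intros)
  \<comment> \<open>Orthogonality to trigonometric polynomials allows a polynomial close to
    \<open>cnj D\<close> to be subtracted from the second factor.\<close>
  have "norm (integral ?C (\<lambda>x. D x * cnj (D x))) \<le> e * integral ?C (\<lambda>x. norm (D x))" if e: "e > 0" for e
  proof -
    obtain p where p: "polynomial_function p" "\<And>x. x \<in> ?C \<Longrightarrow> norm (cnj (D x) - p (torus_map x)) < e"
      using approx[OF e] D' by auto
    have tp: "trig_poly (\<lambda>x. p (torus_map x))" by (rule trig_poly_polynomial_function[OF p(1)])
    have cont: "continuous_on ?C (\<lambda>x. D x * p (torus_map x))" "continuous_on ?C (\<lambda>x. D x * (cnj (D x) - p (torus_map x)))"
      by (intro continuous_intros D trig_poly_continuous[OF tp])+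
    have "integral ?C (\<lambda>x. D x * (cnj (D x) - p (torus_map x))) =
        integral ?C (\<lambda>x. D x * cnj (D x)) - integral ?C (\<lambda>x. D x * p (torus_map x))"
      using int integrable_continuous[OF cont(1)[unfolded cube_def]]
      by (simp add: right_diff_distrib integral_diff cube_def)
    then have "integral ?C (\<lambda>x. D x * cnj (D x)) = integral ?C (\<lambda>x. D x * (cnj (D x) - p (torus_map x)))"
      using integral_trig_poly_eq_0[OF D orth tp] by simp
    also have "norm \<dots> \<le> integral ?C (\<lambda>x. norm (D x) * e)"
    proof (rule integral_norm_bound_integral)
      show "(\<lambda>x. D x * (cnj (D x) - p (torus_map x))) integrable_on ?C"
        using cont(2) unfolding cube_def by (rule integrable_continuous)
      show "(\<lambda>x. norm (D x) * e) integrable_on ?C"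
        using D unfolding cube_def by (intro integrable_continuous continuous_intros)
      show "norm (D x * (cnj (D x) - p (torus_map x))) \<le> norm (D x) * e" if "x \<in> ?C" for x
        unfolding norm_mult using p(2)[OF that] by (intro mult_left_mono) auto
    qed
    finally show ?thesis by (simp add: mult.commute)
  qed
  note small = this
  have "integral ?C (\<lambda>x. D x * cnj (D x)) = 0"
  proof (rule ccontr)
    assume "integral ?C (\<lambda>x. D x * cnj (D x)) \<noteq> 0"
    then have n: "norm (integral ?C (\<lambda>x. D x * cnj (D x))) > 0" (is "?n > 0") by simp
    let ?I = "integral ?C (\<lambda>x. norm (D x))"
    have I: "?I \<ge> 0" by (rule integral_nonneg) (use D in \<open>auto simp: cube_def intro!: integrable_continuous continuous_intros\<close>)
    have "?n \<le> (?n / (2 * (?I + 1))) * ?I" by (rule small) (use n I in auto)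
    also have "\<dots> \<le> ?n / 2" using n I by (simp add: field_simps)
    finally show False using n by simp
  qed
  moreover have "(\<lambda>x. D x * cnj (D x)) = (\<lambda>x. of_real ((norm (D x))\<^sup>2))"
    by (simp only: complex_norm_square)
  ultimately have "((\<lambda>x. complex_of_real ((norm (D x))\<^sup>2)) has_integral 0) ?C"
    using int by (simp add: has_integral_iff)
  from has_integral_linear[OF this bounded_linear_Re]
  have "((\<lambda>x. (norm (D x))\<^sup>2) has_integral 0) ?C" by (simp add: o_def)
  then have "(norm (D x))\<^sup>2 = 0"
    using D x unfolding cube_def
    by (intro has_integral_0_cbox_imp_0[where f = "\<lambda>x. (norm (D x))\<^sup>2"] continuous_intros)
      (auto simp: interval_ne_empty_cart)
  then show ?thesis by simp
qed

lemma fchar_prod: "fchar k x = (\<Prod>j\<in>UNIV. cis (of_int (k j) * x $ j))"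
proof -
  have "fchar k x = exp (\<Sum>j\<in>UNIV. \<i> * of_real (of_int (k j) * x $ j))"
    by (simp only: fchar_def phase_def cis_conv_exp of_real_sum sum_distrib_left)
  then show ?thesis by (simp only: exp_sum[OF finite] cis_conv_exp)
qed

lemma fchar_torus_map:
  assumes "torus_map x = torus_map y" shows "fchar k x = fchar k y"
proof -
  have "cis (x $ j) = cis (y $ j)" for j
    using arg_cong[OF assms, of "\<lambda>z. z $ j"] by (simp add: torus_map_def)
  then show ?thesis by (simp add: fchar_prod flip: cis_power_int)
qed

text \<open>Identified points have coordinates that differ by multiples of 2 pi. A nonzero multiple
  leaves room only for opposite faces of the cube, so x lies outside every smaller concentric
  cube.\<close>

lemma torus_map_eq_boundary:
  assumes "torus_map x = torus_map y" "x \<in> cube a pi" "y \<in> cube a pi" "x \<noteq> y" "d < pi"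
  shows "x \<notin> cube a d"
proof -
  obtain j where j: "x $ j \<noteq> y $ j" using \<open>x \<noteq> y\<close> by (auto simp: vec_eq_iff)
  have "cis (x $ j) = cis (y $ j)"
    using arg_cong[OF assms(1), of "\<lambda>z. z $ j"] by (simp add: torus_map_def)
  then have "sin (x $ j) = sin (y $ j) \<and> cos (x $ j) = cos (y $ j)" by (simp add: complex_eq_iff)
  then obtain n :: int where n: "x $ j = y $ j + 2 * pi * n" unfolding sin_cos_eq_iff by (elim exE)
  have "n \<noteq> 0" using j unfolding n by (intro notI) simp
  then have "\<bar>real_of_int n\<bar> \<ge> 1" by linarith
  then have "2 * pi * \<bar>real_of_int n\<bar> \<ge> 2 * pi" by simp
  moreover have "\<bar>x $ j - y $ j\<bar> = 2 * pi * \<bar>real_of_int n\<bar>" using n by (simp add: abs_mult)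
  moreover have "\<bar>x $ j - a $ j\<bar> \<le> pi" "\<bar>y $ j - a $ j\<bar> \<le> pi" using assms(2,3) by (auto simp: mem_cube)
  ultimately have "\<bar>x $ j - a $ j\<bar> = pi" by linarith
  then have "\<not> \<bar>x $ j - a $ j\<bar> \<le> d" using \<open>d < pi\<close> by simp
  then show ?thesis unfolding mem_cube by blast
qed

text \<open>The difference of both sides has vanishing Fourier coefficients and respects the
  identifications of the torus: the series by periodicity, F because d < pi makes it vanish at
  distinct identified points. The factor reflects that the coefficients are not normalized.\<close>

lemma fourier_inversion:
  fixes F :: "real^'n::finite \<Rightarrow> complex"
  assumes M: "weight_seq M" and c: "decaying M c"
    and F: "continuous_on UNIV F" and supp: "\<And>x. x \<notin> cube a d \<Longrightarrow> F x = 0" and d: "d < pi"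
    and coeff: "\<And>k. c k = (LINT x|lborel. F x * fchar (\<lambda>j. - k j) x)"
    and x: "x \<in> cube a pi"
  shows "trig_series c x = of_real ((2 * pi) ^ CARD('n)) * F x"
proof -
  let ?C = "cube a pi" and ?K = "complex_of_real ((2 * pi) ^ CARD('n))"
  have sub: "cube a d \<subseteq> ?C" unfolding mem_cube subset_iff using d by (meson order_trans less_imp_le)
  have F': "continuous_on S F" for S using F by (rule continuous_on_subset) simp
  have S': "continuous_on S (trig_series c)" for S
    using trig_series_continuous[OF M c] by (rule continuous_on_subset) simp
  have int: "((\<lambda>x. F x * fchar (\<lambda>j. - l j) x) has_integral c l) ?C" for l
  proof -
    let ?G = "\<lambda>x. F x * fchar (\<lambda>j. - l j) x"
    have cont: "continuous_on ?C ?G" by (intro continuous_intros F' fchar_continuous)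
    have si: "set_integrable lborel ?C ?G"
      unfolding set_integrable_def by (rule borel_integrable_compact[OF _ cont]) (simp add: cube_def)
    have "c l = (LINT x:?C|lborel. ?G x)"
      unfolding coeff set_lebesgue_integral_def
      by (intro Bochner_Integration.integral_cong refl) (use supp sub in \<open>auto simp: indicator_def\<close>)
    then show ?thesis using set_borel_integral_eq_integral[OF si] by (simp add: has_integral_iff)
  qed
  define D where "D x = trig_series c x - ?K * F x" for x
  have "D x = 0"
  proof (rule fourier_uniqueness[OF _ _ _ x])
    show "continuous_on ?C D" unfolding D_def[abs_def] by (intro continuous_intros F' S')
  next
    fix x y assume xy: "x \<in> ?C" "y \<in> ?C" "torus_map x = torus_map y"
    have "F x = F y"
      using torus_map_eq_boundary[OF xy(3,1,2) _ d] torus_map_eq_boundary[OF xy(3)[symmetric] xy(2,1) _ d] supp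
      by metis
    then show "D x = D y"
      unfolding D_def trig_series_def using fchar_torus_map[OF xy(3)] by simp
  next
    fix k :: "'n \<Rightarrow> int"
    have "((\<lambda>x. trig_series c x * fchar k x - ?K * (F x * fchar k x)) has_integral
        c (\<lambda>j. - k j) * ?K - ?K * c (\<lambda>j. - k j)) ?C"
      using integral_trig_series[OF M c, of "\<lambda>j. - k j"] int[of "\<lambda>j. - k j"]
      by (intro has_integral_diff has_integral_mult_right) simp_all
    then show "integral ?C (\<lambda>x. D x * fchar k x) = 0"
      by (intro integral_unique) (simp add: D_def algebra_simps)
  qed
  then show ?thesis by (simp add: D_def)
qed

section \<open>Decay of Fourier coefficients\<close>

lemma lborel_integral_translation:
  fixes G :: "'a::euclidean_space \<Rightarrow> 'b::{banach, second_countable_topology}"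
  assumes "G \<in> borel_measurable borel"
  shows "(LINT x|lborel. G (c + x)) = (LINT x|lborel. G x)"
proof -
  have "(LINT x|lborel. G x) = (LINT x|distr lborel borel ((+) c). G x)"
    by (simp only: lborel_distr_plus)
  also have "\<dots> = (LINT x|lborel. G (c + x))"
    by (rule integral_distr) (use assms in measurable)
  finally show ?thesis ..
qed

lemma integrable_compact_support:
  fixes G :: "'a::euclidean_space \<Rightarrow> 'b::{banach, second_countable_topology}"
  assumes "continuous_on UNIV G" "compact Q" "\<And>x. x \<notin> Q \<Longrightarrow> G x = 0"
  shows "integrable lborel G"
proof -
  have "integrable lborel (\<lambda>x. indicator Q x *\<^sub>R G x)"
    using assms by (intro borel_integrable_compact continuous_on_subset[OF assms(1)]) auto
  moreover have "(\<lambda>x. indicator Q x *\<^sub>R G x) = G" using assms(3) by (auto simp: indicator_def fun_eq_iff)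
  ultimately show ?thesis by simp
qed

text \<open>The integral of a difference quotient vanishes by translation invariance; dominated convergence
  then replaces integration by parts.\<close>

lemma integral_line_derivative_eq_0:
  fixes G G' :: "'a::euclidean_space \<Rightarrow> complex"
  assumes G: "continuous_on UNIV G" and G': "continuous_on UNIV G'" and Q: "compact Q"
    and supp: "\<And>x. x \<notin> Q \<Longrightarrow> G x = 0" "\<And>x. x \<notin> Q \<Longrightarrow> G' x = 0"
    and deriv: "\<And>x. ((\<lambda>t. G (x + t *\<^sub>R e)) has_vector_derivative G' x) (at 0)" and e: "norm e \<le> 1"
  shows "(LINT x|lborel. G' x) = 0"
proof -
  define s where "s i x = of_nat (Suc i) * (G ((1 / real (Suc i)) *\<^sub>R e + x) - G x)" for i x
  have meas: "G \<in> borel_measurable borel" "G' \<in> borel_measurable borel"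
    using G G' by (auto intro: borel_measurable_continuous_onI)
  have int: "integrable lborel G" by (rule integrable_compact_support[OF G Q supp(1)])
  have int': "integrable lborel (\<lambda>x. G (c + x))" for c
  proof (rule integrable_compact_support[OF _ compact_translation[OF Q, of "- c"]])
    show "continuous_on UNIV (\<lambda>x. G (c + x))"
      by (rule continuous_on_compose2[OF G]) (auto intro: continuous_intros)
    fix x assume "x \<notin> (+) (- c) ` Q"
    then have "c + x \<notin> Q" using image_eqI[of x "(+) (- c)" "c + x" Q] by auto
    then show "G (c + x) = 0" by (rule supp)
  qed
  have "bounded (G' ` Q)"
    by (rule compact_imp_bounded[OF compact_continuous_image[OF continuous_on_subset[OF G'] Q]]) simp
  then obtain B where B: "\<And>x. x \<in> Q \<Longrightarrow> norm (G' x) \<le> B" "B > 0" by (auto simp: bounded_pos)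
  then have B': "norm (G' x) \<le> B" for x using supp(2)[of x] by (cases "x \<in> Q") auto
  obtain R where R: "\<And>x. x \<in> Q \<Longrightarrow> norm x \<le> R" using compact_imp_bounded[OF Q] by (auto simp: bounded_iff)
  have line: "((\<lambda>t. G (x + t *\<^sub>R e)) has_vector_derivative G' (x + t *\<^sub>R e)) (at t)" for x t
  proof -
    have "((\<lambda>s. G ((x + t *\<^sub>R e) + s *\<^sub>R e)) \<circ> (\<lambda>s. s - t) has_vector_derivative 1 *\<^sub>R G' (x + t *\<^sub>R e)) (at t)"
      by (rule vector_diff_chain_at) (use deriv[of "x + t *\<^sub>R e"] in \<open>auto intro!: derivative_eq_intros\<close>)
    then show ?thesis by (simp add: o_def algebra_simps)
  qed
  have mvt: "norm (G (x + t *\<^sub>R e) - G x) \<le> B * \<bar>t\<bar>" for x t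
  proof -
    have "norm (G (x + t *\<^sub>R e) - G (x + 0 *\<^sub>R e)) \<le> B * norm (t - 0)"
    proof (rule differentiable_bound[of UNIV])
      show "((\<lambda>t. G (x + t *\<^sub>R e)) has_derivative (\<lambda>h. h *\<^sub>R G' (x + t *\<^sub>R e))) (at t within UNIV)" for t
        using line[of x t] by (simp add: has_vector_derivative_def)
      show "onorm (\<lambda>h. h *\<^sub>R G' (x + t *\<^sub>R e)) \<le> B" for t
      proof (rule onorm_le)
        fix h :: real
        show "norm (h *\<^sub>R G' (x + t *\<^sub>R e)) \<le> B * norm h"
          using mult_left_mono[OF B'[of "x + t *\<^sub>R e"] abs_ge_zero[of h]] by (simp add: mult.commute[of B])
      qed
    qed auto
    then show ?thesis by simp
  qed
  \<comment> \<open>Steps of length at most 1 move the support by at most 1, so one ball carries all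
    difference quotients.\<close>
  have bound: "norm (s i x) \<le> B * indicator (cball 0 (R + 1)) x" for i x
  proof (cases "x \<in> cball 0 (R + 1)")
    case True
    have "norm (s i x) = real (Suc i) * norm (G (x + (1 / real (Suc i)) *\<^sub>R e) - G x)"
      unfolding s_def norm_mult norm_of_nat by (simp only: add.commute)
    also have "\<dots> \<le> real (Suc i) * (B * \<bar>1 / real (Suc i)\<bar>)" by (intro mult_left_mono mvt) simp
    finally show ?thesis using True by simp
  next
    case False
    then have x: "norm x > R + 1" by simp
    define v where "v = (1 / real (Suc i)) *\<^sub>R e"
    have "norm v \<le> 1 * 1"
      unfolding v_def norm_scaleR by (intro mult_mono e) auto
    then have "norm (v + x) > R"
      using x norm_triangle_ineq2[of x "- v"] unfolding norm_minus_cancel diff_minus_eq_add add.commute[of x v] by linarith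
    then have "v + x \<notin> Q" "x \<notin> Q" using R[of "v + x"] R[of x] x by linarith+
    then have "s i x = 0" unfolding s_def v_def[symmetric] by (simp add: supp)
    then show ?thesis using False by simp
  qed
  have "(\<lambda>i. LINT x|lborel. s i x) \<longlonglongrightarrow> (LINT x|lborel. G' x)"
  proof (rule integral_dominated_convergence)
    show "integrable lborel (\<lambda>x. B * indicator (cball 0 (R + 1)) x)"
      by (intro integrable_mult_right integrable_real_indicator emeasure_lborel_cball_finite) auto
    show "AE x in lborel. (\<lambda>i. s i x) \<longlonglongrightarrow> G' x"
    proof (rule AE_I2)
      fix x
      have "((\<lambda>t. norm ((G (x + t *\<^sub>R e) - G x) - t *\<^sub>R G' x) / norm t) \<longlongrightarrow> 0) (at 0)"
        using deriv[of x] by (simp add: has_vector_derivative_def has_derivative_iff_norm)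
      moreover have "filterlim (\<lambda>i. 1 / real (Suc i)) (at 0) sequentially"
        using LIMSEQ_inverse_real_of_nat by (simp add: filterlim_at inverse_eq_divide)
      ultimately have "(\<lambda>i. norm ((G (x + (1 / real (Suc i)) *\<^sub>R e) - G x) - (1 / real (Suc i)) *\<^sub>R G' x)
          / norm (1 / real (Suc i))) \<longlonglongrightarrow> 0"
        by (rule filterlim_compose)
      moreover have "norm ((G (x + (1 / real (Suc i)) *\<^sub>R e) - G x) - (1 / real (Suc i)) *\<^sub>R G' x)
          / norm (1 / real (Suc i)) = norm (s i x - G' x)" for i
      proof -
        have "s i x - G' x = of_nat (Suc i) * ((G (x + (1 / real (Suc i)) *\<^sub>R e) - G x) - (1 / real (Suc i)) *\<^sub>R G' x)"
          unfolding s_def right_diff_distrib[of "of_nat (Suc i)" _ "(1 / real (Suc i)) *\<^sub>R G' x"] add.commute[of x]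
          by (simp add: scaleR_conv_of_real del: of_nat_Suc)
        then show ?thesis by (simp only: norm_mult norm_of_nat) (simp del: of_nat_Suc)
      qed
      ultimately have "(\<lambda>i. norm (s i x - G' x)) \<longlonglongrightarrow> 0" by simp
      then show "(\<lambda>i. s i x) \<longlonglongrightarrow> G' x"
        by (simp only: tendsto_norm_zero_iff LIM_zero_iff)
    qed
    show "s i \<in> borel_measurable lborel" for i unfolding s_def[abs_def] using meas by measurable
  qed (use meas bound in auto)
  moreover have "(LINT x|lborel. s i x) = 0" for i
  proof -
    have "(LINT x|lborel. s i x) = of_nat (Suc i) * ((LINT x|lborel. G ((1 / real (Suc i)) *\<^sub>R e + x)) - (LINT x|lborel. G x))"
      unfolding s_def by (subst Bochner_Integration.integral_diff[symmetric, OF int' int]) simp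
    then show ?thesis using lborel_integral_translation[OF meas(1)] by simp
  qed
  ultimately show ?thesis by (simp add: LIMSEQ_const_iff)
qed

lemma phase_axis: "phase k (x + t *\<^sub>R axis j 1) = phase k x + t * of_int (k j)"
  by (simp add: phase_def algebra_simps sum.distrib axis_def if_distrib[of "\<lambda>x. _ * x"] sum_distrib_left[symmetric] cong: if_cong)

lemma fchar_line_derivative:
  "((\<lambda>t. fchar k (x + t *\<^sub>R axis j 1)) has_vector_derivative (\<i> * of_int (k j)) * fchar k x) (at 0)"
  unfolding fchar_def phase_axis has_vector_derivative_def
  by (auto intro!: derivative_eq_intros simp: scaleR_conv_of_real mult_ac)

text \<open>The integral of the derivative of D_p times the character vanishes in direction j; the
  product rule trades that derivative for a factor i k_j.\<close>

lemma fourier_coefficient_derivative: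
  fixes D :: "nat \<Rightarrow> real^'n::finite \<Rightarrow> complex"
  assumes D: "\<And>p. continuous_on UNIV (D p)" and Q: "compact Q" and supp: "\<And>p x. x \<notin> Q \<Longrightarrow> D p x = 0"
    and deriv: "\<And>p x. ((\<lambda>t. D p (x + t *\<^sub>R axis j 1)) has_vector_derivative D (Suc p) x) (at 0)"
  shows "(LINT x|lborel. D p x * fchar (\<lambda>j. - k j) x) = (\<i> * of_int (k j)) ^ p * (LINT x|lborel. D 0 x * fchar (\<lambda>j. - k j) x)"
proof (induction p)
  case (Suc p)
  let ?e = "fchar (\<lambda>j. - k j)" and ?k = "\<i> * of_int (k j)"
  have cont: "continuous_on UNIV (\<lambda>x. D p x * ?e x)" for p
    by (intro continuous_intros D fchar_continuous)
  have int: "integrable lborel (\<lambda>x. D p x * ?e x)" for p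
    by (rule integrable_compact_support[OF cont Q]) (simp add: supp)
  have "(LINT x|lborel. D (Suc p) x * ?e x - ?k * (D p x * ?e x)) = 0"
  proof (rule integral_line_derivative_eq_0[where e = "axis j 1" and G = "\<lambda>x. D p x * ?e x", OF cont _ Q])
    show "continuous_on UNIV (\<lambda>x. D (Suc p) x * ?e x - ?k * (D p x * ?e x))"
      by (intro continuous_intros cont)
    show "((\<lambda>t. D p (x + t *\<^sub>R axis j 1) * ?e (x + t *\<^sub>R axis j 1)) has_vector_derivative
        D (Suc p) x * ?e x - ?k * (D p x * ?e x)) (at 0)" for x
      using has_vector_derivative_mult[OF deriv[of p x] fchar_line_derivative[of "\<lambda>j. - k j" x j]]
      by (simp add: algebra_simps)
  qed (auto simp: supp)
  then have "(LINT x|lborel. D (Suc p) x * ?e x) = ?k * (LINT x|lborel. D p x * ?e x)"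
    using int by (simp add: Bochner_Integration.integral_diff)
  then show ?case using Suc by simp
qed simp

text \<open>Optimization over p: for c > 0 the quotient A / c bounds all \<rho>^p / w_p, with \<rho>
  the norm of k, and therefore exp N_h(\<rho>).\<close>

lemma fourier_coefficient_le:
  assumes M: "weight_seq M" and h: "h \<in> roumieu_seqs"
    and le: "\<And>p. sup_norm k ^ p * c \<le> A * wt M h p" and A: "A \<ge> 0"
  shows "c \<le> A * decay M h k"
proof (cases "c > 0")
  case True
  have "exp (assoc_fun M h (sup_norm k)) \<le> A / c"
    by (rule exp_assoc_fun_le[OF M h sup_norm_nonneg]) (use le True in \<open>simp add: field_simps\<close>)
  then show ?thesis using True by (simp add: exp_minus field_simps)
next
  case False
  then show ?thesis using A by (meson exp_ge_zero linorder_not_less mult_nonneg_nonneg order_trans)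
qed

lemma smooth_on_differentiable:
  assumes "open \<Omega>" "smooth_on \<Omega> f" "x \<in> \<Omega>" shows "foldr partial js f differentiable (at x)"
proof -
  have "foldr partial js f differentiable (at x within \<Omega>)"
    using assms(2,3) unfolding smooth_on_def differentiable_on_def by blast
  then show ?thesis by (simp only: at_within_open[OF assms(3,1)])
qed

lemma differentiable_line_derivative:
  assumes "f differentiable (at x)"
  shows "((\<lambda>t. f (x + t *\<^sub>R axis j 1)) has_vector_derivative partial j f x) (at 0)"
proof -
  obtain f' where f': "(f has_derivative f') (at x)" using assms by (auto simp: differentiable_def)
  have "((\<lambda>t. x + t *\<^sub>R axis j 1) has_vector_derivative axis j 1) (at 0)"
    by (auto intro!: derivative_eq_intros)
  from vector_derivative_diff_chain_within[OF this, of f, OF has_derivative_at_withinI] f'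
  have "((\<lambda>t. f (x + t *\<^sub>R axis j 1)) has_vector_derivative f' (axis j 1)) (at 0)" by (simp add: o_def)
  moreover from partialI[OF this] have "partial j f x = f' (axis j 1)" .
  ultimately show ?thesis by simp
qed

section \<open>Interpolation of coefficients\<close>

text \<open>Intermediate value theorem; this is the purpose of
  \<open>continuous_on_assoc_fun\<close>.\<close>

lemma assoc_fun_hits:
  assumes M: "weight_seq M" and b: "b \<in> roumieu_seqs" and \<rho>: "\<rho> > 0" and V: "assoc_fun M b \<rho> \<le> V"
  shows "\<exists>\<sigma>\<ge>\<rho>. assoc_fun M b \<sigma> = V"
proof -
  \<comment> \<open>By the term p = 1 of the supremum, the value at \<open>wt M b 1 * exp V\<close>
    is at least V.\<close>
  define R where "R = max \<rho> (wt M b 1 * exp V)"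
  have "R > 0" using \<rho> by (simp add: R_def)
  have "V = ln (wt M b 1 * exp V / wt M b 1)" using wt_pos[OF M b, of 1] by simp
  also have "\<dots> \<le> ln (R / wt M b 1)"
    using wt_pos[OF M b, of 1] \<open>R > 0\<close> by (subst ln_le_cancel_iff) (auto simp: R_def pos_le_divide_eq mult.commute)
  also have "\<dots> \<le> assoc_fun M b R" using \<open>R > 0\<close> by (intro assoc_fun_ge_ln[OF M b]) simp
  finally have "V \<le> assoc_fun M b R" .
  moreover have "continuous_on {\<rho>..R} (assoc_fun M b)"
    by (rule continuous_on_subset[OF continuous_on_assoc_fun[OF M b]]) (use \<rho> in auto)
  moreover have "\<rho> \<le> R" by (simp add: R_def)
  ultimately show ?thesis using IVT'[of "assoc_fun M b" \<rho> V R] V by blast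
qed

text \<open>The interpolation in abstract form: i stands for a frequency of size \<rho> i, and
  \<open>c \<epsilon>\<close> and \<open>c0\<close> for the coefficients of the net and of the
  ultradistribution.\<close>

context
  fixes M :: "nat \<Rightarrow> real" and k b s :: "nat \<Rightarrow> real" and m :: nat
    and \<rho> :: "'i \<Rightarrow> real" and c :: "real \<Rightarrow> 'i \<Rightarrow> complex" and c0 :: "'i \<Rightarrow> complex"
  assumes M: "weight_seq M" and k: "k \<in> roumieu_seqs" and b: "b \<in> roumieu_seqs" and s: "s \<in> roumieu_seqs"
    and bk: "\<And>i. i \<ge> 1 \<Longrightarrow> b i \<le> k i" and \<rho>: "\<And>i. \<rho> i \<ge> 0"
    and regular: "\<forall>h\<in>roumieu_seqs. \<exists>C. \<exists>\<epsilon>0>0. \<forall>\<epsilon>\<in>{0<..<\<epsilon>0}. \<forall>i.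
      cmod (c \<epsilon> i) \<le> C * exp (assoc_fun M k (1 / \<epsilon>)) * exp (- assoc_fun M h (\<rho> i))"
    and associated: "\<exists>C. \<exists>\<epsilon>0>0. \<forall>\<epsilon>\<in>{0<..<\<epsilon>0}. \<forall>i.
      cmod (c \<epsilon> i - c0 i) \<le> C * exp (- assoc_fun M b (1 / \<epsilon>)) * exp (m * assoc_fun M s (\<rho> i))"
begin

text \<open>One majorant X, the associated function of the pointwise minimum of s and t, replaces
  both associated functions, and h is chosen to beat a multiple of it. The growth in 1 / \<epsilon>
  is transferred from k to b.\<close>

lemma interpolation_bounds:
  assumes t: "t \<in> roumieu_seqs"
  obtains X :: "'i \<Rightarrow> real" and h C \<epsilon>0 d where "\<epsilon>0 > 0" "C \<ge> 0" "h \<in> roumieu_seqs"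
    "\<And>i. X i \<ge> 0" "\<And>i. assoc_fun M t (\<rho> i) \<le> X i"
    "\<And>i. (3 * m + 4) * X i \<le> assoc_fun M h (\<rho> i) + d"
    "\<And>\<epsilon> i. 0 < \<epsilon> \<Longrightarrow> \<epsilon> < \<epsilon>0 \<Longrightarrow> cmod (c \<epsilon> i) \<le> C * exp (assoc_fun M b (1 / \<epsilon>) - assoc_fun M h (\<rho> i))"
    "\<And>\<epsilon> i. 0 < \<epsilon> \<Longrightarrow> \<epsilon> < \<epsilon>0 \<Longrightarrow> cmod (c \<epsilon> i - c0 i) \<le> C * exp (m * X i - assoc_fun M b (1 / \<epsilon>))"
proof -
  define w where "w = (\<lambda>i. min (s i) (t i))"
  have w: "w \<in> roumieu_seqs" unfolding w_def by (rule roumieu_min[OF s t])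
  define X where "X i = assoc_fun M w (\<rho> i)" for i
  have X: "X i \<ge> 0" "assoc_fun M t (\<rho> i) \<le> X i" "assoc_fun M s (\<rho> i) \<le> X i" for i
  proof -
    show "X i \<ge> 0" unfolding X_def by (rule assoc_fun_nonneg[OF M w \<rho>])
    show "assoc_fun M t (\<rho> i) \<le> X i" unfolding X_def
      by (rule assoc_fun_antimono[OF M w t \<rho>]) (simp add: w_def)
    show "assoc_fun M s (\<rho> i) \<le> X i" unfolding X_def
      by (rule assoc_fun_antimono[OF M w s \<rho>]) (simp add: w_def)
  qed
  obtain h d where h: "h \<in> roumieu_seqs" and hd: "\<forall>\<rho>\<ge>0. real (3 * m + 4) * assoc_fun M w \<rho> \<le> assoc_fun M h \<rho> + d"
    using assoc_fun_multiple[OF M w, of "3 * m + 4"] by blast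
  obtain C1 \<epsilon>1 where 1: "\<epsilon>1 > 0" "\<forall>\<epsilon>\<in>{0<..<\<epsilon>1}. \<forall>i.
      cmod (c \<epsilon> i) \<le> C1 * exp (assoc_fun M k (1 / \<epsilon>)) * exp (- assoc_fun M h (\<rho> i))"
    using regular h by blast
  obtain C2 \<epsilon>2 where 2: "\<epsilon>2 > 0" "\<forall>\<epsilon>\<in>{0<..<\<epsilon>2}. \<forall>i.
      cmod (c \<epsilon> i - c0 i) \<le> C2 * exp (- assoc_fun M b (1 / \<epsilon>)) * exp (m * assoc_fun M s (\<rho> i))"
    using associated by blast
  define C where "C = max \<bar>C1\<bar> \<bar>C2\<bar>"
  show thesis
  proof (rule that[of "min \<epsilon>1 \<epsilon>2" C h X d])
    show "min \<epsilon>1 \<epsilon>2 > 0" "C \<ge> 0" "h \<in> roumieu_seqs" using 1 2 h by (auto simp: C_def)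
    show "X i \<ge> 0" "assoc_fun M t (\<rho> i) \<le> X i" for i by (fact X)+
    show "(3 * m + 4) * X i \<le> assoc_fun M h (\<rho> i) + d" for i
      using hd \<rho>[of i] unfolding X_def by blast
    fix \<epsilon> i assume \<epsilon>: "0 < \<epsilon>" "\<epsilon> < min \<epsilon>1 \<epsilon>2"
    have "cmod (c \<epsilon> i) \<le> C1 * exp (assoc_fun M k (1 / \<epsilon>)) * exp (- assoc_fun M h (\<rho> i))"
      using 1(2) \<epsilon> by simp
    also have "\<dots> \<le> C * exp (assoc_fun M b (1 / \<epsilon>)) * exp (- assoc_fun M h (\<rho> i))"
      using assoc_fun_antimono[OF M b k _ bk, of "1 / \<epsilon>"] \<epsilon>
      by (intro mult_right_mono mult_mono) (auto simp: C_def)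
    finally show "cmod (c \<epsilon> i) \<le> C * exp (assoc_fun M b (1 / \<epsilon>) - assoc_fun M h (\<rho> i))"
      by (simp add: exp_diff exp_minus field_simps)
    have "cmod (c \<epsilon> i - c0 i) \<le> C2 * exp (- assoc_fun M b (1 / \<epsilon>)) * exp (m * assoc_fun M s (\<rho> i))"
      using 2(2) \<epsilon> by simp
    also have "\<dots> \<le> C * exp (- assoc_fun M b (1 / \<epsilon>)) * exp (m * X i)"
      using X(3)[of i] by (intro mult_mono) (auto simp: C_def mult_left_mono)
    finally show "cmod (c \<epsilon> i - c0 i) \<le> C * exp (m * X i - assoc_fun M b (1 / \<epsilon>))"
      by (simp add: exp_diff exp_minus field_simps)
  qed
qed

text \<open>For the frequency \<open>\<rho> i\<close> the parameter \<open>\<epsilon>\<close> is chosen such that \<open>assoc_fun M b (1 / \<epsilon>)\<close>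
  balances the growth permitted by \<open>associated\<close> against the decay granted by \<open>regular\<close>.\<close>

lemma limit_coefficient_decay:
  assumes t: "t \<in> roumieu_seqs"
  shows "\<exists>B. \<forall>i. cmod (c0 i) \<le> B * exp (- assoc_fun M t (\<rho> i))"
proof -
  obtain X :: "'i \<Rightarrow> real" and h C \<epsilon>0 d where \<epsilon>0: "\<epsilon>0 > 0" and C: "C \<ge> 0"
    and X: "\<And>i. X i \<ge> 0" "\<And>i. assoc_fun M t (\<rho> i) \<le> X i"
    and h: "\<And>i. (3 * m + 4) * X i \<le> assoc_fun M h (\<rho> i) + d"
    and 1: "\<And>\<epsilon> i. 0 < \<epsilon> \<Longrightarrow> \<epsilon> < \<epsilon>0 \<Longrightarrow> cmod (c \<epsilon> i) \<le> C * exp (assoc_fun M b (1 / \<epsilon>) - assoc_fun M h (\<rho> i))"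
    and 2: "\<And>\<epsilon> i. 0 < \<epsilon> \<Longrightarrow> \<epsilon> < \<epsilon>0 \<Longrightarrow> cmod (c \<epsilon> i - c0 i) \<le> C * exp (m * X i - assoc_fun M b (1 / \<epsilon>))"
    by (rule interpolation_bounds[OF t]) metis
  \<comment> \<open>The offset V allows the solution \<sigma> below to be taken at least 2 /
    \<epsilon>0, so that 1 / \<sigma> is an admissible parameter; the 2 makes the inequality
    strict.\<close>
  define V where "V = assoc_fun M b (2 / \<epsilon>0)"
  have "cmod (c0 i) \<le> (C + C * exp (V + d)) * exp (- assoc_fun M t (\<rho> i))" for i
  proof -
    have V0: "V \<ge> 0" unfolding V_def using \<epsilon>0 by (intro assoc_fun_nonneg[OF M b]) simp
    define Z where "Z = real m * X i"
    have Z: "Z \<ge> 0" "3 * Z + 4 * X i \<le> assoc_fun M h (\<rho> i) + d"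
      using X(1)[of i] h[of i] by (simp_all add: Z_def algebra_simps)
    have "V \<le> V + (Z + X i)" using X(1)[of i] Z(1) by simp
    then obtain \<sigma> where \<sigma>: "\<sigma> \<ge> 2 / \<epsilon>0" "assoc_fun M b \<sigma> = V + (Z + X i)"
      using assoc_fun_hits[OF M b, of "2 / \<epsilon>0" "V + (Z + X i)"] \<epsilon>0 unfolding V_def by auto
    have "\<sigma> > 0" using \<sigma>(1) \<epsilon>0 by (meson divide_pos_pos less_le_trans zero_less_numeral)
    have \<epsilon>: "0 < 1 / \<sigma>" "1 / \<sigma> < \<epsilon>0"
      using \<sigma>(1) \<epsilon>0 \<open>\<sigma> > 0\<close> by (auto simp: field_simps)
    have "cmod (c0 i) \<le> cmod (c (1 / \<sigma>) i - c0 i) + cmod (c (1 / \<sigma>) i)"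
      using norm_triangle_ineq4[of "c (1 / \<sigma>) i" "c (1 / \<sigma>) i - c0 i"] by simp
    also have "\<dots> \<le> C * exp (Z - assoc_fun M b \<sigma>) + C * exp (assoc_fun M b \<sigma> - assoc_fun M h (\<rho> i))"
      using 1[OF \<epsilon>, of i] 2[OF \<epsilon>, of i] by (simp add: Z_def)
    \<comment> \<open>At this \<sigma> the first exponent is - V - X i, and the second is at most V
      + d - 2 Z - 3 X i.\<close>
    also have "\<dots> \<le> C * exp (- X i) + C * exp (V + d - X i)"
      using Z V0 X(1)[of i] C unfolding \<sigma>(2) by (intro add_mono mult_left_mono) auto
    also have "\<dots> = (C + C * exp (V + d)) * exp (- X i)"
      by (simp add: exp_diff exp_minus field_simps)
    also have "\<dots> \<le> (C + C * exp (V + d)) * exp (- assoc_fun M t (\<rho> i))"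
      using C X(2)[of i] by (intro mult_left_mono) (auto simp: add_nonneg_nonneg)
    finally show ?thesis .
  qed
  then show ?thesis by blast
qed

text \<open>Where 2 (m + 1) X \<le> Y, association alone suffices. Elsewhere
  \<open>c \<epsilon>\<close> and \<open>c0\<close> are estimated separately, the latter by
  \<open>limit_coefficient_decay\<close> applied to h. Giving up half of Y buys the decay in i that
  makes the convergence summable over the frequencies.\<close>

lemma coefficient_convergence:
  assumes t: "t \<in> roumieu_seqs"
  shows "\<exists>B. \<exists>\<epsilon>0>0. \<forall>\<epsilon>\<in>{0<..<\<epsilon>0}. \<forall>i.
    cmod (c \<epsilon> i - c0 i) \<le> B * exp (- assoc_fun M b (1 / \<epsilon>) / 2) * exp (- assoc_fun M t (\<rho> i))"
proof -
  obtain X :: "'i \<Rightarrow> real" and h C \<epsilon>0 d where \<epsilon>0: "\<epsilon>0 > 0" and C: "C \<ge> 0" and hR: "h \<in> roumieu_seqs"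
    and X: "\<And>i. X i \<ge> 0" "\<And>i. assoc_fun M t (\<rho> i) \<le> X i"
    and h: "\<And>i. (3 * m + 4) * X i \<le> assoc_fun M h (\<rho> i) + d"
    and 1: "\<And>\<epsilon> i. 0 < \<epsilon> \<Longrightarrow> \<epsilon> < \<epsilon>0 \<Longrightarrow> cmod (c \<epsilon> i) \<le> C * exp (assoc_fun M b (1 / \<epsilon>) - assoc_fun M h (\<rho> i))"
    and 2: "\<And>\<epsilon> i. 0 < \<epsilon> \<Longrightarrow> \<epsilon> < \<epsilon>0 \<Longrightarrow> cmod (c \<epsilon> i - c0 i) \<le> C * exp (m * X i - assoc_fun M b (1 / \<epsilon>))"
    by (rule interpolation_bounds[OF t]) metis
  obtain B where B: "\<And>i. cmod (c0 i) \<le> B * exp (- assoc_fun M h (\<rho> i))"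
    using limit_coefficient_decay[OF hR] by blast
  have B0: "\<bar>B\<bar> \<ge> 0" by simp
  let ?A = "C + (C + \<bar>B\<bar>) * exp d"
  have "cmod (c \<epsilon> i - c0 i) \<le> ?A * exp (- assoc_fun M b (1 / \<epsilon>) / 2) * exp (- assoc_fun M t (\<rho> i))"
    if \<epsilon>: "0 < \<epsilon>" "\<epsilon> < \<epsilon>0" for \<epsilon> i
  proof -
    define Y where "Y = assoc_fun M b (1 / \<epsilon>)"
    define Z where "Z = real m * X i"
    have Z: "Z \<ge> 0" using X(1)[of i] by (simp add: Z_def)
    have "cmod (c \<epsilon> i - c0 i) \<le> ?A * exp (- Y / 2 - X i)"
    proof (cases "2 * Z + 2 * X i \<le> Y")
      case True
      have "cmod (c \<epsilon> i - c0 i) \<le> C * exp (Z - Y)" using 2[OF \<epsilon>] by (simp add: Y_def Z_def)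
      also have "\<dots> \<le> ?A * exp (- Y / 2 - X i)"
        using True C B0 by (intro mult_mono) (auto simp: add_nonneg_nonneg)
      finally show ?thesis .
    next
      case False
      have N: "- assoc_fun M h (\<rho> i) \<le> d - (3 * Z + 4 * X i)"
        using h[of i] by (simp add: Z_def algebra_simps)
      have "cmod (c \<epsilon> i - c0 i) \<le> C * exp (Y - assoc_fun M h (\<rho> i)) + \<bar>B\<bar> * exp (- assoc_fun M h (\<rho> i))"
      proof -
        have "B * exp (- assoc_fun M h (\<rho> i)) \<le> \<bar>B\<bar> * exp (- assoc_fun M h (\<rho> i))"
          by (intro mult_right_mono) auto
        then show ?thesis
          using norm_triangle_ineq4[of "c \<epsilon> i" "c0 i"] 1[OF \<epsilon>, of i] B[of i] unfolding Y_def by linarith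
      qed
      also have "\<dots> \<le> C * exp (d + (- Y / 2 - X i)) + \<bar>B\<bar> * exp (d + (- Y / 2 - X i))"
        using N False C B0 Z X(1)[of i] by (intro add_mono mult_left_mono) auto
      also have "\<dots> = ((C + \<bar>B\<bar>) * exp d) * exp (- Y / 2 - X i)"
        unfolding exp_add by (simp add: algebra_simps)
      also have "\<dots> \<le> ?A * exp (- Y / 2 - X i)" using C by (intro mult_right_mono) auto
      finally show ?thesis .
    qed
    also have "\<dots> \<le> ?A * exp (- Y / 2 + - assoc_fun M t (\<rho> i))"
      using C B0 X(2)[of i] by (intro mult_left_mono) (auto simp: add_nonneg_nonneg)
    finally show ?thesis unfolding exp_add Y_def by (simp add: mult.assoc)
  qed
  with \<epsilon>0 show ?thesis by (intro exI[of _ ?A] exI[of _ \<epsilon>0]) auto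
qed

end

section \<open>Localization\<close>

abbreviation pure_derivs_le ::
  "(real^'n::finite) set \<Rightarrow> (real^'n \<Rightarrow> complex) \<Rightarrow> real \<Rightarrow> (nat \<Rightarrow> real) \<Rightarrow> bool" where
  "pure_derivs_le Q f B w \<equiv> \<forall>x\<in>Q. \<forall>j q. cmod (foldr partial (replicate q j) f x) \<le> B * w q"

lemma closed_cube: "closed (cube a d)"
  unfolding cube_def by (rule closed_cbox)

text \<open>With d < pi the support of the cutoff lies inside one period cell of the Fourier
  series.\<close>

locale local_cutoff =
  fixes M :: "nat \<Rightarrow> real" and \<Omega> :: "(real^'n::finite) set" and a :: "real^'n" and d L :: real
    and \<kappa> :: "nat \<Rightarrow> real \<Rightarrow> real"
  assumes M: "weight_seq M" and open_\<Omega>: "open \<Omega>" and cube_sub: "cube a d \<subseteq> \<Omega>" and d_less: "d < pi"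
    and \<kappa>_deriv: "\<And>q t. (\<kappa> q has_real_derivative \<kappa> (Suc q) t) (at t)"
    and \<kappa>_supp: "\<And>q t. \<bar>t\<bar> \<ge> d \<Longrightarrow> \<kappa> q t = 0"
    and L_pos: "L > 0" and \<kappa>_bound: "\<And>q t. \<bar>\<kappa> q t\<bar> \<le> L ^ q * M q"
begin

section \<open>Localized characters as test functions\<close>

definition cutoff_factor :: "'n \<Rightarrow> nat \<Rightarrow> real \<Rightarrow> complex" where
  "cutoff_factor j q t = of_real (\<kappa> q (t - a $ j))"

definition wave_factor :: "('n \<Rightarrow> int) \<Rightarrow> 'n \<Rightarrow> nat \<Rightarrow> real \<Rightarrow> complex" where
  "wave_factor k j p t = (\<i> * of_int (k j)) ^ p * cis (of_int (k j) * t)"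

definition packet_factor :: "('n \<Rightarrow> int) \<Rightarrow> 'n \<Rightarrow> nat \<Rightarrow> real \<Rightarrow> complex" where
  "packet_factor k j q t = leib (\<lambda>p. cutoff_factor j p t) (\<lambda>p. wave_factor k j p t) q 0 0"

definition cutoff :: "real^'n \<Rightarrow> complex" where
  "cutoff = tensor cutoff_factor (\<lambda>_. 0)"

text \<open>Pairing with the packet of frequency - k reads off the k-th Fourier coefficient of the
  localized function, and applying T to it defines that of the localized ultradistribution.\<close>

definition packet :: "('n \<Rightarrow> int) \<Rightarrow> real^'n \<Rightarrow> complex" where
  "packet k = tensor (packet_factor k) (\<lambda>_. 0)"

lemma cutoff_factor_deriv: "(cutoff_factor j q has_vector_derivative cutoff_factor j (Suc q) t) (at t)"
proof -
  have "((\<lambda>t. \<kappa> q (t - a $ j)) has_real_derivative \<kappa> (Suc q) (t - a $ j) * 1) (at t)"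
    by (rule DERIV_chain2[OF \<kappa>_deriv]) (auto intro!: derivative_eq_intros)
  from has_vector_derivative_of_real[OF this] show ?thesis
    unfolding cutoff_factor_def[abs_def] by simp
qed

lemma wave_factor_deriv: "(wave_factor k j p has_vector_derivative wave_factor k j (Suc p) t) (at t)"
  unfolding wave_factor_def[abs_def] has_vector_derivative_def
  by (auto intro!: derivative_eq_intros simp: scaleR_conv_of_real mult_ac)

lemma packet_factor_deriv: "(packet_factor k j q has_vector_derivative packet_factor k j (Suc q) t) (at t)"
  unfolding packet_factor_def[abs_def]
  by (rule leib_has_vector_derivative) (rule cutoff_factor_deriv wave_factor_deriv)+

lemma cutoff_factor_bound: "cmod (cutoff_factor j q t) \<le> 1 * (L ^ q * M q)"
  using \<kappa>_bound by (simp add: cutoff_factor_def)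

lemma packet_eq: "packet k x = cutoff x * fchar k x"
  by (simp add: packet_def cutoff_def tensor_def packet_factor_def wave_factor_def fchar_prod prod.distrib)

lemma tensor_cutoff_support: "x \<notin> cube a d \<Longrightarrow> tensor cutoff_factor \<alpha> x = 0"
proof -
  assume "x \<notin> cube a d"
  then obtain j where "\<not> \<bar>x $ j - a $ j\<bar> \<le> d" unfolding mem_cube by blast
  then have "cutoff_factor j (\<alpha> j) (x $ j) = 0" by (simp add: cutoff_factor_def \<kappa>_supp)
  then show ?thesis unfolding tensor_def by (intro prod_zero) auto
qed

text \<open>The q-th derivative of a wave has modulus |k_j|^q, which
  \<open>power_le_assoc_fun\<close> splits into a weight of order q and an exponential in the
  frequency.\<close>

lemma packet_factor_bound:
  assumes l: "l \<in> roumieu_seqs"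
  shows "\<exists>C>0. \<forall>k j q t. cmod (packet_factor k j q t) \<le>
    (C * exp (assoc_fun M (halved l) \<bar>of_int (k j)\<bar>)) * wt M l q"
proof -
  obtain C where C: "C > 0" "leib_const M l L C"
    using leib_weight_bound[OF M l L_pos] by blast
  have l2: "(halved l) \<in> roumieu_seqs" by (rule halved_roumieu[OF l])
  have "cmod (packet_factor k j q t) \<le> C * 1 * exp (assoc_fun M (halved l) \<bar>of_int (k j)\<bar>) * wt M l q" for k j q t
    unfolding packet_factor_def
  proof (rule C(2)[rule_format])
    show "cmod (cutoff_factor j q t) \<le> 1 * (L ^ q * M q)" for q by (rule cutoff_factor_bound)
    show "cmod (wave_factor k j q t) \<le> exp (assoc_fun M (halved l) \<bar>of_int (k j)\<bar>) * wt M (halved l) q" for q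
      using power_le_assoc_fun[OF M l2, of "\<bar>of_int (k j)\<bar>" q]
      by (simp add: wave_factor_def norm_mult norm_power mult.commute)
  qed simp_all
  with C(1) show ?thesis by auto
qed

lemma packet_in_test_on: "packet k \<in> test_on M \<Omega> (cube a d)"
  unfolding packet_def
proof (rule tensor_in_test_on[where W = "packet_factor k", OF packet_factor_deriv M])
  fix r assume "r \<in> roumieu_seqs"
  from packet_factor_bound[OF this] obtain C where
    "\<forall>k j q t. cmod (packet_factor k j q t) \<le> (C * exp (assoc_fun M (halved r) \<bar>of_int (k j)\<bar>)) * wt M r q"
    by blast
  then show "\<exists>A. \<forall>j q t. cmod (packet_factor k j q t) \<le> A j * wt M r q"
    by (intro exI[of _ "\<lambda>j. C * exp (assoc_fun M (halved r) \<bar>of_int (k j)\<bar>)"]) blast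
next
  show "closed (cube a d)" by (rule closed_cube)
next
  fix x assume "x \<notin> cube a d"
  then have "cutoff x = 0" unfolding cutoff_def by (rule tensor_cutoff_support)
  then show "tensor (packet_factor k) (\<lambda>_. 0) x = 0" using packet_eq[of k x] by (simp add: packet_def)
qed

text \<open>Each coordinate contributes one associated function, at |k_j| and hence at most its
  value at the norm of k; this accounts for the dimension in the exponent.\<close>

lemma useminorm_packet:
  assumes l: "l \<in> roumieu_seqs"
  shows "\<exists>C>0. \<forall>k. useminorm M l K (packet k) \<le>
    ennreal (C * exp (real CARD('n) * assoc_fun M (halved l) (sup_norm k)))"
proof -
  let ?N = "assoc_fun M (halved l)"
  have l2: "(halved l) \<in> roumieu_seqs" by (rule halved_roumieu[OF l])
  obtain C where C: "C > 0" "\<forall>k j q t. cmod (packet_factor k j q t) \<le> (C * exp (?N \<bar>of_int (k j)\<bar>)) * wt M l q"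
    using packet_factor_bound[OF l] by blast
  have "useminorm M l K (packet k) \<le> ennreal (C ^ CARD('n) * exp (real CARD('n) * ?N (sup_norm k)))" for k
  proof -
    have "useminorm M l K (packet k) \<le> ennreal (\<Prod>j\<in>(UNIV :: 'n set). C * exp (?N (sup_norm k)))"
      unfolding packet_def
    proof (rule useminorm_tensor[where W = "packet_factor k", OF packet_factor_deriv M l])
      fix j q t
      have "cmod (packet_factor k j q t) \<le> (C * exp (?N \<bar>of_int (k j)\<bar>)) * wt M l q" using C(2) by blast
      also have "\<dots> \<le> (C * exp (?N (sup_norm k))) * wt M l q"
        using assoc_fun_mono[OF M l2 _ sup_norm_upper[of k j]] C(1) wt_pos[OF M l, of q]
        by (intro mult_right_mono mult_left_mono) auto
      finally show "cmod (packet_factor k j q t) \<le> (C * exp (?N (sup_norm k))) * wt M l q" .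
    qed
    then show ?thesis by (simp add: power_mult_distrib exp_of_nat_mult[symmetric])
  qed
  with C(1) show ?thesis by (intro exI[of _ "C ^ CARD('n)"]) auto
qed

lemma pairing_packet: "pairing \<Omega> g (packet k) = (LINT x|lborel. (cutoff x * g x) * fchar k x)"
  unfolding pairing_def set_lebesgue_integral_def
proof (intro Bochner_Integration.integral_cong refl)
  fix x
  show "indicator \<Omega> x *\<^sub>R (g x * packet k x) = (cutoff x * g x) * fchar k x"
    using tensor_cutoff_support[of x "\<lambda>_. 0"] cube_sub
    by (cases "x \<in> \<Omega>") (auto simp: packet_eq cutoff_def mult_ac)
qed

section \<open>Pure derivatives of a localized function\<close>

context
  fixes g :: "real^'n \<Rightarrow> complex"
  assumes g: "smooth_on \<Omega> g"
begin

text \<open>The p-th derivative of the localized function in direction j. The cutoff factors make it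
  vanish off the cube, where g may have arbitrary values.\<close>

definition cutoff_deriv :: "'n \<Rightarrow> nat \<Rightarrow> real^'n \<Rightarrow> complex" where
  "cutoff_deriv j p x = leib (\<lambda>q. tensor cutoff_factor (\<lambda>i. if i = j then q else 0) x)
     (\<lambda>q. foldr partial (replicate q j) g x) p 0 0"

lemma cutoff_deriv_support: "x \<notin> cube a d \<Longrightarrow> cutoff_deriv j p x = 0"
  unfolding cutoff_deriv_def by (intro leib_eq_0 tensor_cutoff_support)

lemma cutoff_deriv_0: "cutoff_deriv j 0 x = cutoff x * g x"
  by (simp add: cutoff_deriv_def cutoff_def)

lemma cutoff_deriv_line_derivative:
  "((\<lambda>t. cutoff_deriv j p (x + t *\<^sub>R axis j 1)) has_vector_derivative cutoff_deriv j (Suc p) x) (at 0)"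
proof (cases "x \<in> \<Omega>")
  case True
  have upd: "(\<lambda>i. if i = j then q else 0)(j := Suc ((\<lambda>i. if i = j then q else 0) j)) = (\<lambda>i. if i = j then Suc q else 0)" for q
    by auto
  have 1: "((\<lambda>t. tensor cutoff_factor (\<lambda>i. if i = j then q else 0) (x + t *\<^sub>R axis j 1)) has_vector_derivative
      tensor cutoff_factor (\<lambda>i. if i = j then Suc q else 0) x) (at 0)" for q
    using tensor_line_derivative[where W = cutoff_factor, OF cutoff_factor_deriv, of "\<lambda>i. if i = j then q else 0" x j] unfolding upd .
  have 2: "((\<lambda>t. foldr partial (replicate q j) g (x + t *\<^sub>R axis j 1)) has_vector_derivative
      foldr partial (replicate (Suc q) j) g x) (at 0)" for q
    using differentiable_line_derivative[OF smooth_on_differentiable[OF open_\<Omega> g True, of "replicate q j"], of j] by simp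
  have "((\<lambda>t. leib (\<lambda>q. tensor cutoff_factor (\<lambda>i. if i = j then q else 0) (x + t *\<^sub>R axis j 1))
      (\<lambda>q. foldr partial (replicate q j) g (x + t *\<^sub>R axis j 1)) p 0 0) has_vector_derivative
      leib (\<lambda>q. tensor cutoff_factor (\<lambda>i. if i = j then q else 0) (x + 0 *\<^sub>R axis j 1))
      (\<lambda>q. foldr partial (replicate q j) g (x + 0 *\<^sub>R axis j 1)) (Suc p) 0 0) (at 0)"
    by (rule leib_has_vector_derivative) (use 1 2 in simp_all)
  then show ?thesis unfolding cutoff_deriv_def by simp
next
  case False
  \<comment> \<open>Off \<Omega>, x has a neighbourhood that avoids the cube, and there the function
    is identically 0.\<close>
  then have x: "x \<in> - cube a d" using cube_sub by auto
  have "open (- cube a d)" by (intro open_Compl closed_cube)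
  have "((\<lambda>t. x + t *\<^sub>R axis j 1) \<longlongrightarrow> x + 0 *\<^sub>R axis j 1) (nhds 0)"
    by (intro tendsto_intros filterlim_ident)
  then have "eventually (\<lambda>t. x + t *\<^sub>R axis j 1 \<in> - cube a d) (nhds 0)"
    by (rule topological_tendstoD[OF _ \<open>open (- cube a d)\<close>]) (use x in simp)
  then have "eventually (\<lambda>t. cutoff_deriv j p (x + t *\<^sub>R axis j 1) = 0) (nhds 0)"
    by eventually_elim (simp add: cutoff_deriv_support)
  then have "((\<lambda>t. cutoff_deriv j p (x + t *\<^sub>R axis j 1)) has_vector_derivative 0) (at 0)
      \<longleftrightarrow> ((\<lambda>t. 0 :: complex) has_vector_derivative 0) (at (0::real))"
    using cutoff_deriv_support[of x j p] x by (intro has_vector_derivative_cong_ev) (auto elim: eventually_mono)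
  then show ?thesis using cutoff_deriv_support[of x j "Suc p"] x by simp
qed

text \<open>\<Omega> and the complement of the cube are open and together cover the space;
  continuity is checked on each.\<close>

lemma cutoff_deriv_continuous: "continuous_on UNIV (cutoff_deriv j p)"
proof -
  have leib_cont: "continuous_on S (\<lambda>x. leib (\<lambda>q. tensor cutoff_factor (\<lambda>i. if i = j then q else 0) x)
     (\<lambda>q. foldr partial (replicate q j) g x) p b c)" if "S \<subseteq> \<Omega>" for S b c
  proof (induction p arbitrary: b c)
    case 0
    have "isCont (\<lambda>x. tensor cutoff_factor (\<lambda>i. if i = j then b else 0) x * foldr partial (replicate c j) g x) x"
      if "x \<in> S" for x
      using that \<open>S \<subseteq> \<Omega>\<close>
      by (intro continuous_intros differentiable_imp_continuous_within
          tensor_differentiable[where W = cutoff_factor, OF cutoff_factor_deriv] smooth_on_differentiable[OF open_\<Omega> g]) auto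
    then show ?case by (simp add: continuous_at_imp_continuous_on)
  qed (simp add: continuous_on_add)
  have "continuous_on (\<Omega> \<union> - cube a d) (cutoff_deriv j p)"
  proof (rule continuous_on_open_Un[OF open_\<Omega>])
    show "open (- cube a d)" by (intro open_Compl closed_cube)
    show "continuous_on \<Omega> (cutoff_deriv j p)" unfolding cutoff_deriv_def[abs_def] by (rule leib_cont) simp
    show "continuous_on (- cube a d) (cutoff_deriv j p)"
      by (rule continuous_on_eq[of _ "\<lambda>_. 0"]) (auto simp: cutoff_deriv_support)
  qed
  also have "\<Omega> \<union> - cube a d = UNIV" using cube_sub by auto
  finally show ?thesis .
qed

lemma cutoff_continuous: "continuous_on UNIV (\<lambda>x. cutoff x * g x)"
  using cutoff_deriv_continuous[of _ 0] unfolding cutoff_deriv_0[abs_def] .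

end

text \<open>In the direction where the norm of k is attained, p derivatives multiply the coefficient
  by the p-th power of that norm; optimizing over p gives the decay. C is independent of g and B, so
  for a net the dependence on \<epsilon> is carried by B alone.\<close>

lemma coefficient_bound:
  assumes h: "h \<in> roumieu_seqs"
  shows "\<exists>C>0. \<forall>g B. smooth_on \<Omega> g \<longrightarrow> B \<ge> 0 \<longrightarrow>
    pure_derivs_le (cube a d) g B (wt M (halved h)) \<longrightarrow>
    (\<forall>k. cmod (pairing \<Omega> g (packet (\<lambda>j. - k j))) \<le> (C * B) * decay M h k)"
proof -
  obtain C where C: "C > 0" "leib_const M h L C"
    using leib_weight_bound[OF M h L_pos] by blast
  define V where "V = measure lborel (cube a d) + 1"
  have V: "V > 0" unfolding V_def by (simp add: add_nonneg_pos)
  have "cmod (pairing \<Omega> g (packet (\<lambda>j. - k j))) \<le> ((C * V) * B) * decay M h k"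
    if g: "smooth_on \<Omega> g" and B: "B \<ge> 0"
      and le: "pure_derivs_le (cube a d) g B (wt M (halved h))" for g B k
  proof (rule fourier_coefficient_le[OF M h])
    fix p
    obtain j where j: "sup_norm k = \<bar>of_int (k j)\<bar>" using sup_norm_attained by blast
    let ?D = "cutoff_deriv g j"
    have cube: "compact (cube a d)" by (simp add: cube_def)
    have bound: "cmod (?D p x) \<le> C * B * wt M h p" if x: "x \<in> cube a d" for x
    proof -
      have "cmod (?D p x) \<le> C * 1 * B * wt M h p"
        unfolding cutoff_deriv_def[OF g]
      proof (rule C(2)[rule_format])
        show "cmod (foldr partial (replicate q j) g x) \<le> B * wt M (halved h) q" for q using le x by blast
        show "cmod (tensor cutoff_factor (\<lambda>i. if i = j then q else 0) x) \<le> 1 * (L ^ q * M q)" for q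
        proof -
          have "cmod (tensor cutoff_factor (\<lambda>i. if i = j then q else 0) x) \<le> (\<Prod>i\<in>UNIV. if i = j then L ^ q * M q else 1)"
            unfolding tensor_def prod_norm[symmetric]
          proof (intro prod_mono conjI norm_ge_zero)
            fix i
            show "cmod (cutoff_factor i (if i = j then q else 0) (x $ i)) \<le> (if i = j then L ^ q * M q else 1)"
              using cutoff_factor_bound[of i q "x $ i"] cutoff_factor_bound[of i 0 "x $ i"] 
              by (cases "i = j") (simp_all add: weight_seq_0[OF M])
          qed
          then show ?thesis by simp
        qed
      qed (use B in simp_all)
      then show ?thesis by simp
    qed
    have "cmod (LINT x|lborel. ?D p x * fchar (\<lambda>j. - k j) x) \<le> (LINT x|lborel. (C * B * wt M h p) * indicator (cube a d) x)"
    proof (rule Bochner_Integration.integral_norm_bound_integral)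
      show "integrable lborel (\<lambda>x. ?D p x * fchar (\<lambda>j. - k j) x)"
        by (rule integrable_compact_support[OF _ cube])
          (auto intro!: continuous_intros cutoff_deriv_continuous[OF g] fchar_continuous simp: cutoff_deriv_support[OF g])
      show "integrable lborel (\<lambda>x. (C * B * wt M h p) * indicator (cube a d) x)"
        unfolding cube_def by (intro integrable_mult_right integrable_real_indicator emeasure_lborel_cbox_finite) auto
      show "cmod (?D p x * fchar (\<lambda>j. - k j) x) \<le> (C * B * wt M h p) * indicator (cube a d) x" for x
        using bound[of x] cutoff_deriv_support[OF g, of x j p] by (cases "x \<in> cube a d") (auto simp: norm_mult)
    qed
    also have "\<dots> = (C * B * wt M h p) * measure lborel (cube a d)" by (simp add: cube_def)
    also have "\<dots> \<le> (C * B * wt M h p) * V"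
      unfolding V_def using C B wt_pos[OF M h, of p] by (intro mult_left_mono) auto
    finally have "cmod ((\<i> * of_int (k j)) ^ p * (LINT x|lborel. ?D 0 x * fchar (\<lambda>j. - k j) x)) \<le> (C * B * wt M h p) * V"
      using fourier_coefficient_derivative[of ?D "cube a d" j p k] cutoff_deriv_continuous[OF g] cube
        cutoff_deriv_support[OF g] cutoff_deriv_line_derivative[OF g] by simp
    then show "sup_norm k ^ p * cmod (pairing \<Omega> g (packet (\<lambda>j. - k j))) \<le> ((C * V) * B) * wt M h p"
      unfolding j pairing_packet cutoff_deriv_0[OF g] by (simp add: norm_mult norm_power mult_ac)
  next
    show "0 \<le> (C * V) * B" using C V B by simp
  qed
  moreover have "C * V > 0" using C V by simp
  ultimately show ?thesis by (intro exI[of _ "C * V"]) blast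
qed

lemma sup_norm_uminus: "sup_norm (\<lambda>j. - k j) = sup_norm k"
  by (simp add: sup_norm_def)

text \<open>Characters have modulus 1, so the sum of the coefficient differences bounds the distance
  of the two series uniformly on the cube.\<close>

lemma local_limit:
  fixes G :: "real \<Rightarrow> real^'n \<Rightarrow> complex" and T :: "(real^'n \<Rightarrow> complex) \<Rightarrow> complex"
  assumes k: "k \<in> roumieu_seqs" and b: "b \<in> roumieu_seqs" and s: "s \<in> roumieu_seqs"
    and bk: "\<And>i. i \<ge> 1 \<Longrightarrow> b i \<le> k i"
    and smooth: "\<And>\<epsilon>. \<epsilon> \<in> {0<..<1} \<Longrightarrow> smooth_on \<Omega> (G \<epsilon>)"
    and ultra: "\<And>\<epsilon> h. \<epsilon> \<in> {0<..<1} \<Longrightarrow> h \<in> roumieu_seqs \<Longrightarrow>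
      \<exists>B. pure_derivs_le (cube a d) (G \<epsilon>) B (wt M h)"
    and regular: "\<And>h. h \<in> roumieu_seqs \<Longrightarrow> \<exists>C. \<exists>\<epsilon>0>0. \<forall>\<epsilon>\<in>{0<..<\<epsilon>0}. pure_derivs_le (cube a d) (G \<epsilon>) (C * exp (assoc_fun M k (1 / \<epsilon>))) (wt M h)"
    and associated: "\<exists>C. \<exists>\<epsilon>0>0. \<forall>\<epsilon>\<in>{0<..<\<epsilon>0}. \<forall>i. cmod (pairing \<Omega> (G \<epsilon>) (packet i) - T (packet i))
      \<le> C * exp (- assoc_fun M b (1 / \<epsilon>)) * exp (real CARD('n) * assoc_fun M s (sup_norm i))"
  shows "\<exists>c. decaying M c \<and> (\<exists>B. \<exists>\<epsilon>0>0. \<forall>\<epsilon>\<in>{0<..<\<epsilon>0}. \<forall>x\<in>cube a pi.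
      cmod (cutoff x * G \<epsilon> x - trig_series c x) \<le> B * exp (- assoc_fun M b (1 / \<epsilon>) / 2))"
proof -
  \<comment> \<open>Dividing the coefficients by K makes the series reproduce the localized function
    itself.\<close>
  define K where "K = (2 * pi) ^ CARD('n)"
  have K: "K > 0" by (simp add: K_def)
  define ce where "ce \<epsilon> i = pairing \<Omega> (G \<epsilon>) (packet (\<lambda>j. - i j)) / of_real K" for \<epsilon> i
  define c0 where "c0 i = T (packet (\<lambda>j. - i j)) / of_real K" for i
  define coeff_bound where "coeff_bound h D \<longleftrightarrow> (\<forall>\<epsilon> B. \<epsilon> \<in> {0<..<1} \<longrightarrow>
      pure_derivs_le (cube a d) (G \<epsilon>) B (wt M (halved h)) \<longrightarrow>
      (\<forall>i. cmod (ce \<epsilon> i) \<le> D * \<bar>B\<bar> * decay M h i))" for h D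
  have coeff: "\<exists>D>0. coeff_bound h D"
    if h: "h \<in> roumieu_seqs" for h
  proof -
    have h2: "(halved h) \<in> roumieu_seqs" by (rule halved_roumieu[OF h])
    obtain D where D: "D > 0" "\<forall>g B. smooth_on \<Omega> g \<longrightarrow> B \<ge> 0 \<longrightarrow>
      pure_derivs_le (cube a d) g B (wt M (halved h)) \<longrightarrow>
      (\<forall>k. cmod (pairing \<Omega> g (packet (\<lambda>j. - k j))) \<le> (D * B) * decay M h k)"
      using coefficient_bound[OF h] by blast
    have "cmod (ce \<epsilon> i) \<le> (D / K) * \<bar>B\<bar> * decay M h i"
      if \<epsilon>: "\<epsilon> \<in> {0<..<1}" and le: "pure_derivs_le (cube a d) (G \<epsilon>) B (wt M (halved h))"
      for \<epsilon> B i
    proof -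
      have "cmod (foldr partial (replicate q j) (G \<epsilon>) x) \<le> \<bar>B\<bar> * wt M (halved h) q" if "x \<in> cube a d" for x j q
      proof -
        have "B * wt M (halved h) q \<le> \<bar>B\<bar> * wt M (halved h) q"
          using wt_pos[OF M h2, of q] by (intro mult_right_mono) auto
        then show ?thesis using le that by (meson order_trans)
      qed
      then have "cmod (pairing \<Omega> (G \<epsilon>) (packet (\<lambda>j. - i j))) \<le> (D * \<bar>B\<bar>) * decay M h i"
        by (intro D(2)[rule_format] smooth[OF \<epsilon>]) auto
      then show ?thesis using K by (simp add: ce_def norm_divide field_simps)
    qed
    moreover have "D / K > 0" using D(1) K by simp
    ultimately show ?thesis unfolding coeff_bound_def by (intro exI[of _ "D / K"]) simp
  qed
  have dec: "decaying M (ce \<epsilon>)" if \<epsilon>: "\<epsilon> \<in> {0<..<1}" for \<epsilon>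
    unfolding decaying_def
  proof
    fix h assume h: "h \<in> roumieu_seqs"
    have h2: "(halved h) \<in> roumieu_seqs" by (rule halved_roumieu[OF h])
    obtain B where B: "pure_derivs_le (cube a d) (G \<epsilon>) B (wt M (halved h))"
      using ultra[OF \<epsilon> h2] by blast
    obtain D where "coeff_bound h D" using coeff[OF h] by blast
    from this[unfolded coeff_bound_def, rule_format, OF \<epsilon> B[rule_format]]
    show "\<exists>B. \<forall>i. cmod (ce \<epsilon> i) \<le> B * decay M h i" by (intro exI[of _ "D * \<bar>B\<bar>"]) simp
  qed
  have regular': "\<forall>h\<in>roumieu_seqs. \<exists>C. \<exists>\<epsilon>0>0. \<forall>\<epsilon>\<in>{0<..<\<epsilon>0}. \<forall>i.
      cmod (ce \<epsilon> i) \<le> C * exp (assoc_fun M k (1 / \<epsilon>)) * decay M h i"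
  proof
    fix h assume h: "h \<in> roumieu_seqs"
    have h2: "(halved h) \<in> roumieu_seqs" by (rule halved_roumieu[OF h])
    obtain C \<epsilon>1 where C: "\<epsilon>1 > 0" "\<forall>\<epsilon>\<in>{0<..<\<epsilon>1}. pure_derivs_le (cube a d) (G \<epsilon>) (C * exp (assoc_fun M k (1 / \<epsilon>))) (wt M (halved h))"
      using regular[OF h2] by blast
    obtain D where D: "coeff_bound h D" using coeff[OF h] by blast
    have "cmod (ce \<epsilon> i) \<le> (D * \<bar>C\<bar>) * exp (assoc_fun M k (1 / \<epsilon>)) * decay M h i"
      if \<epsilon>: "\<epsilon> \<in> {0<..<min \<epsilon>1 1}" for \<epsilon> i
    proof -
      have "\<epsilon> \<in> {0<..<1}" "\<epsilon> \<in> {0<..<\<epsilon>1}" using \<epsilon> by auto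
      from D[unfolded coeff_bound_def, rule_format, OF this(1) C(2)[rule_format, OF this(2)], of i]
      show ?thesis by (simp add: abs_mult mult.assoc)
    qed
    then show "\<exists>C. \<exists>\<epsilon>0>0. \<forall>\<epsilon>\<in>{0<..<\<epsilon>0}. \<forall>i.
      cmod (ce \<epsilon> i) \<le> C * exp (assoc_fun M k (1 / \<epsilon>)) * decay M h i"
      using C(1) by (intro exI[of _ "D * \<bar>C\<bar>"] exI[of _ "min \<epsilon>1 1"] conjI ballI allI) simp_all
  qed
  have associated': "\<exists>C. \<exists>\<epsilon>0>0. \<forall>\<epsilon>\<in>{0<..<\<epsilon>0}. \<forall>i. cmod (ce \<epsilon> i - c0 i)
      \<le> C * exp (- assoc_fun M b (1 / \<epsilon>)) * exp (real CARD('n) * assoc_fun M s (sup_norm i))"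
  proof -
    obtain C \<epsilon>0 where C: "\<epsilon>0 > 0" "\<forall>\<epsilon>\<in>{0<..<\<epsilon>0}. \<forall>i. cmod (pairing \<Omega> (G \<epsilon>) (packet i) - T (packet i))
      \<le> C * exp (- assoc_fun M b (1 / \<epsilon>)) * exp (real CARD('n) * assoc_fun M s (sup_norm i))"
      using associated by blast
    have "cmod (ce \<epsilon> i - c0 i) \<le> (C / K) * exp (- assoc_fun M b (1 / \<epsilon>)) * exp (real CARD('n) * assoc_fun M s (sup_norm i))"
      if "\<epsilon> \<in> {0<..<\<epsilon>0}" for \<epsilon> i
    proof -
      have "cmod (ce \<epsilon> i - c0 i) = cmod (pairing \<Omega> (G \<epsilon>) (packet (\<lambda>j. - i j)) - T (packet (\<lambda>j. - i j))) / K"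
        unfolding ce_def c0_def diff_divide_distrib[symmetric] norm_divide using K by simp
      also have "\<dots> \<le> (C * exp (- assoc_fun M b (1 / \<epsilon>)) * exp (real CARD('n) * assoc_fun M s (sup_norm i))) / K"
        using C(2)[rule_format, OF that, of "\<lambda>j. - i j"] K unfolding sup_norm_uminus by (intro divide_right_mono) auto
      finally show ?thesis by simp
    qed
    with C(1) show ?thesis by (intro exI[of _ "C / K"] exI[of _ \<epsilon>0]) blast
  qed
  note interpolation = M k b s bk sup_norm_nonneg regular' associated'
  have dec0: "decaying M c0"
    unfolding decaying_def using limit_coefficient_decay[OF interpolation] by blast
  \<comment> \<open>Any member of \<open>roumieu_seqs\<close> gives enough decay to sum over the
    lattice; \<open>real\<close> is a concrete one.\<close>
  obtain B \<epsilon>1 where B: "\<epsilon>1 > 0" "\<forall>\<epsilon>\<in>{0<..<\<epsilon>1}. \<forall>i.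
    cmod (ce \<epsilon> i - c0 i) \<le> B * exp (- assoc_fun M b (1 / \<epsilon>) / 2) * decay M real i"
    using coefficient_convergence[OF interpolation roumieu_seqs_real] by blast
  obtain Z where Z: "\<forall>u B. (\<forall>k::'n \<Rightarrow> int. 0 \<le> u k \<and> u k \<le> B * decay M real k) \<longrightarrow>
    summable (\<lambda>m. u (freq m)) \<and> (\<Sum>m. u (freq m)) \<le> Z * B"
    using lattice_sum_bound[OF M roumieu_seqs_real, where 'n = 'n] by blast
  have "cmod (cutoff x * G \<epsilon> x - trig_series c0 x) \<le> (Z * B) * exp (- assoc_fun M b (1 / \<epsilon>) / 2)"
    if \<epsilon>: "\<epsilon> \<in> {0<..<min \<epsilon>1 1}" and x: "x \<in> cube a pi" for \<epsilon> x
  proof -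
    have \<epsilon>': "\<epsilon> \<in> {0<..<1}" "\<epsilon> \<in> {0<..<\<epsilon>1}" using \<epsilon> by auto
    have "trig_series (ce \<epsilon>) x = of_real ((2 * pi) ^ CARD('n)) * (cutoff x * G \<epsilon> x / of_real K)"
    proof (rule fourier_inversion[OF M dec[OF \<epsilon>'(1)] _ _ d_less _ x])
      show "continuous_on UNIV (\<lambda>x. cutoff x * G \<epsilon> x / complex_of_real K)"
        using K by (intro continuous_intros cutoff_continuous[OF smooth[OF \<epsilon>'(1)]]) simp
      show "cutoff x * G \<epsilon> x / complex_of_real K = 0" if "x \<notin> cube a d" for x
        using tensor_cutoff_support[OF that] by (simp add: cutoff_def)
      show "ce \<epsilon> i = (LINT x|lborel. cutoff x * G \<epsilon> x / complex_of_real K * fchar (\<lambda>j. - i j) x)" for i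
        unfolding ce_def pairing_packet by (subst integral_divide_zero[symmetric]) simp
    qed
    then have eq: "cutoff x * G \<epsilon> x = trig_series (ce \<epsilon>) x" using K by (simp add: K_def)
    let ?u = "\<lambda>m. cmod (ce \<epsilon> (freq m) - c0 (freq m))"
    have u: "summable ?u" "suminf ?u \<le> Z * (B * exp (- assoc_fun M b (1 / \<epsilon>) / 2))"
      using Z[rule_format, of "\<lambda>i. cmod (ce \<epsilon> i - c0 i)" "B * exp (- assoc_fun M b (1 / \<epsilon>) / 2)"]
        B(2)[rule_format, OF \<epsilon>'(2)] by auto
    have "(\<lambda>m. ce \<epsilon> (freq m) * fchar (freq m) x - c0 (freq m) * fchar (freq m) x)
        sums (trig_series (ce \<epsilon>) x - trig_series c0 x)"
      by (intro sums_diff trig_series_sums[OF M] dec dec0 \<epsilon>')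
    then have "trig_series (ce \<epsilon>) x - trig_series c0 x = (\<Sum>m. (ce \<epsilon> (freq m) - c0 (freq m)) * fchar (freq m) x)"
      by (simp add: sums_iff left_diff_distrib)
    also have "norm \<dots> \<le> (\<Sum>m. norm ((ce \<epsilon> (freq m) - c0 (freq m)) * fchar (freq m) x))"
      by (rule summable_norm) (use u(1) in \<open>simp add: norm_mult\<close>)
    also have "\<dots> = suminf ?u" by (simp add: norm_mult)
    also have "\<dots> \<le> (Z * B) * exp (- assoc_fun M b (1 / \<epsilon>) / 2)" using u(2) by (simp add: mult.assoc)
    finally show ?thesis unfolding eq .
  qed
  moreover have "min \<epsilon>1 1 > 0" using B(1) by simp
  ultimately show ?thesis using dec0
    by (intro exI[of _ c0] conjI exI[of _ "Z * B"] exI[of _ "min \<epsilon>1 1"]) blast+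
qed

end

section \<open>Regularity of the limit\<close>

lemma path_length_linepath: "path_length (linepath x y) \<le> ennreal (dist x (y :: 'a::real_normed_vector))"
  unfolding path_length_def
proof (rule SUP_least, clarify)
  fix n :: nat and t :: "nat \<Rightarrow> real" assume t: "mono t" "range t \<subseteq> {0..1}"
  have "dist (linepath x y (t i)) (linepath x y (t (Suc i))) = (t (Suc i) - t i) * dist x y" for i
  proof -
    have "linepath x y (t i) - linepath x y (t (Suc i)) = (t (Suc i) - t i) *\<^sub>R (x - y)"
      by (simp add: linepath_def algebra_simps)
    moreover have "t i \<le> t (Suc i)" using t(1) by (simp add: monoD)
    ultimately show ?thesis by (simp add: dist_norm)
  qed
  then have "(\<Sum>i<n. dist (linepath x y (t i)) (linepath x y (t (Suc i)))) = (t n - t 0) * dist x y"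
    by (simp add: sum_distrib_right[symmetric] sum_lessThan_telescope)
  also have "\<dots> \<le> 1 * dist x y"
  proof (rule mult_right_mono)
    have "t n \<in> {0..1}" "t 0 \<in> {0..1}" by (rule subsetD[OF t(2) rangeI])+
    then show "t n - t 0 \<le> 1" by simp
  qed simp
  finally show "(\<Sum>i<n. ennreal (dist (linepath x y (t i)) (linepath x y (t (Suc i))))) \<le> ennreal (dist x y)"
    by (simp add: sum_ennreal ennreal_leI)
qed

text \<open>Segments serve as connecting curves, with constant 1. This allows the hypotheses on the
  net to be applied to small cubes.\<close>

lemma regular_compact_convex:
  fixes K :: "'a::real_normed_vector set"
  assumes "compact K" "K \<subseteq> \<Omega>" "convex K"
  shows "regular_compact \<Omega> K"
  unfolding regular_compact_def
proof (intro conjI exI[of _ 1] allI impI)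
  show "finite (components K)"
    using convex_connected[OF assms(3)] by (cases "K = {}") (simp_all add: components_eq_sing_iff[THEN iffD2])
  fix x y assume "connected_component K x y"
  then have "x \<in> K" "y \<in> K" using connected_component_in by blast+
  then show "\<exists>\<gamma>. path \<gamma> \<and> path_image \<gamma> \<subseteq> K \<and> pathstart \<gamma> = x \<and> pathfinish \<gamma> = y \<and>
      path_length \<gamma> \<le> ennreal (1 * dist x y)"
    using assms(3) path_length_linepath[of x y]
    by (intro exI[of _ "linepath x y"]) (simp add: closed_segment_subset)
qed (use assms in auto)

text \<open>For a multi-index concentrated on j, the list chosen in \<open>multi_deriv\<close> can
  only be \<open>replicate q j\<close>; so the seminorm controls pure derivatives in the form in
  which the coefficient estimate uses them.\<close>

lemma useminorm_upper:
  assumes M: "weight_seq M" and h: "h \<in> roumieu_seqs"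
    and le: "useminorm M h K f \<le> ennreal B" and B: "B \<ge> 0" and x: "x \<in> K"
  shows "cmod (foldr partial (replicate q j) f x) \<le> B * wt M h q"
proof -
  let ?\<alpha> = "\<lambda>i. if i = j then q else 0"
  define js where "js = (SOME js. \<forall>i. count_list js i = ?\<alpha> i)"
  have count: "count_list js i = ?\<alpha> i" for i unfolding js_def by (rule count_list_some)
  have "set js \<subseteq> {j}" using count count_list_0_iff by (metis (full_types) singletonI subsetI)
  then have "js = replicate (length js) j" by (metis replicate_length_same singletonD subsetD)
  moreover have "count_list (replicate m j) j = m" for m by (induction m) auto
  ultimately have "js = replicate q j" using count[of j] by (metis (full_types))
  then have md: "multi_deriv ?\<alpha> f = foldr partial (replicate q j) f"
    unfolding multi_deriv_def js_def[symmetric] by simp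
  have "ennreal (cmod (multi_deriv ?\<alpha> f x) / (M (order_of ?\<alpha>) * (\<Prod>i=1..order_of ?\<alpha>. h i))) \<le> useminorm M h K f"
    unfolding useminorm_def by (rule SUP_upper2[of "(x, ?\<alpha>)"]) (use x in auto)
  also have "\<dots> \<le> ennreal B" by (rule le)
  finally have "cmod (foldr partial (replicate q j) f x) / wt M h q \<le> B"
    using B unfolding md by (simp add: wt_def)
  then show ?thesis using wt_pos[OF M h, of q] by (simp add: field_simps)
qed

lemma length_eq_order_of: "length js = order_of (count_list js)" for js :: "'n::finite list"
proof (induction js)
  case (Cons a js)
  have "count_list (a # js) = (\<lambda>i. (if i = a then 1 else 0) + count_list js i)" by auto
  then show ?case using Cons by (simp only: sum.distrib) simp
qed simp

text \<open>Iterated line derivatives are local; this transfers smoothness and bounds from the local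
  series to the limit function.\<close>

lemma foldr_partial_cong:
  assumes "open U" "\<And>x. x \<in> U \<Longrightarrow> f x = g x" "x \<in> U"
  shows "foldr partial js f x = foldr partial js g x"
  using assms(3)
proof (induction js arbitrary: x)
  case (Cons j js)
  let ?f = "foldr partial js f" and ?g = "foldr partial js g"
  have "((\<lambda>t. x + t *\<^sub>R axis j 1) \<longlongrightarrow> x + 0 *\<^sub>R axis j 1) (nhds 0)"
    by (intro tendsto_intros filterlim_ident)
  then have "eventually (\<lambda>t. x + t *\<^sub>R axis j 1 \<in> U) (nhds 0)"
    by (rule topological_tendstoD[OF _ \<open>open U\<close>]) (use Cons.prems in simp)
  then have ev: "eventually (\<lambda>t. ?f (x + t *\<^sub>R axis j 1) = ?g (x + t *\<^sub>R axis j 1)) (nhds 0)"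
    by eventually_elim (rule Cons.IH)
  have "((\<lambda>t. ?f (x + t *\<^sub>R axis j 1)) has_vector_derivative D) (at 0) \<longleftrightarrow>
      ((\<lambda>t. ?g (x + t *\<^sub>R axis j 1)) has_vector_derivative D) (at 0)" for D
    by (intro has_vector_derivative_cong_ev)
      (use ev Cons.IH[OF Cons.prems] in \<open>auto elim: eventually_mono\<close>)
  then have "partial j ?f x = partial j ?g x" unfolding partial_def vector_derivative_def by simp
  then show ?case by simp
qed (simp add: assms(2))

text \<open>The parameter c covers both the halved exponent in the convergence of the local series
  and the full exponent in the association.\<close>

lemma exp_assoc_fun_tendsto_0:
  assumes M: "weight_seq M" and b: "b \<in> roumieu_seqs" and c: "c > 0"
  shows "((\<lambda>\<epsilon>. B * exp (- assoc_fun M b (1 / \<epsilon>) / c)) \<longlongrightarrow> 0) (at_right 0)"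
proof -
  have "filterlim (\<lambda>\<sigma>. 1 / wt M b 1 * \<sigma>) at_top at_top"
    by (rule filterlim_tendsto_pos_mult_at_top[OF tendsto_const _ filterlim_ident]) (simp add: wt_pos[OF M b])
  then have "filterlim (\<lambda>\<sigma>. ln (1 / wt M b 1 * \<sigma>)) at_top at_top" by (rule filterlim_compose[OF ln_at_top])
  then have "filterlim (assoc_fun M b) at_top at_top"
    by (rule filterlim_at_top_mono)
      (use assoc_fun_ge_ln[OF M b] in \<open>auto intro!: eventually_mono[OF eventually_ge_at_top[of 0]]\<close>)
  then have "filterlim (\<lambda>\<epsilon>. assoc_fun M b (inverse \<epsilon>)) at_top (at_right 0)"
    by (rule filterlim_compose[OF _ filterlim_inverse_at_top_right])
  then have "filterlim (\<lambda>\<epsilon>. 1 / c * assoc_fun M b (inverse \<epsilon>)) at_top (at_right 0)"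
    by (rule filterlim_tendsto_pos_mult_at_top[OF tendsto_const, rotated]) (simp add: c)
  then have "filterlim (\<lambda>\<epsilon>. - (1 / c * assoc_fun M b (inverse \<epsilon>))) at_bot (at_right 0)"
    by (simp add: filterlim_uminus_at_bot)
  then have "((\<lambda>\<epsilon>. exp (- (1 / c * assoc_fun M b (inverse \<epsilon>)))) \<longlongrightarrow> 0) (at_right 0)"
    by (rule filterlim_compose[OF exp_at_bot])
  then have "((\<lambda>\<epsilon>. B * exp (- (1 / c * assoc_fun M b (inverse \<epsilon>)))) \<longlongrightarrow> 0) (at_right 0)"
    by (rule tendsto_mult_right_zero)
  then show ?thesis by (simp add: inverse_eq_divide)
qed

lemma cube_mono: "d \<le> e \<Longrightarrow> cube x d \<subseteq> cube x e"
  unfolding mem_cube subset_iff by (meson order_trans)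

lemma cube_nhds:
  assumes "open \<Omega>" "x \<in> \<Omega>"
  shows "\<exists>d>0. d < pi \<and> cube x d \<subseteq> (\<Omega> :: (real^'n::finite) set)"
proof -
  obtain e where e: "e > 0" "cball x e \<subseteq> \<Omega>" using assms open_contains_cball by blast
  \<comment> \<open>Dividing e by the dimension bounds the sum of the coordinate distances, hence
    the Euclidean distance, by e; the bound 1 ensures d < pi.\<close>
  define d where "d = min (e / real CARD('n)) 1"
  have "cube x d \<subseteq> cball x e"
  proof
    fix y assume y: "y \<in> cube x d"
    have "norm (y - x) \<le> (\<Sum>j\<in>UNIV. \<bar>(y - x) $ j\<bar>)" by (rule norm_le_l1_cart)
    also have "\<dots> \<le> (\<Sum>j\<in>(UNIV::'n set). e / real CARD('n))"
      using y by (intro sum_mono) (auto simp: mem_cube d_def)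
    finally show "y \<in> cball x e" by (simp add: dist_norm norm_minus_commute)
  qed
  moreover have "d > 0" using e(1) by (simp add: d_def)
  moreover have "d < pi" using pi_gt3 by (simp add: d_def)
  ultimately show ?thesis using e(2) by blast
qed

lemma smooth_on_continuous: "smooth_on \<Omega> f \<Longrightarrow> continuous_on \<Omega> f"
  unfolding smooth_on_def using differentiable_imp_continuous_on[of f \<Omega>] by (metis foldr.simps(1) id_apply)

lemma pairing_compact_support:
  fixes f \<phi> :: "real^'n::finite \<Rightarrow> complex"
  assumes "compact K" "K \<subseteq> \<Omega>" "\<And>x. x \<notin> K \<Longrightarrow> \<phi> x = 0" "continuous_on K f" "continuous_on K \<phi>"
  shows "integrable lborel (\<lambda>x. indicator K x *\<^sub>R (f x * \<phi> x))"
    and "pairing \<Omega> f \<phi> = (LINT x|lborel. indicator K x *\<^sub>R (f x * \<phi> x))"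
proof -
  show "integrable lborel (\<lambda>x. indicator K x *\<^sub>R (f x * \<phi> x))"
    by (intro borel_integrable_compact assms continuous_intros)
  show "pairing \<Omega> f \<phi> = (LINT x|lborel. indicator K x *\<^sub>R (f x * \<phi> x))"
    unfolding pairing_def set_lebesgue_integral_def
    by (intro Bochner_Integration.integral_cong refl) (use assms(2,3) in \<open>auto simp: indicator_def\<close>)
qed

lemma pairing_tendsto:
  fixes f \<phi> :: "real^'n::finite \<Rightarrow> complex"
  assumes K: "compact K" "K \<subseteq> \<Omega>" "\<And>x. x \<notin> K \<Longrightarrow> \<phi> x = 0" "continuous_on K \<phi>" "continuous_on K f"
    and G: "\<forall>\<^sub>F \<epsilon> in F. continuous_on K (G \<epsilon>)" and ul: "uniform_limit K G f F"
  shows "((\<lambda>\<epsilon>. pairing \<Omega> (G \<epsilon>) \<phi>) \<longlongrightarrow> pairing \<Omega> f \<phi>) F"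
proof (rule tendstoI)
  fix e :: real assume e: "e > 0"
  define I where "I = (LINT x|lborel. indicator K x *\<^sub>R cmod (\<phi> x))"
  have int: "integrable lborel (\<lambda>x. indicator K x *\<^sub>R cmod (\<phi> x))"
    by (intro borel_integrable_compact K continuous_intros)
  have I: "I \<ge> 0" unfolding I_def by (intro integral_nonneg_AE) auto
  define e' where "e' = e / (I + 1)"
  have e': "e' > 0" using e I by (simp add: e'_def)
  have "\<forall>\<^sub>F \<epsilon> in F. \<forall>x\<in>K. dist (G \<epsilon> x) (f x) < e'" using ul e' by (rule uniform_limitD)
  with G show "\<forall>\<^sub>F \<epsilon> in F. dist (pairing \<Omega> (G \<epsilon>) \<phi>) (pairing \<Omega> f \<phi>) < e"
  proof eventually_elim
    case (elim \<epsilon>)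
    have g: "integrable lborel (\<lambda>x. indicator K x *\<^sub>R (G \<epsilon> x * \<phi> x))"
        "pairing \<Omega> (G \<epsilon>) \<phi> = (LINT x|lborel. indicator K x *\<^sub>R (G \<epsilon> x * \<phi> x))"
      by (rule pairing_compact_support; use K elim(1) in blast)+
    have f: "integrable lborel (\<lambda>x. indicator K x *\<^sub>R (f x * \<phi> x))"
        "pairing \<Omega> f \<phi> = (LINT x|lborel. indicator K x *\<^sub>R (f x * \<phi> x))"
      by (rule pairing_compact_support; use K in blast)+
    have "pairing \<Omega> (G \<epsilon>) \<phi> - pairing \<Omega> f \<phi>
        = (LINT x|lborel. indicator K x *\<^sub>R (G \<epsilon> x * \<phi> x) - indicator K x *\<^sub>R (f x * \<phi> x))"
      by (simp only: g(2) f(2) Bochner_Integration.integral_diff[OF g(1) f(1)])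
    also have "norm \<dots> \<le> (LINT x|lborel. e' * (indicator K x *\<^sub>R cmod (\<phi> x)))"
    proof (rule Bochner_Integration.integral_norm_bound_integral)
      show "integrable lborel (\<lambda>x. indicator K x *\<^sub>R (G \<epsilon> x * \<phi> x) - indicator K x *\<^sub>R (f x * \<phi> x))"
        using g(1) f(1) by (rule Bochner_Integration.integrable_diff)
      show "integrable lborel (\<lambda>x. e' * (indicator K x *\<^sub>R cmod (\<phi> x)))" using int by (rule integrable_mult_right)
      fix x
      show "norm (indicator K x *\<^sub>R (G \<epsilon> x * \<phi> x) - indicator K x *\<^sub>R (f x * \<phi> x)) \<le> e' * (indicator K x *\<^sub>R cmod (\<phi> x))"
      proof (cases "x \<in> K")
        case True
        have "norm (G \<epsilon> x * \<phi> x - f x * \<phi> x) = cmod (G \<epsilon> x - f x) * cmod (\<phi> x)"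
          unfolding left_diff_distrib[symmetric] norm_mult ..
        also have "\<dots> \<le> e' * cmod (\<phi> x)"
          using elim(2) True by (intro mult_right_mono) (auto simp: dist_norm less_imp_le)
        finally show ?thesis using True by simp
      qed simp
    qed
    also have "\<dots> = e' * I" unfolding I_def by (rule Bochner_Integration.integral_mult_right_zero)
    also have "\<dots> < e" using e I by (simp add: e'_def field_simps)
    finally show ?case by (simp add: dist_norm)
  qed
qed

text \<open>On the plateau of the cutoff the localized net is the net itself, so there the series of
  \<open>local_limit\<close> is its uniform limit.\<close>

lemma local_trig_series:
  fixes \<Omega> :: "(real^'n::finite) set" and G :: "real \<Rightarrow> real^'n \<Rightarrow> complex" and T :: "(real^'n \<Rightarrow> complex) \<Rightarrow> complex"
  assumes \<Omega>: "open \<Omega>" and M: "weight_seq M" and G: "\<And>\<epsilon>. \<epsilon> \<in> {0<..<1} \<Longrightarrow> G \<epsilon> \<in> ultradiff M \<Omega>"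
    and approx: "\<And>K. regular_compact \<Omega> K \<Longrightarrow>
      \<exists>k\<in>roumieu_seqs. \<exists>l\<in>roumieu_seqs. \<exists>b\<in>roumieu_seqs.
        (\<forall>i\<ge>1. b i \<le> k i) \<and>
        (\<forall>h\<in>roumieu_seqs.
           net_bigo (\<lambda>\<epsilon>. useminorm M h K (G \<epsilon>)) (\<lambda>\<epsilon>. exp (assoc_fun M k (1 / \<epsilon>)))) \<and>
        (\<exists>C>0. \<exists>\<epsilon>0\<in>{0<..<1}. \<forall>\<phi>\<in>test_on M \<Omega> K. \<forall>\<epsilon>\<in>{0<..<\<epsilon>0}.
           ennreal (cmod (pairing \<Omega> (G \<epsilon>) \<phi> - T \<phi>))
             \<le> ennreal (C * exp (- assoc_fun M b (1 / \<epsilon>))) * useminorm M l K \<phi>)"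
    and x: "x \<in> \<Omega>"
  shows "\<exists>U c. open U \<and> x \<in> U \<and> U \<subseteq> \<Omega> \<and> decaying M c \<and> uniform_limit U G (trig_series c) (at_right 0)"
proof -
  obtain d where d: "d > 0" "d < pi" "cube x d \<subseteq> \<Omega>" using cube_nhds[OF \<Omega> x] by blast
  let ?Q = "cube x d"
  \<comment> \<open>Radius d / 4 gives the plateau \<open>cube x (d / 4)\<close> and keeps the
    support in \<open>cube x d\<close>.\<close>
  obtain \<kappa> :: "nat \<Rightarrow> real \<Rightarrow> real" and L where \<kappa>: "L > 0" "\<forall>q t. (\<kappa> q has_real_derivative \<kappa> (Suc q) t) (at t)"
    "\<forall>t. \<bar>t\<bar> \<le> d / 4 \<longrightarrow> \<kappa> 0 t = 1" "\<forall>q t. \<bar>t\<bar> \<ge> 4 * (d / 4) \<longrightarrow> \<kappa> q t = 0" "\<forall>q t. \<bar>\<kappa> q t\<bar> \<le> L ^ q * M q"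
    using ultradiff_bump[OF M, of "d / 4"] d(1) by auto
  interpret local_cutoff M \<Omega> x d L \<kappa>
    by unfold_locales (use M \<Omega> d \<kappa> in auto)
  have regQ: "regular_compact \<Omega> ?Q"
    by (rule regular_compact_convex[OF _ d(3)]) (auto simp: cube_def)
  from approx[OF regQ] obtain k l b where k: "k \<in> roumieu_seqs" and l: "l \<in> roumieu_seqs" and b: "b \<in> roumieu_seqs"
    and bk: "\<forall>i\<ge>1. b i \<le> k i"
    and reg: "\<forall>h\<in>roumieu_seqs. net_bigo (\<lambda>\<epsilon>. useminorm M h ?Q (G \<epsilon>)) (\<lambda>\<epsilon>. exp (assoc_fun M k (1 / \<epsilon>)))"
    and assoc: "\<exists>C>0. \<exists>\<epsilon>0\<in>{0<..<1}. \<forall>\<phi>\<in>test_on M \<Omega> ?Q. \<forall>\<epsilon>\<in>{0<..<\<epsilon>0}.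
           ennreal (cmod (pairing \<Omega> (G \<epsilon>) \<phi> - T \<phi>))
             \<le> ennreal (C * exp (- assoc_fun M b (1 / \<epsilon>))) * useminorm M l ?Q \<phi>"
    by blast
  have l2: "(halved l) \<in> roumieu_seqs" by (rule halved_roumieu[OF l])
  have "\<exists>c. decaying M c \<and> (\<exists>B. \<exists>\<epsilon>0>0. \<forall>\<epsilon>\<in>{0<..<\<epsilon>0}. \<forall>y\<in>cube x pi.
      cmod (cutoff y * G \<epsilon> y - trig_series c y) \<le> B * exp (- assoc_fun M b (1 / \<epsilon>) / 2))"
  proof (rule local_limit[OF k b l2])
    show "b i \<le> k i" if "i \<ge> 1" for i using bk that by blast
    show "smooth_on \<Omega> (G \<epsilon>)" if "\<epsilon> \<in> {0<..<1}" for \<epsilon> using G[OF that] by (simp add: ultradiff_def)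
    show "\<exists>B. pure_derivs_le ?Q (G \<epsilon>) B (wt M h)"
      if \<epsilon>: "\<epsilon> \<in> {0<..<1}" and h: "h \<in> roumieu_seqs" for \<epsilon> h
    proof -
      have "useminorm M h ?Q (G \<epsilon>) < \<infinity>" using G[OF \<epsilon>] regQ h by (simp add: ultradiff_def)
      then obtain B where B: "B \<ge> 0" "useminorm M h ?Q (G \<epsilon>) = ennreal B"
        by (metis ennreal_cases infinity_ennreal_def less_irrefl)
      show ?thesis using useminorm_upper[OF M h eq_refl[OF B(2)] B(1)] by blast
    qed
    show "\<exists>C. \<exists>\<epsilon>0>0. \<forall>\<epsilon>\<in>{0<..<\<epsilon>0}. pure_derivs_le ?Q (G \<epsilon>) (C * exp (assoc_fun M k (1 / \<epsilon>))) (wt M h)"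
      if h: "h \<in> roumieu_seqs" for h
    proof -
      obtain C \<epsilon>0 where C: "C > 0" "\<epsilon>0 \<in> {0<..<1}"
        "\<forall>\<epsilon>\<in>{0<..<\<epsilon>0}. useminorm M h ?Q (G \<epsilon>) \<le> ennreal (C * exp (assoc_fun M k (1 / \<epsilon>)))"
        using reg h unfolding net_bigo_def by blast
      have "cmod (foldr partial (replicate q j) (G \<epsilon>) y) \<le> (C * exp (assoc_fun M k (1 / \<epsilon>))) * wt M h q"
        if "\<epsilon> \<in> {0<..<\<epsilon>0}" "y \<in> ?Q" for \<epsilon> y j q
        by (rule useminorm_upper[OF M h C(3)[rule_format, OF that(1)] _ that(2)]) (use C(1) in simp)
      then show ?thesis using C(2) by (intro exI[of _ C] exI[of _ \<epsilon>0]) simp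
    qed
    obtain C \<epsilon>0 where C: "C > 0" "\<epsilon>0 \<in> {0<..<1}" "\<forall>\<phi>\<in>test_on M \<Omega> ?Q. \<forall>\<epsilon>\<in>{0<..<\<epsilon>0}.
           ennreal (cmod (pairing \<Omega> (G \<epsilon>) \<phi> - T \<phi>))
             \<le> ennreal (C * exp (- assoc_fun M b (1 / \<epsilon>))) * useminorm M l ?Q \<phi>"
      using assoc by blast
    obtain D where D: "D > 0" "\<forall>i. useminorm M l ?Q (packet i) \<le>
        ennreal (D * exp (real CARD('n) * assoc_fun M (halved l) (sup_norm i)))"
      using useminorm_packet[OF l] by blast
    have "cmod (pairing \<Omega> (G \<epsilon>) (packet i) - T (packet i))
        \<le> (C * D) * exp (- assoc_fun M b (1 / \<epsilon>)) * exp (real CARD('n) * assoc_fun M (halved l) (sup_norm i))"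
      if \<epsilon>: "\<epsilon> \<in> {0<..<\<epsilon>0}" for \<epsilon> i
    proof -
      let ?E = "exp (real CARD('n) * assoc_fun M (halved l) (sup_norm i))"
      have "ennreal (cmod (pairing \<Omega> (G \<epsilon>) (packet i) - T (packet i)))
          \<le> ennreal (C * exp (- assoc_fun M b (1 / \<epsilon>))) * useminorm M l ?Q (packet i)"
        using C(3) packet_in_test_on \<epsilon> by blast
      also have "\<dots> \<le> ennreal (C * exp (- assoc_fun M b (1 / \<epsilon>))) * ennreal (D * ?E)"
        by (rule mult_left_mono) (use D(2) in auto)
      also have "\<dots> = ennreal ((C * exp (- assoc_fun M b (1 / \<epsilon>))) * (D * ?E))"
        using C(1) D(1) by (intro ennreal_mult[symmetric]) auto
      finally have "cmod (pairing \<Omega> (G \<epsilon>) (packet i) - T (packet i)) \<le> (C * exp (- assoc_fun M b (1 / \<epsilon>))) * (D * ?E)"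
        using C(1) D(1) by (subst (asm) ennreal_le_iff) auto
      then show ?thesis by (simp add: mult_ac)
    qed
    then show "\<exists>C. \<exists>\<epsilon>0>0. \<forall>\<epsilon>\<in>{0<..<\<epsilon>0}. \<forall>i. cmod (pairing \<Omega> (G \<epsilon>) (packet i) - T (packet i))
      \<le> C * exp (- assoc_fun M b (1 / \<epsilon>)) * exp (real CARD('n) * assoc_fun M (halved l) (sup_norm i))"
      using C(2) by (intro exI[of _ "C * D"] exI[of _ \<epsilon>0]) simp
  qed
  then obtain c B \<epsilon>0 where c: "decaying M c" and \<epsilon>0: "\<epsilon>0 > 0" and B: "\<forall>\<epsilon>\<in>{0<..<\<epsilon>0}. \<forall>y\<in>cube x pi.
      cmod (cutoff y * G \<epsilon> y - trig_series c y) \<le> B * exp (- assoc_fun M b (1 / \<epsilon>) / 2)"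
    by blast
  define U where "U = box (x - (\<chi> j. d / 4)) (x + (\<chi> j. d / 4))"
  have U: "y \<in> cube x (d / 4)" if "y \<in> U" for y
    using that unfolding U_def cube_def mem_box_cart by (auto intro: less_imp_le)
  have sub: "cube x (d / 4) \<subseteq> cube x d" "cube x d \<subseteq> cube x pi"
    using d(1,2) by (auto intro!: cube_mono)
  have cut1: "cutoff y = 1" if "y \<in> U" for y
    using U[OF that] \<kappa>(3) by (simp add: cutoff_def tensor_def cutoff_factor_def mem_cube)
  have "uniform_limit U G (trig_series c) (at_right 0)"
  proof (rule uniform_limitI)
    fix e :: real assume "e > 0"
    have "\<forall>\<^sub>F \<epsilon> in at_right 0. \<epsilon> \<in> {0<..<\<epsilon>0}" using \<epsilon>0 by (rule eventually_at_rightI[rotated]) simp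
    moreover have "\<forall>\<^sub>F \<epsilon> in at_right 0. B * exp (- assoc_fun M b (1 / \<epsilon>) / 2) < e"
      using exp_assoc_fun_tendsto_0[OF M b, of 2 B] \<open>e > 0\<close> by (intro order_tendstoD(2)) auto
    ultimately show "\<forall>\<^sub>F \<epsilon> in at_right 0. \<forall>y\<in>U. dist (G \<epsilon> y) (trig_series c y) < e"
    proof eventually_elim
      case (elim \<epsilon>)
      have "cmod (G \<epsilon> y - trig_series c y) < e" if y: "y \<in> U" for y
      proof -
        have "y \<in> cube x pi" using U[OF y] sub by blast
        then have "cmod (cutoff y * G \<epsilon> y - trig_series c y) \<le> B * exp (- assoc_fun M b (1 / \<epsilon>) / 2)"
          using B elim(1) by blast
        then show ?thesis using elim(2) by (simp add: cut1[OF y])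
      qed
      then show ?case by (simp add: dist_norm)
    qed
  qed
  moreover have "open U" "x \<in> U" using d(1) by (simp_all add: U_def mem_box_cart open_box)
  moreover have "U \<subseteq> \<Omega>" using U sub d(3) by blast
  ultimately show ?thesis using c by (intro exI[of _ U] exI[of _ c] conjI)
qed

theorem theorem3:
  fixes \<Omega> :: "(real^'n::finite) set"
    and M :: "nat \<Rightarrow> real"
    and g :: "(real \<Rightarrow> real^'n \<Rightarrow> complex) set"
    and g_rep :: "real \<Rightarrow> real^'n \<Rightarrow> complex"
    and T :: "(real^'n \<Rightarrow> complex) \<Rightarrow> complex"
  assumes "open \<Omega>"
    and "weight_seq M"
    and "g \<in> generalized_ultradistributions M \<Omega>"
    and "g_rep \<in> g"
    and "T \<in> ultradistributions M \<Omega>"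
    and "\<And>K. regular_compact \<Omega> K \<Longrightarrow>
      \<exists>k\<in>roumieu_seqs. \<exists>l\<in>roumieu_seqs. \<exists>b\<in>roumieu_seqs.
        (\<forall>i\<ge>1. b i \<le> k i) \<and>
        (\<forall>h\<in>roumieu_seqs.
           net_bigo (\<lambda>\<epsilon>. useminorm M h K (g_rep \<epsilon>)) (\<lambda>\<epsilon>. exp (assoc_fun M k (1 / \<epsilon>)))) \<and>
        (\<exists>C>0. \<exists>\<epsilon>0\<in>{0<..<1}. \<forall>\<phi>\<in>test_on M \<Omega> K. \<forall>\<epsilon>\<in>{0<..<\<epsilon>0}.
           ennreal (cmod (pairing \<Omega> (g_rep \<epsilon>) \<phi> - T \<phi>))
             \<le> ennreal (C * exp (- assoc_fun M b (1 / \<epsilon>))) * useminorm M l K \<phi>)"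
  shows "\<exists>f\<in>ultradiff M \<Omega>. \<forall>\<phi>\<in>test_functions M \<Omega>. T \<phi> = pairing \<Omega> f \<phi>"
proof -
  note \<Omega> = assms(1) and M = assms(2) and approx = assms(6)
  have "g_rep \<in> moderate_nets M \<Omega>"
    using assms(3,4) unfolding generalized_ultradistributions_def quotient_def by auto
  then have G: "g_rep \<epsilon> \<in> ultradiff M \<Omega>" if "\<epsilon> \<in> {0<..<1}" for \<epsilon>
    using that by (simp add: moderate_nets_def)
  \<comment> \<open>As a pointwise limit of the net, f does not depend on a centre; the local series
    therefore agree wherever their neighbourhoods overlap.\<close>
  define f where "f x = Lim (at_right 0) (\<lambda>\<epsilon>. g_rep \<epsilon> x)" for x
  have "\<forall>x\<in>\<Omega>. \<exists>U c. open U \<and> x \<in> U \<and> U \<subseteq> \<Omega> \<and> decaying M c \<and> uniform_limit U g_rep (trig_series c) (at_right 0)"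
    using local_trig_series[OF \<Omega> M G approx] by blast
  then obtain U c where U: "\<And>x. x \<in> \<Omega> \<Longrightarrow> open (U x)" "\<And>x. x \<in> \<Omega> \<Longrightarrow> x \<in> U x"
    "\<And>x. x \<in> \<Omega> \<Longrightarrow> U x \<subseteq> \<Omega>" "\<And>x. x \<in> \<Omega> \<Longrightarrow> decaying M (c x)"
    "\<And>x. x \<in> \<Omega> \<Longrightarrow> uniform_limit (U x) g_rep (trig_series (c x)) (at_right 0)"
    by metis
  have f_eq: "f y = trig_series (c x) y" if "x \<in> \<Omega>" "y \<in> U x" for x y
    unfolding f_def by (rule tendsto_Lim[OF trivial_limit_at_right_real tendsto_uniform_limitI[OF U(5)[OF that(1)] that(2)]])
  have f_deriv: "foldr partial js f y = foldr partial js (trig_series (c x)) y" if "x \<in> \<Omega>" "y \<in> U x" for x y js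
    by (rule foldr_partial_cong[OF U(1)[OF that(1)] f_eq[OF that(1)] that(2)])
  have smooth: "smooth_on \<Omega> f"
    unfolding smooth_on_def differentiable_on_def
  proof (intro allI ballI)
    fix js x assume x: "x \<in> \<Omega>"
    obtain D where "(foldr partial js (trig_series (c x)) has_derivative D) (at x)"
      using foldr_partial_trig_series_differentiable[OF M U(4)[OF x]] unfolding differentiable_def by blast
    then have "(foldr partial js f has_derivative D) (at x)"
      by (rule has_derivative_transform_within_open[OF _ U(1,2)[OF x]]) (simp add: f_deriv[OF x])
    then show "foldr partial js f differentiable (at x within \<Omega>)"
      unfolding differentiable_def using has_derivative_at_withinI by blast
  qed
  have cover: "\<exists>C. finite C \<and> C \<subseteq> \<Omega> \<and> K \<subseteq> (\<Union>x\<in>C. U x)" if K: "compact K" "K \<subseteq> \<Omega>" for K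
  proof (rule compactE_image[OF K(1), of K U])
    show "open (U x)" if "x \<in> K" for x using U(1) that K(2) by blast
    show "K \<subseteq> (\<Union>x\<in>K. U x)" using U(2) K(2) by blast
    show "\<exists>C. finite C \<and> C \<subseteq> \<Omega> \<and> K \<subseteq> (\<Union>x\<in>C. U x)"
      if "C \<subseteq> K" "finite C" "K \<subseteq> (\<Union>x\<in>C. U x)" for C
      using that K(2) by (intro exI[of _ C]) blast
  qed
  have "useminorm M r K f < \<infinity>" if K: "regular_compact \<Omega> K" and r: "r \<in> roumieu_seqs" for K r
  proof -
    have "compact K" "K \<subseteq> \<Omega>" using K by (auto simp: regular_compact_def)
    from cover[OF this] obtain C where C: "finite C" "C \<subseteq> \<Omega>" "K \<subseteq> (\<Union>x\<in>C. U x)" by (elim exE conjE)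
    have "\<forall>x\<in>\<Omega>. \<exists>B. \<forall>js y. cmod (foldr partial js (trig_series (c x)) y) \<le> B * wt M r (length js)"
      using foldr_partial_trig_series_bound[OF M U(4) r] by blast
    then obtain B where B: "\<And>x js y. x \<in> \<Omega> \<Longrightarrow> cmod (foldr partial js (trig_series (c x)) y) \<le> B x * wt M r (length js)"
      by metis
    \<comment> \<open>The sum over the finite subcover dominates each local constant; absolute
      values make all summands nonnegative.\<close>
    define B' where "B' = (\<Sum>x\<in>C. \<bar>B x\<bar>)"
    have "useminorm M r K f \<le> ennreal B'"
      unfolding useminorm_def
    proof (rule SUP_least)
      fix z :: "(real^'n) \<times> ('n \<Rightarrow> nat)" assume "z \<in> K \<times> UNIV"
      then obtain y \<alpha> where z: "z = (y, \<alpha>)" and y: "y \<in> K" by auto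
      obtain x where x: "x \<in> C" "y \<in> U x" using C(3) y by blast
      \<comment> \<open>The bound holds for derivatives along every list, in particular for the one
        chosen by \<open>multi_deriv\<close>.\<close>
      define js where "js = (SOME js. \<forall>i. count_list js i = \<alpha> i)"
      have "count_list js i = \<alpha> i" for i unfolding js_def by (rule count_list_some)
      then have len: "length js = order_of \<alpha>" unfolding length_eq_order_of by simp
      have "\<bar>B x\<bar> \<le> B'" unfolding B'_def by (rule member_le_sum) (use x C(1) in auto)
      then have "B x \<le> B'" by simp
      then have le: "B x * wt M r (order_of \<alpha>) \<le> B' * wt M r (order_of \<alpha>)"
        using wt_pos[OF M r, of "order_of \<alpha>"] by (intro mult_right_mono) auto
      have x\<Omega>: "x \<in> \<Omega>" using x(1) C(2) by blast
      have "cmod (foldr partial js f y) \<le> B' * wt M r (order_of \<alpha>)"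
        using order_trans[OF B[OF x\<Omega>, of js y, unfolded len] le] unfolding f_deriv[OF x\<Omega> x(2)] .
      then have "ennreal (cmod (foldr partial js f y) / wt M r (order_of \<alpha>)) \<le> ennreal B'"
        using wt_pos[OF M r, of "order_of \<alpha>"] by (intro ennreal_leI) (simp add: pos_divide_le_eq)
      then show "(case z of (x, \<alpha>) \<Rightarrow> ennreal (cmod (multi_deriv \<alpha> f x) /
          (M (order_of \<alpha>) * (\<Prod>i=1..order_of \<alpha>. r i)))) \<le> ennreal B'"
        by (simp add: z multi_deriv_def wt_def js_def)
    qed
    also have "\<dots> < \<infinity>" by simp
    finally show ?thesis .
  qed
  with smooth have f: "f \<in> ultradiff M \<Omega>" by (simp add: ultradiff_def)
  have "T \<phi> = pairing \<Omega> f \<phi>" if tf: "\<phi> \<in> test_functions M \<Omega>" for \<phi>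
  proof -
    obtain K where K: "regular_compact \<Omega> K" and \<phi>: "\<phi> \<in> test_on M \<Omega> K"
      using tf by (auto simp: test_functions_def)
    have cK: "compact K" "K \<subseteq> \<Omega>" using K by (auto simp: regular_compact_def)
    have supp: "\<phi> x = 0" if "x \<notin> K" for x
      using \<phi> that closure_subset[of "{x. \<phi> x \<noteq> 0}"] by (auto simp: test_on_def)
    have cont: "continuous_on K h" if "h \<in> ultradiff M \<Omega>" for h
      using that by (intro continuous_on_subset[OF smooth_on_continuous cK(2)]) (simp add: ultradiff_def)
    obtain C where C: "finite C" "C \<subseteq> \<Omega>" "K \<subseteq> (\<Union>x\<in>C. U x)"
      using cover[OF cK] by (elim exE conjE)
    \<comment> \<open>Uniform convergence on finitely many neighbourhoods gives uniform convergence
      on K, and with it passage to the limit under the integral.\<close>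
    have "uniform_limit (\<Union>x\<in>C. U x) g_rep f (at_right 0)"
    proof (rule uniform_limit_on_UNION[OF C(1)])
      fix x assume "x \<in> C"
      then have x: "x \<in> \<Omega>" using C(2) by blast
      show "uniform_limit (U x) g_rep f (at_right 0)"
        using U(5)[OF x] by (rule uniform_limit_cong'[THEN iffD1, rotated -1]) (auto simp: f_eq[OF x])
    qed
    then have ul: "uniform_limit K g_rep f (at_right 0)" by (rule uniform_limit_on_subset[OF _ C(3)])
    have ev1: "\<forall>\<^sub>F \<epsilon> in at_right 0. \<epsilon> \<in> {0<..<1::real}" by (rule eventually_at_rightI[of 0 1]) auto
    have "((\<lambda>\<epsilon>. pairing \<Omega> (g_rep \<epsilon>) \<phi>) \<longlongrightarrow> pairing \<Omega> f \<phi>) (at_right 0)"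
      by (rule pairing_tendsto[OF cK supp _ _ _ ul])
        (use \<phi> in \<open>auto intro: cont f eventually_mono[OF ev1 cont[OF G]] simp: test_on_def\<close>)
    \<comment> \<open>Association on a compact set that carries \<phi>: its seminorm there is
      finite, so the error tends to 0.\<close>
    moreover have "((\<lambda>\<epsilon>. pairing \<Omega> (g_rep \<epsilon>) \<phi>) \<longlongrightarrow> T \<phi>) (at_right 0)"
    proof -
      obtain l b where l: "l \<in> roumieu_seqs" and b: "b \<in> roumieu_seqs" and
        "\<exists>C>0. \<exists>\<epsilon>0\<in>{0<..<1}. \<forall>\<phi>\<in>test_on M \<Omega> K. \<forall>\<epsilon>\<in>{0<..<\<epsilon>0}.
           ennreal (cmod (pairing \<Omega> (g_rep \<epsilon>) \<phi> - T \<phi>))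
             \<le> ennreal (C * exp (- assoc_fun M b (1 / \<epsilon>))) * useminorm M l K \<phi>"
        using approx[OF K] by blast
      then obtain A \<epsilon>0 where A: "A > 0" "\<epsilon>0 \<in> {0<..<1}" "\<forall>\<epsilon>\<in>{0<..<\<epsilon>0}.
           ennreal (cmod (pairing \<Omega> (g_rep \<epsilon>) \<phi> - T \<phi>))
             \<le> ennreal (A * exp (- assoc_fun M b (1 / \<epsilon>))) * useminorm M l K \<phi>"
        using \<phi> by blast
      have "useminorm M l K \<phi> < \<infinity>" using \<phi> K l by (simp add: test_on_def ultradiff_def)
      then obtain S where S: "S \<ge> 0" "useminorm M l K \<phi> = ennreal S"
        by (metis ennreal_cases infinity_ennreal_def less_irrefl)
      have bound: "norm (pairing \<Omega> (g_rep \<epsilon>) \<phi> - T \<phi>) \<le> (A * S) * exp (- assoc_fun M b (1 / \<epsilon>) / 1)"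
        if "\<epsilon> \<in> {0<..<\<epsilon>0}" for \<epsilon>
      proof -
        have "ennreal (cmod (pairing \<Omega> (g_rep \<epsilon>) \<phi> - T \<phi>)) \<le> ennreal (A * exp (- assoc_fun M b (1 / \<epsilon>)) * S)"
          using A(3)[rule_format, OF that] A(1) S by (simp add: ennreal_mult[symmetric])
        then show ?thesis using A(1) S(1) by (subst (asm) ennreal_le_iff) (simp_all add: mult_ac)
      qed
      have "\<forall>\<^sub>F \<epsilon> in at_right 0. \<epsilon> \<in> {0<..<\<epsilon>0}" using A(2) by (intro eventually_at_rightI[of 0 \<epsilon>0]) auto
      then have "\<forall>\<^sub>F \<epsilon> in at_right 0. norm (pairing \<Omega> (g_rep \<epsilon>) \<phi> - T \<phi>) \<le> (A * S) * exp (- assoc_fun M b (1 / \<epsilon>) / 1)"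
        by eventually_elim (rule bound)
      then have "((\<lambda>\<epsilon>. pairing \<Omega> (g_rep \<epsilon>) \<phi> - T \<phi>) \<longlongrightarrow> 0) (at_right 0)"
        by (rule Lim_null_comparison[OF _ exp_assoc_fun_tendsto_0[OF M b zero_less_one]])
      then show ?thesis by (simp only: LIM_zero_iff)
    qed
    ultimately show ?thesis using tendsto_unique[OF trivial_limit_at_right_real] by blast
  qed
  with f show ?thesis by blast
qed

end
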